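(* Let $\mathcal V$ be an operator system, and suppose that $p \in \mathcal V$ is an abstract projection. Then $p$ is a projection in its C*-envelope $C_e^*(\mathcal V)$.
   Context: Let $(\mathcal V, \{C_n\}_n, e)$ be an abstract operator system. For a positive contraction $p \in \mathcal V$ (i.e. $0 \leq p \leq e$) let $\alpha_m(p) = \sup\{|\varphi(p)| : \varphi \text{ a state on } \mathcal V\}$, and set $q = e - p$. For each $n$ define $C((p \oplus q)_n) = \{ x \in M_{2n}(\mathcal V) : x = x^*, \ \forall \epsilon > 0 \ \exists t > 0 \text{ such that } x + \epsilon (p\oplus q)_n + t (q \oplus p)_n \in C_{2n}\}$, and $J_{p \oplus q} = \operatorname{span}\big(C(p\oplus q) \cap -C(p \oplus q)\big)$. The quotient $M_2(\mathcal V)/J_{p\oplus q}$ with the image cones and unit $(p\oplus q)+J_{p\oplus q}$ is an operator system when $\alpha_m(p)=1$. The element $p$ is an abstract projection if $0 \leq p \leq e$, $\alpha_m(p)=1$, and $\pi_p: \mathcal V \to M_2(\mathcal V)/J_{p\oplus q}$, $\pi_p(x) = \begin{pmatrix} x & x \\ x & x \end{pmatrix} + J_{p \oplus q}$, is a complete order isomorphism. $C_e^*(\mathcal V)$ denotes the C*-envelope of $\mathcal V$, with $\mathcal V$ identified with its image under the canonical unital complete order embedding. *)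

theory Defs
  imports Complex_Main "HOL-Library.Function_Algebras"
begin

definition Mat :: "nat \<Rightarrow> (nat \<Rightarrow> nat \<Rightarrow> 'v::zero) set" where
  "Mat n = {x. \<forall>i j. \<not> (i < n \<and> j < n) \<longrightarrow> x i j = 0}"

definition mstar :: "('v \<Rightarrow> 'v) \<Rightarrow> nat \<Rightarrow> (nat \<Rightarrow> nat \<Rightarrow> 'v::zero) \<Rightarrow> nat \<Rightarrow> nat \<Rightarrow> 'v" where
  "mstar st n x = (\<lambda>i j. if i < n \<and> j < n then st (x j i) else 0)"

definition msc :: "(complex \<Rightarrow> 'v \<Rightarrow> 'v) \<Rightarrow> complex \<Rightarrow> (nat \<Rightarrow> nat \<Rightarrow> 'v) \<Rightarrow> nat \<Rightarrow> nat \<Rightarrow> 'v" where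
  "msc sm c x = (\<lambda>i j. sm c (x i j))"

text \<open>congruence alpha^* x alpha for a complex n x m matrix alpha and x in M_n(V)\<close>
definition congr :: "(complex \<Rightarrow> 'v \<Rightarrow> 'v::comm_monoid_add) \<Rightarrow> nat \<Rightarrow> nat \<Rightarrow> (nat \<Rightarrow> nat \<Rightarrow> complex)
     \<Rightarrow> (nat \<Rightarrow> nat \<Rightarrow> 'v) \<Rightarrow> nat \<Rightarrow> nat \<Rightarrow> 'v" where
  "congr sm n m \<alpha> x = (\<lambda>i j. if i < m \<and> j < m then
       (\<Sum>k<n. \<Sum>l<n. sm (cnj (\<alpha> k i) * \<alpha> l j) (x k l)) else 0)"

definition dunit :: "nat \<Rightarrow> 'v::zero \<Rightarrow> nat \<Rightarrow> nat \<Rightarrow> 'v" where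
  "dunit n v = (\<lambda>i j. if i = j \<and> i < n then v else 0)"

text \<open>Abstract operator system in the sense of Choi--Effros: complex vector space with
 involution, matrix cones C n in M_n(V), and an Archimedean matrix order unit e.\<close>
definition operator_system ::
  "(complex \<Rightarrow> 'v \<Rightarrow> 'v) \<Rightarrow> ('v \<Rightarrow> 'v) \<Rightarrow> (nat \<Rightarrow> (nat \<Rightarrow> nat \<Rightarrow> 'v::ab_group_add) set) \<Rightarrow> 'v \<Rightarrow> bool" where
  "operator_system sm st C e \<longleftrightarrow>
     (\<forall>v. sm 1 v = v) \<and> (\<forall>a b v. sm a (sm b v) = sm (a * b) v) \<and>
     (\<forall>a b v. sm (a + b) v = sm a v + sm b v) \<and> (\<forall>a v w. sm a (v + w) = sm a v + sm a w) \<and>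
     (\<forall>v. st (st v) = v) \<and> (\<forall>v w. st (v + w) = st v + st w) \<and>
     (\<forall>a v. st (sm a v) = sm (cnj a) (st v)) \<and>
     (\<forall>n. C n \<subseteq> Mat n \<and> (\<forall>x\<in>C n. mstar st n x = x)) \<and>
     (\<forall>n x y. x \<in> C n \<longrightarrow> y \<in> C n \<longrightarrow> x + y \<in> C n) \<and>
     (\<forall>n m \<alpha> x. x \<in> C n \<longrightarrow> congr sm n m \<alpha> x \<in> C m) \<and>
     (\<forall>n. C n \<inter> uminus ` C n = {0}) \<and>
     st e = e \<and>
     (\<forall>n x. x \<in> Mat n \<and> mstar st n x = x \<longrightarrow>
        (\<exists>r>0. msc sm (complex_of_real r) (dunit n e) + x \<in> C n)) \<and>
     (\<forall>n x. x \<in> Mat n \<and> mstar st n x = x \<and>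
        (\<forall>\<epsilon>>0. msc sm (complex_of_real \<epsilon>) (dunit n e) + x \<in> C n) \<longrightarrow> x \<in> C n)"

definition state ::
  "(complex \<Rightarrow> 'v \<Rightarrow> 'v) \<Rightarrow> (nat \<Rightarrow> (nat \<Rightarrow> nat \<Rightarrow> 'v::ab_group_add) set) \<Rightarrow> 'v \<Rightarrow> ('v \<Rightarrow> complex) \<Rightarrow> bool" where
  "state sm C e \<phi> \<longleftrightarrow>
     (\<forall>v w. \<phi> (v + w) = \<phi> v + \<phi> w) \<and> (\<forall>a v. \<phi> (sm a v) = a * \<phi> v) \<and> \<phi> e = 1 \<and>
     (\<forall>v. dunit 1 v \<in> C 1 \<longrightarrow> Im (\<phi> v) = 0 \<and> Re (\<phi> v) \<ge> 0)"

definition alpha_m ::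
  "(complex \<Rightarrow> 'v \<Rightarrow> 'v) \<Rightarrow> (nat \<Rightarrow> (nat \<Rightarrow> nat \<Rightarrow> 'v::ab_group_add) set) \<Rightarrow> 'v \<Rightarrow> 'v \<Rightarrow> real" where
  "alpha_m sm C e p = Sup {cmod (\<phi> p) | \<phi>. state sm C e \<phi>}"

text \<open>(p \<oplus> q)_n as a 2n x 2n matrix, via the canonical identification M_n(M_2(V)) = M_{2n}(V)
 (entry (2i+k,2j+l) is entry (k,l) of block (i,j)).\<close>
definition dpq :: "nat \<Rightarrow> 'v::zero \<Rightarrow> 'v \<Rightarrow> nat \<Rightarrow> nat \<Rightarrow> 'v" where
  "dpq n p q = (\<lambda>i j. if i = j \<and> i < 2 * n then (if even i then p else q) else 0)"

definition Cpq ::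
  "(complex \<Rightarrow> 'v \<Rightarrow> 'v) \<Rightarrow> ('v \<Rightarrow> 'v) \<Rightarrow> (nat \<Rightarrow> (nat \<Rightarrow> nat \<Rightarrow> 'v::ab_group_add) set) \<Rightarrow> 'v \<Rightarrow> 'v
     \<Rightarrow> nat \<Rightarrow> (nat \<Rightarrow> nat \<Rightarrow> 'v) set" where
  "Cpq sm st C e p n = {x \<in> Mat (2 * n). mstar st (2 * n) x = x \<and>
      (\<forall>\<epsilon>>0. \<exists>t>0. x + msc sm (complex_of_real \<epsilon>) (dpq n p (e - p))
                       + msc sm (complex_of_real t) (dpq n (e - p) p) \<in> C (2 * n))}"

definition cspan :: "(complex \<Rightarrow> 'v \<Rightarrow> 'v) \<Rightarrow> (nat \<Rightarrow> nat \<Rightarrow> 'v::ab_group_add) set \<Rightarrow> (nat \<Rightarrow> nat \<Rightarrow> 'v) set" where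
  "cspan sm S = {x. \<exists>cs xs. set xs \<subseteq> S \<and> length cs = length xs \<and>
                        x = sum_list (map2 (\<lambda>c y. msc sm c y) cs xs)}"

definition Jpq ::
  "(complex \<Rightarrow> 'v \<Rightarrow> 'v) \<Rightarrow> ('v \<Rightarrow> 'v) \<Rightarrow> (nat \<Rightarrow> (nat \<Rightarrow> nat \<Rightarrow> 'v::ab_group_add) set) \<Rightarrow> 'v \<Rightarrow> 'v
     \<Rightarrow> (nat \<Rightarrow> nat \<Rightarrow> 'v) set" where
  "Jpq sm st C e p = cspan sm (Cpq sm st C e p 1 \<inter> uminus ` Cpq sm st C e p 1)"

text \<open>y (a 2n x 2n matrix) lies in M_n(J), J a subspace of M_2(V)\<close>
definition blocks_in :: "nat \<Rightarrow> (nat \<Rightarrow> nat \<Rightarrow> 'v::zero) set \<Rightarrow> (nat \<Rightarrow> nat \<Rightarrow> 'v) \<Rightarrow> bool" where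
  "blocks_in n J y \<longleftrightarrow> y \<in> Mat (2 * n) \<and>
     (\<forall>i<n. \<forall>j<n. (\<lambda>k l. if k < 2 \<and> l < 2 then y (2 * i + k) (2 * j + l) else 0) \<in> J)"

text \<open>the n-th amplification of x \<mapsto> [[x,x],[x,x]], as a 2n x 2n matrix\<close>
definition pimat :: "nat \<Rightarrow> (nat \<Rightarrow> nat \<Rightarrow> 'v::zero) \<Rightarrow> nat \<Rightarrow> nat \<Rightarrow> 'v" where
  "pimat n x = (\<lambda>a b. if a < 2 * n \<and> b < 2 * n then x (a div 2) (b div 2) else 0)"

text \<open>Abstract projection: 0 \<le> p \<le> e, alpha_m p = 1, and pi_p is a complete order
 isomorphism (onto its image) of V into M_2(V)/J with the image cones
 (a class is positive iff it contains an element of C_{2n}).\<close>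
definition abstract_projection ::
  "(complex \<Rightarrow> 'v \<Rightarrow> 'v) \<Rightarrow> ('v \<Rightarrow> 'v) \<Rightarrow> (nat \<Rightarrow> (nat \<Rightarrow> nat \<Rightarrow> 'v::ab_group_add) set) \<Rightarrow> 'v \<Rightarrow> 'v \<Rightarrow> bool" where
  "abstract_projection sm st C e p \<longleftrightarrow>
     dunit 1 p \<in> C 1 \<and> dunit 1 (e - p) \<in> C 1 \<and> alpha_m sm C e p = 1 \<and>
     (\<forall>x y. pimat 1 (dunit 1 x) - pimat 1 (dunit 1 y) \<in> Jpq sm st C e p \<longrightarrow> x = y) \<and>
     (\<forall>n x. x \<in> Mat n \<longrightarrow>
        (x \<in> C n \<longleftrightarrow> (\<exists>y. blocks_in n (Jpq sm st C e p) y \<and> pimat n x + y \<in> C (2 * n))))"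

definition cstar_alg :: "(complex \<Rightarrow> 'a::{real_normed_algebra_1,banach} \<Rightarrow> 'a) \<Rightarrow> ('a \<Rightarrow> 'a) \<Rightarrow> bool" where
  "cstar_alg sc st \<longleftrightarrow>
     (\<forall>r a. sc (complex_of_real r) a = scaleR r a) \<and>
     (\<forall>c d a. sc c (sc d a) = sc (c * d) a) \<and> (\<forall>c d a. sc (c + d) a = sc c a + sc d a) \<and>
     (\<forall>c a b. sc c (a + b) = sc c a + sc c b) \<and>
     (\<forall>c a b. sc c (a * b) = sc c a * b \<and> sc c (a * b) = a * sc c b) \<and>
     (\<forall>c a. norm (sc c a) = cmod c * norm a) \<and>
     (\<forall>a. st (st a) = a) \<and> (\<forall>a b. st (a + b) = st a + st b) \<and>
     (\<forall>c a. st (sc c a) = sc (cnj c) (st a)) \<and> (\<forall>a b. st (a * b) = st b * st a) \<and>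
     (\<forall>a. norm (st a * a) = (norm a)\<^sup>2)"

definition mpos :: "('a \<Rightarrow> 'a) \<Rightarrow> nat \<Rightarrow> (nat \<Rightarrow> nat \<Rightarrow> 'a::{comm_monoid_add,times}) \<Rightarrow> bool" where
  "mpos st n x \<longleftrightarrow> (\<exists>y. \<forall>i<n. \<forall>j<n. x i j = (\<Sum>k<n. st (y k i) * y k j))"

definition cstar_sub :: "(complex \<Rightarrow> 'a \<Rightarrow> 'a) \<Rightarrow> ('a \<Rightarrow> 'a) \<Rightarrow> 'a::{real_normed_algebra_1} set \<Rightarrow> bool" where
  "cstar_sub sc st B \<longleftrightarrow> 1 \<in> B \<and> (\<forall>a\<in>B. \<forall>b\<in>B. a + b \<in> B \<and> a * b \<in> B) \<and>
     (\<forall>c. \<forall>a\<in>B. sc c a \<in> B) \<and> (\<forall>a\<in>B. st a \<in> B) \<and> closed B"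

definition cstar_gen :: "(complex \<Rightarrow> 'a \<Rightarrow> 'a) \<Rightarrow> ('a \<Rightarrow> 'a) \<Rightarrow> 'a::{real_normed_algebra_1} set \<Rightarrow> 'a set" where
  "cstar_gen sc st S = \<Inter> {B. S \<subseteq> B \<and> cstar_sub sc st B}"

definition closed_ideal :: "(complex \<Rightarrow> 'a \<Rightarrow> 'a) \<Rightarrow> 'a::{real_normed_algebra_1} set \<Rightarrow> bool" where
  "closed_ideal sc I \<longleftrightarrow> I \<noteq> UNIV \<and> 0 \<in> I \<and> (\<forall>a\<in>I. \<forall>b\<in>I. a + b \<in> I) \<and>
     (\<forall>c. \<forall>a\<in>I. sc c a \<in> I) \<and> (\<forall>a. \<forall>b\<in>I. a * b \<in> I \<and> b * a \<in> I) \<and> closed I"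

definition ucoe ::
  "(complex \<Rightarrow> 'v \<Rightarrow> 'v) \<Rightarrow> (nat \<Rightarrow> (nat \<Rightarrow> nat \<Rightarrow> 'v::ab_group_add) set) \<Rightarrow> 'v
    \<Rightarrow> (complex \<Rightarrow> 'a \<Rightarrow> 'a) \<Rightarrow> ('a \<Rightarrow> 'a) \<Rightarrow> ('v \<Rightarrow> 'a::{real_normed_algebra_1}) \<Rightarrow> bool" where
  "ucoe sm C e scA stA \<iota> \<longleftrightarrow>
     (\<forall>v w. \<iota> (v + w) = \<iota> v + \<iota> w) \<and> (\<forall>c v. \<iota> (sm c v) = scA c (\<iota> v)) \<and> \<iota> e = 1 \<and> inj \<iota> \<and>
     (\<forall>n x. x \<in> Mat n \<longrightarrow> (x \<in> C n \<longleftrightarrow> mpos stA n (\<lambda>i j. \<iota> (x i j))))"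

text \<open>boundary ideal (Arveson): a closed ideal I such that the quotient map A \<rightarrow> A/I is a
 complete order embedding on \<iota>(V); positivity in M_n(A/I) means the class contains a
 positive element of M_n(A).\<close>
definition boundary_ideal ::
  "(complex \<Rightarrow> 'v \<Rightarrow> 'v) \<Rightarrow> (nat \<Rightarrow> (nat \<Rightarrow> nat \<Rightarrow> 'v::ab_group_add) set)
    \<Rightarrow> (complex \<Rightarrow> 'a \<Rightarrow> 'a) \<Rightarrow> ('a \<Rightarrow> 'a) \<Rightarrow> ('v \<Rightarrow> 'a::{real_normed_algebra_1}) \<Rightarrow> 'a set \<Rightarrow> bool" where
  "boundary_ideal sm C scA stA \<iota> I \<longleftrightarrow> closed_ideal scA I \<and> (\<forall>v. \<iota> v \<in> I \<longrightarrow> v = 0) \<and>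
     (\<forall>n x. x \<in> Mat n \<longrightarrow>
        (x \<in> C n \<longleftrightarrow> (\<exists>y. mpos stA n y \<and> (\<forall>i<n. \<forall>j<n. \<iota> (x i j) - y i j \<in> I))))"

text \<open>(A, \<iota>) is a C*-envelope of V: \<iota> is a unital complete order embedding, A = C*(\<iota>(V)),
 and the Shilov boundary ideal is trivial, i.e. every boundary ideal for \<iota>(V) is zero.\<close>
definition cstar_envelope ::
  "(complex \<Rightarrow> 'v \<Rightarrow> 'v) \<Rightarrow> (nat \<Rightarrow> (nat \<Rightarrow> nat \<Rightarrow> 'v::ab_group_add) set) \<Rightarrow> 'v
    \<Rightarrow> (complex \<Rightarrow> 'a \<Rightarrow> 'a) \<Rightarrow> ('a \<Rightarrow> 'a) \<Rightarrow> ('v \<Rightarrow> 'a::{real_normed_algebra_1,banach}) \<Rightarrow> bool" where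
  "cstar_envelope sm C e scA stA \<iota> \<longleftrightarrow>
     cstar_alg scA stA \<and> ucoe sm C e scA stA \<iota> \<and> cstar_gen scA stA (range \<iota>) = UNIV \<and>
     (\<forall>I. boundary_ideal sm C scA stA \<iota> I \<longrightarrow> I = {0})"

end

theory Submission
  imports Defs "HOL-Analysis.Function_Topology" "HOL-Analysis.Topology_Euclidean_Space"
    "HOL-Library.Complex_Order" "HOL-Computational_Algebra.Formal_Power_Series"
begin

text \<open>Realise the C*-envelope, through its universal representation, inside the operator system of
  bounded kernels, that is, inside an injective \<open>B(H)\<close>. Since \<open>\<pi>\<^sub>p\<close> is a complete order
  isomorphism that kills \<open>q \<oplus> p\<close>, the map \<open>\<pi>\<^sub>p(x) \<mapsto> x\<close> extends by the Hahn--Banach theorem;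
  composing the extension with \<open>x \<mapsto> [[x, x], [x, x]]\<close> yields a unital completely positive map
  that fixes the operator system and annihilates \<open>p q\<close>, because \<open>p q \<le> p\<close> and \<open>p q \<le> q\<close>. The
  set of all such maps is a compact right topological semigroup, so it contains an idempotent \<open>\<Phi>\<close>.
  By the argument of Choi and Effros, the set of all \<open>a\<close> with \<open>\<Phi>(b a c) = 0\<close> for all \<open>b\<close> and
  \<open>c\<close> is then an ideal containing \<open>p q\<close>, and it is a boundary ideal since \<open>\<Phi>\<close> fixes the
  operator system. In the C*-envelope it vanishes, so \<open>p q = 0\<close>.\<close>

section \<open>Positive functionals and the Hahn--Banach theorem\<close>

text \<open>No Hilbert space is built. \<open>B(H)\<close> is replaced by kernels bounded relative
  to a possibly degenerate unit kernel, and multiplication, which kernels lack, by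
  \<open>move\<close>, which shifts the points. Injectivity becomes scalar: a kernel-valued map
  \<Theta> corresponds to the functional F with
  \<open>\<Theta> b s t = F (ker_unit_block s t b)\<close> on finitely supported matrices, and
  complete positivity of \<Theta> to positivity of F, so one extension treats all points at once.
  These matrices have no order unit in general, hence the set \<open>G\<close> of majorants in place
  of a single unit. Fixing the system and killing \<open>p q\<close> is not enough: nothing makes
  the kernel of such a map stable under multiplication by the system. The Schur complement argument
  for this stability uses idempotency, hence the semigroup. Spectral theory is avoided: positivity
  in the algebra is exhibited by sums of squares, completed by a root of
  \<open>r *\<^sub>R 1 - st a * a\<close>. Conversely, positivity in the system is recovered from
  kernels by separating functionals and the Archimedean axiom, in \<open>C_of_rep\<close>.\<close>

locale star_space = vector_space s
  for s :: "complex \<Rightarrow> 'x::ab_group_add \<Rightarrow> 'x" +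
  fixes star :: "'x \<Rightarrow> 'x" and E :: "'x set"
  assumes E_sub: "subspace E"
    and star_in: "x \<in> E \<Longrightarrow> star x \<in> E"
    and star_add: "x \<in> E \<Longrightarrow> y \<in> E \<Longrightarrow> star (x + y) = star x + star y"
    and star_scale: "x \<in> E \<Longrightarrow> star (s c x) = s (cnj c) (star x)"
    and star_star: "x \<in> E \<Longrightarrow> star (star x) = x"
begin

lemma E_zero: "0 \<in> E" and E_add: "x \<in> E \<Longrightarrow> y \<in> E \<Longrightarrow> x + y \<in> E"
  and E_scale: "x \<in> E \<Longrightarrow> s c x \<in> E" and E_neg: "x \<in> E \<Longrightarrow> - x \<in> E"
  and E_diff: "x \<in> E \<Longrightarrow> y \<in> E \<Longrightarrow> x - y \<in> E"
  using E_sub by (auto simp: subspace_0 subspace_add subspace_scale subspace_neg subspace_diff)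

definition sublinear :: "('x \<Rightarrow> real) \<Rightarrow> bool" where
  "sublinear q \<longleftrightarrow> (\<forall>x\<in>E. \<forall>y\<in>E. q (x + y) \<le> q x + q y) \<and>
     (\<forall>x\<in>E. \<forall>t>0. q (s (of_real t) x) \<le> t * q x)"

lemma sublinear_add: "sublinear q \<Longrightarrow> x \<in> E \<Longrightarrow> y \<in> E \<Longrightarrow> q (x + y) \<le> q x + q y"
  and sublinear_le: "sublinear q \<Longrightarrow> x \<in> E \<Longrightarrow> t > 0 \<Longrightarrow> q (s (of_real t) x) \<le> t * q x"
  by (auto simp: sublinear_def)

lemma sublinear_scale:
  assumes q: "sublinear q" and x: "x \<in> E" and t: "t > 0"
  shows "q (s (of_real t) x) = t * q x"
proof (rule antisym)
  show "q (s (of_real t) x) \<le> t * q x"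
    using sublinear_le[OF q x t] .
  have "q (s (of_real (inverse t)) (s (of_real t) x)) \<le>
      inverse t * q (s (of_real t) x)"
    by (rule sublinear_le[OF q E_scale[OF x]]) (use t in simp)
  moreover have "s (of_real (inverse t)) (s (of_real t) x) = x"
    using t by (simp flip: of_real_mult)
  ultimately show "t * q x \<le> q (s (of_real t) x)"
    using t by (simp add: field_simps)
qed

lemma sublinear_zero:
  assumes q: "sublinear q" shows "q 0 = 0"
proof -
  have "q (s (of_real 2) 0) = 2 * q 0"
    by (rule sublinear_scale[OF q E_zero]) simp
  then show ?thesis by simp
qed

lemma sublinear_neg:
  assumes q: "sublinear q" and x: "x \<in> E" shows "- q (- x) \<le> q x"
  using sublinear_add[OF q x E_neg[OF x]] sublinear_zero[OF q] by simp

text \<open>The linear functional is a minimal sublinear one: if \<open>q\<close> is minimal, then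
 \<open>x \<mapsto> inf {q (x + t y) - t q y | t \<ge> 0}\<close> is sublinear and below \<open>q\<close>,
 hence equal to \<open>q\<close>, and this makes \<open>q\<close> additive.\<close>

lemma minimal_sublinear:
  assumes p: "sublinear p"
  shows "\<exists>q. sublinear q \<and> (\<forall>x\<in>E. q x \<le> p x) \<and>
    (\<forall>r. sublinear r \<longrightarrow> (\<forall>x\<in>E. r x \<le> q x) \<longrightarrow> (\<forall>x\<in>E. r x = q x))"
proof -
  define A where "A = {q. sublinear q \<and> (\<forall>x\<in>E. q x \<le> p x) \<and> (\<forall>x. x \<notin> E \<longrightarrow> q x = 0)}"
  define P where "P = (\<lambda>f g :: 'x \<Rightarrow> real. g \<le> f)"
  \<comment> \<open>Forcing the value 0 off \<open>E\<close> makes the pointwise order depend on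
    \<open>E\<close> alone.\<close>
  have subl_off: "sublinear (\<lambda>x. if x \<in> E then q x else 0)" if "sublinear q" for q
    using that by (auto simp: sublinear_def E_add E_scale)
  have "\<exists>m\<in>A. \<forall>a\<in>A. P m a \<longrightarrow> a = m"
  proof (rule predicate_Zorn)
    show "partial_order_on A (relation_of P A)"
      by (auto simp: partial_order_on_def preorder_on_def refl_on_def trans_def antisym_def
          relation_of_def P_def)
  next
    fix c assume c: "c \<in> Chains (relation_of P A)"
    show "\<exists>u\<in>A. \<forall>a\<in>c. P a u"
    proof (cases "c = {}")
      case True
      have "(\<lambda>x. if x \<in> E then p x else 0) \<in> A"
        using subl_off[OF p] by (auto simp: A_def)
      then show ?thesis using True by blast
    next
      case False
      have cA: "c \<subseteq> A" using c by (auto simp: Chains_def relation_of_def)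
      have tot: "q \<le> r \<or> r \<le> q" if "q \<in> c" "r \<in> c" for q r
        using c that by (auto simp: Chains_def relation_of_def P_def)
      define u where "u = (\<lambda>x. if x \<in> E then INF q\<in>c. q x else 0)"
      \<comment> \<open>Every member lies above \<open>- p (- x)\<close> at x, so infima along
        chains are finite.\<close>
      have bdd: "bdd_below ((\<lambda>q. q x) ` c)" if x: "x \<in> E" for x
      proof (rule bdd_belowI2)
        fix q assume "q \<in> c"
        then have q: "sublinear q" "q (- x) \<le> p (- x)" using cA x E_neg by (auto simp: A_def)
        show "- p (- x) \<le> q x" using sublinear_neg[OF q(1) x] q(2) by linarith
      qed
      have ule: "u x \<le> q x" if "x \<in> E" "q \<in> c" for x q
        unfolding u_def using that by (auto intro!: cINF_lower bdd)
      have uge: "b \<le> u x" if "x \<in> E" "\<And>q. q \<in> c \<Longrightarrow> b \<le> q x" for x b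
        unfolding u_def using that False by (auto intro!: cINF_greatest)
      have uadd: "u (x + y) \<le> u x + u y" if x: "x \<in> E" and y: "y \<in> E" for x y
      proof -
        have *: "u (x + y) \<le> q x + r y" if q: "q \<in> c" and r: "r \<in> c" for q r
        proof -
          obtain k where k: "k \<in> c" "k \<le> q" "k \<le> r" using tot[OF q r] q r by blast
          have "u (x + y) \<le> k (x + y)" using ule k x y E_add by blast
          also have "\<dots> \<le> k x + k y" using k cA x y by (auto simp: A_def sublinear_def)
          also have "\<dots> \<le> q x + r y" using k by (auto simp: le_fun_def intro!: add_mono)
          finally show ?thesis .
        qed
        have "u (x + y) - u y \<le> u x"
        proof (rule uge[OF x])
          fix q assume q: "q \<in> c"
          have "u (x + y) - q x \<le> u y"
            by (rule uge[OF y]) (use *[OF q] in \<open>auto simp: algebra_simps\<close>)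
          then show "u (x + y) - u y \<le> q x" by linarith
        qed
        then show ?thesis by linarith
      qed
      have uscale: "u (s (of_real t) x) \<le> t * u x" if x: "x \<in> E" and t: "t > 0" for x t
      proof -
        have "u (s (of_real t) x) / t \<le> u x"
        proof (rule uge[OF x])
          fix q assume q: "q \<in> c"
          have "u (s (of_real t) x) \<le> q (s (of_real t) x)"
            using ule q x E_scale by blast
          also have "\<dots> \<le> t * q x" using q cA x t by (auto simp: A_def sublinear_def)
          finally show "u (s (of_real t) x) / t \<le> q x" using t by (simp add: field_simps)
        qed
        then show ?thesis using t by (simp add: field_simps)
      qed
      obtain q0 where q0: "q0 \<in> c" using False by blast
      have "u x \<le> p x" if "x \<in> E" for x
        using ule[OF that q0] q0 cA that by (force simp: A_def)
      then have "u \<in> A" using uadd uscale by (auto simp: A_def sublinear_def u_def)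
      moreover have "P a u" if "a \<in> c" for a
        unfolding P_def le_fun_def
      proof
        fix x show "u x \<le> a x"
          using ule[of x a] that cA by (cases "x \<in> E") (auto simp: A_def u_def)
      qed
      ultimately show ?thesis by blast
    qed
  qed
  then obtain m where m: "m \<in> A" "\<And>a. a \<in> A \<Longrightarrow> a \<le> m \<Longrightarrow> a = m" unfolding P_def by blast
  show ?thesis
  proof (intro exI[of _ m] conjI allI impI ballI)
    show "sublinear m" "\<And>x. x \<in> E \<Longrightarrow> m x \<le> p x" using m by (auto simp: A_def)
    fix r x assume r: "sublinear r" "\<forall>x\<in>E. r x \<le> m x" and x: "x \<in> E"
    define r' where "r' = (\<lambda>x. if x \<in> E then r x else 0)"
    have "r' \<in> A" using subl_off[OF r(1)] r(2) m(1) by (force simp: A_def r'_def)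
    moreover have "r' \<le> m" using r(2) m(1) by (auto simp: le_fun_def r'_def A_def)
    ultimately have "r' = m" using m(2) by blast
    then have "r' x = m x" by simp
    then show "r x = m x" using x by (simp add: r'_def)
  qed
qed

theorem hahn_banach:
  assumes p: "sublinear p"
  obtains g where "\<And>x y. x \<in> E \<Longrightarrow> y \<in> E \<Longrightarrow> g (x + y) = g x + g y"
    "\<And>x t. x \<in> E \<Longrightarrow> g (s (of_real t) x) = t * g x"
    "\<And>x. x \<in> E \<Longrightarrow> g x \<le> p x"
proof -
  obtain q where q: "sublinear q" and qp: "\<And>x. x \<in> E \<Longrightarrow> q x \<le> p x"
    and qmin: "\<forall>r. sublinear r \<longrightarrow> (\<forall>x\<in>E. r x \<le> q x) \<longrightarrow> (\<forall>x\<in>E. r x = q x)"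
    using minimal_sublinear[OF p] by blast
  have add: "q (x + y) = q x + q y" if x: "x \<in> E" and y: "y \<in> E" for x y
  proof -
    define h where "h = (\<lambda>x t. q (x + s (of_real t) y) - t * q y)"
    define r where "r = (\<lambda>x. INF t\<in>{0<..}. h x t)"
    have lower: "- q (- x) \<le> h x t" if x: "x \<in> E" and t: "t > 0" for x t
    proof -
      have "q (s (of_real t) y) \<le> q (x + s (of_real t) y) + q (- x)"
        using sublinear_add[OF q, of "x + s (of_real t) y" "- x"] x y
        by (simp add: E_add E_scale E_neg)
      then show ?thesis using sublinear_scale[OF q y t] by (simp add: h_def)
    qed
    have bdd: "bdd_below (h x ` {0<..})" if "x \<in> E" for x
      by (rule bdd_belowI2[where m = "- q (- x)"]) (use lower that in auto)
    have rle: "r x \<le> h x t" if "x \<in> E" "t > 0" for x t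
      unfolding r_def using that by (intro cINF_lower bdd) auto
    have rge: "b \<le> r x" if "\<And>t. t > 0 \<Longrightarrow> b \<le> h x t" for x b
      unfolding r_def using that gt_ex by (intro cINF_greatest) auto
    have radd: "r (x + x') \<le> r x + r x'" if x: "x \<in> E" and x': "x' \<in> E" for x x'
    proof -
      have *: "r (x + x') \<le> h x t + h x' t'" if t: "t > 0" "t' > 0" for t t'
      proof -
        have "r (x + x') \<le> h (x + x') (t + t')" using rle E_add x x' t by simp
        also have "h (x + x') (t + t') \<le> h x t + h x' t'"
        proof -
          have "x + x' + s (of_real (t + t')) y =
              (x + s (of_real t) y) + (x' + s (of_real t') y)"
            by (simp add: scale_left_distrib)
          moreover have "q ((x + s (of_real t) y) + (x' + s (of_real t') y)) \<le>
              q (x + s (of_real t) y) + q (x' + s (of_real t') y)"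
            by (rule sublinear_add[OF q]) (simp_all add: x x' y E_add E_scale)
          ultimately show ?thesis unfolding h_def by (simp only: distrib_right)
        qed
        finally show ?thesis .
      qed
      have "r (x + x') - r x' \<le> r x"
      proof (rule rge)
        fix t :: real assume t: "t > 0"
        have "r (x + x') - h x t \<le> r x'"
          by (rule rge) (use *[OF t] in \<open>auto simp: algebra_simps\<close>)
        then show "r (x + x') - r x' \<le> h x t" by linarith
      qed
      then show ?thesis by linarith
    qed
    have rscale: "r (s (of_real l) x) \<le> l * r x" if x: "x \<in> E" and l: "l > 0" for x l
    proof -
      have "r (s (of_real l) x) / l \<le> r x"
      proof (rule rge)
        fix t :: real assume t: "t > 0"
        have "r (s (of_real l) x) \<le> h (s (of_real l) x) (l * t)"
          using rle E_scale x l t by simp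
        also have "\<dots> = l * h x t"
        proof -
          have "s (of_real l) x + s (of_real (l * t)) y =
              s (of_real l) (x + s (of_real t) y)"
            by (simp add: scale_right_distrib)
          then show ?thesis using sublinear_scale[OF q _ l, of "x + s (of_real t) y"] x y
            by (simp add: h_def E_add E_scale algebra_simps)
        qed
        finally show "r (s (of_real l) x) / l \<le> h x t" using l by (simp add: field_simps)
      qed
      then show ?thesis using l by (simp add: field_simps)
    qed
    have rq: "r x \<le> q x" if x: "x \<in> E" for x
    proof -
      have "r x \<le> h x 1" using rle[OF x] by simp
      also have "\<dots> \<le> q x" using sublinear_add[OF q x y] by (simp add: h_def)
      finally show ?thesis .
    qed
    have "sublinear r" using radd rscale by (auto simp: sublinear_def)
    then have "r x = q x" using qmin rq x by blast
    \<comment> \<open>With \<open>r = q\<close> by minimality, the instance t = 1 is superadditivity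
      of q.\<close>
    then have "q x + q y \<le> q (x + y)" using rle[OF x, of 1] by (simp add: h_def)
    then show ?thesis using sublinear_add[OF q x y] by simp
  qed
  have neg: "q (- x) = - q x" if "x \<in> E" for x
    using add[OF that E_neg[OF that]] sublinear_zero[OF q] by simp
  have scale: "q (s (of_real t) x) = t * q x" if x: "x \<in> E" for x t
  proof (cases "t > 0")
    case True then show ?thesis using sublinear_scale[OF q x] by simp
  next
    case False
    show ?thesis
    proof (cases "t = 0")
      case True then show ?thesis using sublinear_zero[OF q] by simp
    next
      case False
      with \<open>\<not> t > 0\<close> have "- t > 0" by simp
      then have "q (s (of_real (- t)) (- x)) = - t * q (- x)"
        using sublinear_scale[OF q E_neg[OF x]] by blast
      then show ?thesis using neg[OF x] by simp
    qed
  qed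
  show ?thesis using that[of q] add scale qp by blast
qed

text \<open>\<open>G\<close> consists of pairs \<open>(w, r)\<close> demanding that the functional is at most \<open>r\<close> at \<open>w\<close>.\<close>

theorem positive_functional:
  assumes P_E: "P \<subseteq> E" and P_star: "\<And>x. x \<in> P \<Longrightarrow> star x = x"
    and P_add: "\<And>x y. x \<in> P \<Longrightarrow> y \<in> P \<Longrightarrow> x + y \<in> P"
    and P_scale: "\<And>x t. x \<in> P \<Longrightarrow> t > 0 \<Longrightarrow> s (of_real t) x \<in> P"
    and P_zero: "0 \<in> P"
    and G_E: "\<And>w r. (w, r) \<in> G \<Longrightarrow> w \<in> E \<and> star w = w"
    and G_add: "\<And>w r w' r'. (w, r) \<in> G \<Longrightarrow> (w', r') \<in> G \<Longrightarrow> (w + w', r + r') \<in> G"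
    and G_scale: "\<And>w r t. (w, r) \<in> G \<Longrightarrow> t > 0 \<Longrightarrow> (s (of_real t) w, t * r) \<in> G"
    and G_major: "\<And>x. x \<in> E \<Longrightarrow> star x = x \<Longrightarrow> \<exists>w r. (w, r) \<in> G \<and> w - x \<in> P"
    and G_pos: "\<And>w r. (w, r) \<in> G \<Longrightarrow> w \<in> P \<Longrightarrow> r \<ge> (0::real)"
  shows "\<exists>F :: 'x \<Rightarrow> complex. (\<forall>x\<in>E. \<forall>y\<in>E. F (x + y) = F x + F y) \<and>
    (\<forall>c. \<forall>x\<in>E. F (s c x) = c * F x) \<and> (\<forall>x\<in>E. F (star x) = cnj (F x)) \<and>
    (\<forall>x\<in>P. 0 \<le> F x) \<and> (\<forall>w r. (w, r) \<in> G \<longrightarrow> Re (F w) \<le> r)"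
proof -
  define re where "re = (\<lambda>x. s (1/2) (x + star x))"
  have re_E: "re x \<in> E" if "x \<in> E" for x
    using that by (simp add: re_def E_scale E_add star_in)
  have star_re: "star (re x) = re x" if "x \<in> E" for x
    using that by (simp add: re_def E_scale E_add star_in star_scale star_add star_star add.commute)
  have re_herm: "re x = x" if "star x = x" for x
    using that scale_left_distrib[of "1/2" "1/2" x] by (simp add: re_def scale_right_distrib)
  have re_add: "re (x + y) = re x + re y" if "x \<in> E" "y \<in> E" for x y
    using that by (simp add: re_def star_add algebra_simps)
  have re_scale: "re (s (of_real t) x) = s (of_real t) (re x)" if "x \<in> E" for x t
    using that by (simp add: re_def star_scale scale_right_distrib mult.commute)
  \<comment> \<open>\<open>p x\<close> is the infimum of the bounds attached to those elements of
    \<open>G\<close> that dominate the hermitian part of x; \<open>G_pos\<close> keeps it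
    finite.\<close>
  define Q where "Q = (\<lambda>x. {r. \<exists>w. (w, r) \<in> G \<and> w - re x \<in> P})"
  define p where "p = (\<lambda>x. Inf (Q x))"
  have Q_ne: "Q x \<noteq> {}" if "x \<in> E" for x
    using G_major[OF re_E star_re] that by (force simp: Q_def)
  have Q_add: "r + r' \<in> Q (x + y)" if "x \<in> E" "y \<in> E" "r \<in> Q x" "r' \<in> Q y" for x y r r'
  proof -
    obtain w where w1: "(w, r) \<in> G" "w - re x \<in> P" using \<open>r \<in> Q x\<close> by (auto simp: Q_def)
    obtain w' where w2: "(w', r') \<in> G" "w' - re y \<in> P" using \<open>r' \<in> Q y\<close> by (auto simp: Q_def)
    note w = w1 w2
    have "(w + w') - re (x + y) = (w - re x) + (w' - re y)"
      using re_add that by simp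
    then have "(w + w') - re (x + y) \<in> P" using P_add w by presburger
    then show ?thesis using G_add[OF w(1,3)] by (auto simp: Q_def)
  qed
  have Q_scale: "t * r \<in> Q (s (of_real t) x)" if "x \<in> E" "r \<in> Q x" "t > 0" for x r t
  proof -
    obtain w where w: "(w, r) \<in> G" "w - re x \<in> P" using \<open>r \<in> Q x\<close> unfolding Q_def by blast
    have "s (of_real t) w - re (s (of_real t) x) = s (of_real t) (w - re x)"
      using that by (simp add: re_scale scale_right_diff_distrib)
    then have "s (of_real t) w - re (s (of_real t) x) \<in> P"
      using P_scale[OF w(2)] that by simp
    then show ?thesis using G_scale[OF w(1)] that by (auto simp: Q_def)
  qed
  have re0: "re 0 = 0"
  proof -
    have "star (s 0 0) = s 0 (star 0)" using star_scale[OF E_zero, of 0] by simp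
    then show ?thesis by (simp add: re_def)
  qed
  have Q_zero: "r \<ge> 0" if "r \<in> Q 0" for r
    using that G_pos by (auto simp: Q_def re0)
  have bdd: "bdd_below (Q x)" if x: "x \<in> E" for x
  proof -
    obtain r' where r': "r' \<in> Q (- x)" using Q_ne E_neg x by blast
    have "- r' \<le> r" if "r \<in> Q x" for r
      using Q_zero[of "r + r'"] Q_add[OF x E_neg[OF x] that r'] by simp
    then show ?thesis by (rule bdd_belowI)
  qed
  have ple: "p x \<le> r" if "x \<in> E" "r \<in> Q x" for x r
    unfolding p_def using that bdd by (simp add: cInf_lower)
  have pge: "b \<le> p x" if "x \<in> E" "\<And>r. r \<in> Q x \<Longrightarrow> b \<le> r" for x b
    unfolding p_def using that Q_ne by (simp add: cInf_greatest)
  have "sublinear p"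
    unfolding sublinear_def
  proof (intro conjI ballI allI impI)
    fix x y assume x: "x \<in> E" and y: "y \<in> E"
    have "p (x + y) - p y \<le> p x"
    proof (rule pge[OF x])
      fix r assume r: "r \<in> Q x"
      have "p (x + y) - r \<le> p y"
      proof (rule pge[OF y])
        fix r' assume "r' \<in> Q y"
        then show "p (x + y) - r \<le> r'" using ple[OF E_add[OF x y] Q_add[OF x y r]] by force
      qed
      then show "p (x + y) - p y \<le> r" by linarith
    qed
    then show "p (x + y) \<le> p x + p y" by linarith
  next
    fix x and t :: real assume x: "x \<in> E" and t: "t > 0"
    have "p (s (of_real t) x) / t \<le> p x"
    proof (rule pge[OF x])
      fix r assume "r \<in> Q x"
      then show "p (s (of_real t) x) / t \<le> r"
        using ple[OF E_scale[OF x] Q_scale[OF x _ t]] t by (simp add: field_simps)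
    qed
    then show "p (s (of_real t) x) \<le> t * p x" using t by (simp add: field_simps)
  qed
  then obtain g where g: "\<And>x y. x \<in> E \<Longrightarrow> y \<in> E \<Longrightarrow> g (x + y) = g x + g y"
    "\<And>x t. x \<in> E \<Longrightarrow> g (s (of_real t) x) = t * g x" "\<And>x. x \<in> E \<Longrightarrow> g x \<le> p x"
    using hahn_banach by blast
  have g_neg: "g (- x) = - g x" if "x \<in> E" for x
    using g(2)[OF that, of "-1"] by simp
  \<comment> \<open>The gauge sees only \<open>re x\<close>, which vanishes at an antihermitian x
    and at its negative.\<close>
  have g_antiherm: "g x = 0" if x: "x \<in> E" "star x = - x" for x
  proof -
    have "re x = 0" "re (- x) = 0"
      using x star_scale[of x "-1"] by (auto simp: re_def)
    moreover have "(0, r) \<in> G \<Longrightarrow> r \<ge> 0" for r using G_pos P_zero by blast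
    ultimately have "p x \<le> p 0" "p (- x) \<le> p 0" by (auto simp: p_def Q_def re0)
    moreover have "p 0 = 0" using sublinear_zero[OF \<open>sublinear p\<close>] .
    ultimately show ?thesis using g(3)[OF x(1)] g(3)[OF E_neg[OF x(1)]] g_neg[OF x(1)] by linarith
  qed
  \<comment> \<open>The usual complexification of a real functional.\<close>
  define F where "F = (\<lambda>x. Complex (g x) (- g (s \<i> x)))"
  have F_add: "F (x + y) = F x + F y" if "x \<in> E" "y \<in> E" for x y
    using that by (simp add: F_def g(1) E_scale scale_right_distrib complex_eq_iff)
  have decomp: "g (s c x) = Re c * g x + Im c * g (s \<i> x)" if "x \<in> E" for c x
  proof -
    have "s c x = s (of_real (Re c)) x + s (of_real (Im c)) (s \<i> x)"
      by (simp add: scale_left_distrib[symmetric] complex_eq mult.commute)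
    then show ?thesis using that g(2)[of "s \<i> x" "Im c"] by (simp add: g(1) g(2) E_scale)
  qed
  have F_scale: "F (s c x) = c * F x" if "x \<in> E" for c x
    using decomp[OF that, of c] decomp[OF that, of "\<i> * c"]
    by (simp add: F_def complex_eq_iff)
  have F_herm: "F x = of_real (g x)" if "x \<in> E" "star x = x" for x
    using g_antiherm[of "s \<i> x"] that by (simp add: F_def E_scale star_scale complex_eq_iff)
  have pG: "p w \<le> r" if "(w, r) \<in> G" for w r
    using that G_E[OF that] P_zero by (intro ple) (auto simp: Q_def re_herm)
  show ?thesis
  proof (intro exI[of _ F] conjI ballI allI impI)
    show "F (x + y) = F x + F y" if "x \<in> E" "y \<in> E" for x y using F_add that by blast
    show "F (star x) = cnj (F x)" if x: "x \<in> E" for x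
    proof -
      have *: "Im (F (y + star y)) = 0" if y: "y \<in> E" for y
      proof -
        have "star (y + star y) = y + star y"
          using y by (simp add: star_add star_in star_star add.commute)
        then show ?thesis using F_herm[of "y + star y"] y by (simp add: E_add star_in)
      qed
      have "F (s \<i> x + star (s \<i> x)) = \<i> * F x - \<i> * F (star x)"
        using x F_add[of "s \<i> x" "s (- \<i>) (star x)"] F_scale[of "star x" "- \<i>"]
        by (simp only: F_scale E_scale star_in star_scale complex_cnj_i) simp
      then show ?thesis using *[OF x] *[OF E_scale[OF x, of \<i>]] F_add[of x "star x"] x
        by (simp add: star_in complex_eq_iff)
    qed
    show "F (s c x) = c * F x" if "x \<in> E" for c x using F_scale that by blast
    show "0 \<le> F x" if x: "x \<in> P" for x
    proof -
      have xE: "x \<in> E" "star x = x" using x P_E P_star by auto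
      obtain w0 r0 where "(w0, r0) \<in> G" using G_major[OF xE] by blast
      have "star (- x) = - x" using star_scale[OF xE(1), of "-1"] xE by simp
      then have re_neg: "re (- x) = - x" using re_herm by blast
      \<comment> \<open>0 dominates \<open>- x\<close>, so every positive multiple t w of a majorant
        w of 0 does; the bound t r tends to 0 with t.\<close>
      have "p (- x) \<le> e" if e: "e > 0" for e
      proof -
        obtain w r where w: "(w, r) \<in> G" "w - 0 \<in> P"
          using G_major[OF E_zero] star_scale[OF E_zero, of 0] by auto
        define t where "t = e / (\<bar>r\<bar> + 1)"
        have t: "t > 0" using e by (simp add: t_def add_nonneg_pos)
        have "t * r \<le> t * (\<bar>r\<bar> + 1)" using t by (intro mult_left_mono) auto
        also have "\<dots> = e" by (simp add: t_def)
        finally have tr: "t * r \<le> e" .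
        have "s (of_real t) w - re (- x) = s (of_real t) w + x" by (simp add: re_neg)
        also have "\<dots> \<in> P" using P_add P_scale w t x by simp
        finally have "t * r \<in> Q (- x)" using G_scale[OF w(1) t] by (auto simp: Q_def)
        then show ?thesis using ple[OF E_neg[OF xE(1)]] tr by force
      qed
      then have "p (- x) \<le> 0" by (rule field_le_epsilon[where y = 0, simplified])
      then have "g x \<ge> 0" using g(3)[OF E_neg[OF xE(1)]] g_neg[OF xE(1)] by linarith
      then show ?thesis using F_herm xE by (simp add: less_eq_complex_def)
    qed
    show "Re (F w) \<le> r" if "(w, r) \<in> G" for w r
      using pG[OF that] g(3) G_E[OF that] by (force simp: F_def)
  qed
qed

end

section \<open>Idempotents in compact right topological semigroups\<close>

text \<open>The semigroup argument needs compact sets of maps to be closed, so pointwise convergence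
  has to be Hausdorff; two functions are separated at one argument.\<close>

instance "fun" :: (type, t2_space) t2_space
proof
  fix f g :: "'a \<Rightarrow> 'b" assume "f \<noteq> g"
  then obtain i where "f i \<noteq> g i" by blast
  then obtain U V where UV: "open U" "open V" "f i \<in> U" "g i \<in> V" "U \<inter> V = {}"
    using hausdorff by metis
  have op: "open {h :: 'a \<Rightarrow> 'b. h i \<in> W}" if "open W" for W
    using product_topology_basis'[of "{i}" "\<lambda>_. W" "\<lambda>x. x"] that by simp
  show "\<exists>U V. open U \<and> open V \<and> f \<in> U \<and> g \<in> V \<and> U \<inter> V = {}"
    using op[OF UV(1)] op[OF UV(2)] UV
    by (intro exI[of _ "{h. h i \<in> U}"] exI[of _ "{h. h i \<in> V}"]) auto
qed

text \<open>Tychonoff's theorem for total functions.\<close>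

lemma compact_Pi_UNIV:
  fixes X :: "'i \<Rightarrow> 'b::topological_space set"
  assumes "\<And>i. compact (X i)"
  shows "compact {f. \<forall>i. f i \<in> X i}"
proof -
  have "compactin (product_topology (\<lambda>i. euclidean) UNIV) (Pi\<^sub>E UNIV X)"
    using assms by (simp add: compactin_PiE)
  then have "compact (Pi\<^sub>E UNIV X)"
    by (simp add: euclidean_product_topology)
  moreover have "Pi\<^sub>E UNIV X = {f. \<forall>i. f i \<in> X i}" by auto
  ultimately show ?thesis by simp
qed

lemma closed_singleton_preimage:
  fixes f :: "'x::t2_space \<Rightarrow> 'x"
  assumes "closed S" "continuous_on S f" shows "closed {x \<in> S. f x = y}"
  using continuous_closed_preimage[OF assms(2,1) closed_singleton[of y]]
  by (simp add: vimage_def Int_def conj_commute)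

text \<open>The Ellis--Numakura lemma. By compactness there is a minimal closed subsemigroup T. For
  u in T the set \<open>T u\<close> is again a closed subsemigroup, so it equals T and some a has
  \<open>a u = u\<close>. The a in T with this property also form a closed subsemigroup, hence all
  of T, and u is one of them.\<close>

theorem compact_semigroup_idempotent:
  fixes op :: "'x::t2_space \<Rightarrow> 'x \<Rightarrow> 'x"
  assumes S: "compact S" "S \<noteq> {}"
    and cl: "\<And>a b. a \<in> S \<Longrightarrow> b \<in> S \<Longrightarrow> op a b \<in> S"
    and assoc: "\<And>a b c. a \<in> S \<Longrightarrow> b \<in> S \<Longrightarrow> c \<in> S \<Longrightarrow> op (op a b) c = op a (op b c)"
    and cont: "\<And>b. b \<in> S \<Longrightarrow> continuous_on S (\<lambda>a. op a b)"
  shows "\<exists>u\<in>S. op u u = u"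
proof -
  define A where "A = {T. T \<subseteq> S \<and> closed T \<and> T \<noteq> {} \<and> (\<forall>a\<in>T. \<forall>b\<in>T. op a b \<in> T)}"
  have SA: "S \<in> A" using S cl by (auto simp: A_def compact_imp_closed)
  have "\<exists>m\<in>A. \<forall>a\<in>A. m \<supseteq> a \<longrightarrow> a = m"
  proof (rule predicate_Zorn[where P = "\<lambda>a b. a \<supseteq> b"])
    show "partial_order_on A (relation_of (\<lambda>a b. a \<supseteq> b) A)"
      by (auto simp: partial_order_on_def preorder_on_def refl_on_def trans_def antisym_def
          relation_of_def)
  next
    fix c assume c: "c \<in> Chains (relation_of (\<lambda>a b. a \<supseteq> b) A)"
    have cA: "c \<subseteq> A" using c by (auto simp: Chains_def relation_of_def)
    have tot: "q \<subseteq> r \<or> r \<subseteq> q" if "q \<in> c" "r \<in> c" for q r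
      using c that by (auto simp: Chains_def relation_of_def)
    have fin: "S \<inter> \<Inter>F \<noteq> {}" if F: "finite F" "F \<subseteq> c" for F
    proof (cases "F = {}")
      case True then show ?thesis using S by simp
    next
      case False
      have "\<exists>m\<in>F. \<forall>k\<in>F. m \<subseteq> k"
        using F(1) False F(2)
      proof (induction F rule: finite_ne_induct)
        case (singleton x) then show ?case by simp
      next
        case (insert x F)
        then obtain m where m: "m \<in> F" "\<forall>k\<in>F. m \<subseteq> k" by auto
        have "x \<subseteq> m \<or> m \<subseteq> x" using tot insert.prems m by auto
        then show ?case
        proof
          assume "x \<subseteq> m" then show ?thesis using m by (intro bexI[of _ x]) auto
        next
          assume "m \<subseteq> x" then show ?thesis using m by (intro bexI[of _ m]) auto
        qed
      qed
      then obtain m where m: "m \<in> F" "m \<subseteq> \<Inter>F" by blast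
      then have "m \<noteq> {}" "m \<subseteq> S" using F cA by (auto simp: A_def)
      then have "m \<subseteq> S \<inter> \<Inter>F" using m(2) by (simp only: Int_subset_iff)
      then show ?thesis using \<open>m \<noteq> {}\<close> by (metis subset_empty)
    qed
    have "S \<inter> \<Inter>c \<noteq> {}"
      by (rule compact_imp_fip[OF S(1)]) (use cA fin in \<open>auto simp: A_def\<close>)
    have "S \<inter> \<Inter>c \<in> A"
    proof -
      have "closed (S \<inter> \<Inter>c)"
        using cA compact_imp_closed[OF S(1)] by (intro closed_Int closed_Inter) (auto simp: A_def)
      moreover have "op a b \<in> S \<inter> \<Inter>c" if "a \<in> S \<inter> \<Inter>c" "b \<in> S \<inter> \<Inter>c" for a b
      proof (intro IntI InterI)
        show "op a b \<in> S" using that cl by simp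
        fix T assume "T \<in> c"
        then show "op a b \<in> T" using that cA by (auto simp: A_def)
      qed
      ultimately show ?thesis using \<open>S \<inter> \<Inter>c \<noteq> {}\<close> by (auto simp: A_def)
    qed
    then show "\<exists>u\<in>A. \<forall>a\<in>c. a \<supseteq> u" by (intro bexI[of _ "S \<inter> \<Inter>c"]) auto
  qed
  then obtain T where T: "T \<in> A" and Tmin: "\<And>U. U \<in> A \<Longrightarrow> U \<subseteq> T \<Longrightarrow> U = T" by metis
  have TS: "T \<subseteq> S" "closed T" "T \<noteq> {}" and Top: "\<And>a b. a \<in> T \<Longrightarrow> b \<in> T \<Longrightarrow> op a b \<in> T"
    using T by (simp_all add: A_def)
  have Tc: "compact T" using TS S(1) compact_Int_closed[of S T] by (simp add: Int_absorb1)
  obtain u where u: "u \<in> T" using TS by blast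
  have contT: "continuous_on T (\<lambda>a. op a u)" using cont continuous_on_subset TS u by blast
  have "(\<lambda>a. op a u) ` T = T"
  proof (rule Tmin)
    show "(\<lambda>a. op a u) ` T \<subseteq> T" using Top u by blast
    have "op (op a u) (op b u) \<in> (\<lambda>a. op a u) ` T" if "a \<in> T" "b \<in> T" for a b
    proof (rule image_eqI)
      show "op (op a u) (op b u) = op (op (op a u) b) u"
        using assoc[of "op a u" b u] that u Top TS by (simp add: subset_iff)
      show "op (op a u) b \<in> T" using that u Top by simp
    qed
    then show "(\<lambda>a. op a u) ` T \<in> A"
      using compact_imp_closed[OF compact_continuous_image[OF contT Tc]] u TS
        subsetD[OF TS(1) Top[OF _ u]] by (auto simp: A_def)
  qed
  then obtain a where a: "a \<in> T" "op a u = u" using u by (metis imageE)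
  have "{a \<in> T. op a u = u} = T"
  proof (rule Tmin)
    have "op (op a b) u = u" if "a \<in> T" "b \<in> T" "op a u = u" "op b u = u" for a b
      using assoc[of a b u] that u TS by (auto simp: subset_iff)
    then show "{a \<in> T. op a u = u} \<in> A"
      using closed_singleton_preimage[OF TS(2) contT, of u] a TS Top by (auto simp: A_def)
  qed auto
  then have "op u u = u" using u by blast
  then show ?thesis using u TS by blast
qed

section \<open>Positive definite kernels and completely positive maps\<close>


type_synonym 'd kernel = "'d \<Rightarrow> 'd \<Rightarrow> complex"

lemma sum_lessThan_plus:
  fixes f :: "nat \<Rightarrow> 'b::comm_monoid_add"
  shows "(\<Sum>i<a + m. f i) = (\<Sum>i<a. f i) + (\<Sum>i<m. f (a + i))"
  by (induction m) (simp_all add: add.assoc)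

lemma sum_fun_apply2:
  fixes h :: "'x \<Rightarrow> 'i \<Rightarrow> 'j \<Rightarrow> 'b::comm_monoid_add"
  shows "(sum h A) k l = (\<Sum>a\<in>A. h a k l)"
  using sum_comp_morphism[of "\<lambda>h. h k l" h A] by (simp add: comp_def)

lemma sum_two_deltas:
  "x < (n::nat) \<Longrightarrow> y < n \<Longrightarrow>
    (\<Sum>k<n. \<Sum>l<n. if k = x \<and> l = y then z k l else 0) = (z x y :: 'b::comm_monoid_add)"
proof -
  assume xy: "x < n" "y < n"
  have "(\<Sum>k<n. \<Sum>l<n. if k = x \<and> l = y then z k l else 0) = (\<Sum>k<n. if k = x then z x y else 0)"
  proof (intro sum.cong refl)
    fix k
    have "(\<Sum>l<n. if k = x \<and> l = y then z k l else 0) =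
        (\<Sum>l<n. if l = y then (if k = x then z x y else 0) else 0)"
      by (intro sum.cong refl) auto
    then show "(\<Sum>l<n. if k = x \<and> l = y then z k l else 0) = (if k = x then z x y else 0)"
      using xy by simp
  qed
  then show ?thesis using xy by simp
qed

definition ker_scale :: "complex \<Rightarrow> 'd kernel \<Rightarrow> 'd kernel" where
  "ker_scale k K = (\<lambda>s t. k * K s t)"

definition ker_adj :: "'d kernel \<Rightarrow> 'd kernel" where
  "ker_adj K = (\<lambda>s t. cnj (K t s))"

text \<open>The matrix coefficient of K between the finitely supported vectors with coefficients c
  and d. Both share one list of points, possibly with repetitions; this costs nothing, as
  coefficients may be 0.\<close>

definition ker_form :: "nat \<Rightarrow> (nat \<Rightarrow> 'd) \<Rightarrow> (nat \<Rightarrow> complex) \<Rightarrow> (nat \<Rightarrow> complex) \<Rightarrow>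
    'd kernel \<Rightarrow> complex" where
  "ker_form n s c d K = (\<Sum>i<n. \<Sum>j<n. cnj (c i) * d j * K (s i) (s j))"

definition block_pos :: "nat \<Rightarrow> (nat \<Rightarrow> nat \<Rightarrow> 'd kernel) \<Rightarrow> bool" where
  "block_pos N m \<longleftrightarrow> (\<forall>n s C. 0 \<le> (\<Sum>a<N. \<Sum>b<N. ker_form n s (C a) (C b) (m a b)))"

definition pos_def :: "'d kernel \<Rightarrow> bool" where
  "pos_def K \<longleftrightarrow> (\<forall>n s c. 0 \<le> ker_form n s c c K)"

text \<open>Indices beyond 1 repeat the last row and column, so a condition on all entries, as in
  \<open>ucp_pos\<close>, concerns just the four given kernels.\<close>

definition block2 :: "'k \<Rightarrow> 'k \<Rightarrow> 'k \<Rightarrow> 'k \<Rightarrow> nat \<Rightarrow> nat \<Rightarrow> 'k" where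
  "block2 P X Y Q = (\<lambda>a b. if a = 0 then (if b = 0 then P else X) else (if b = 0 then Y else Q))"

interpretation ker: vector_space ker_scale
  by unfold_locales (auto simp: ker_scale_def fun_eq_iff algebra_simps)

lemma ker_adj_simps [simp]:
  "ker_adj (ker_adj K) = K" "ker_adj (K + L) = ker_adj K + ker_adj L"
  "ker_adj (ker_scale k K) = ker_scale (cnj k) (ker_adj K)" "ker_adj 0 = 0"
  by (auto simp: ker_adj_def ker_scale_def fun_eq_iff)

lemma ker_form_add [simp]:
  "ker_form n s c d (K + L) = ker_form n s c d K + ker_form n s c d L"
  by (simp add: ker_form_def distrib_left sum.distrib)

lemma ker_form_zero [simp]: "ker_form n s c d 0 = 0"
  by (simp add: ker_form_def)

lemma ker_form_scale [simp]: "ker_form n s c d (ker_scale k K) = k * ker_form n s c d K"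
  by (simp add: ker_form_def ker_scale_def sum_distrib_left algebra_simps)

lemma ker_form_neg [simp]: "ker_form n s c d (- K) = - ker_form n s c d K"
  by (simp add: ker_form_def sum_negf)

lemma ker_form_diff [simp]:
  "ker_form n s c d (K - L) = ker_form n s c d K - ker_form n s c d L"
  by (simp add: ker_form_def right_diff_distrib sum_subtractf)

lemma ker_form_sum:
  "ker_form n s c d (sum f A) = (\<Sum>x\<in>A. ker_form n s c d (f x))"
  using sum_comp_morphism[of "ker_form n s c d" f A] by (simp add: comp_def)

lemma ker_form_adj: "ker_form n s c d (ker_adj K) = cnj (ker_form n s d c K)"
  unfolding ker_form_def ker_adj_def
  by (subst sum.swap) (simp add: mult_ac)

lemma ker_form_coeff [simp]:
  "ker_form n s (\<lambda>i. k * c i) d K = cnj k * ker_form n s c d K"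
  "ker_form n s c (\<lambda>i. k * d i) K = k * ker_form n s c d K"
  "ker_form n s (\<lambda>i. 0) d K = 0" "ker_form n s c (\<lambda>i. 0) K = 0"
  by (simp_all add: ker_form_def sum_distrib_left mult_ac)

lemma ker_form_coeff_neg [simp]:
  "ker_form n s (\<lambda>i. - c i) d K = - ker_form n s c d K"
  "ker_form n s c (\<lambda>i. - d i) K = - ker_form n s c d K"
  by (simp_all add: ker_form_def sum_negf)

lemma ker_form_coeff_add:
  "ker_form n s (\<lambda>i. c i + c' i) d K = ker_form n s c d K + ker_form n s c' d K"
  "ker_form n s c (\<lambda>i. d i + d' i) K = ker_form n s c d K + ker_form n s c d' K"
  by (simp_all add: ker_form_def sum.distrib algebra_simps)

lemma ker_form_coeff_sum:
  "ker_form n s (\<lambda>i. \<Sum>x\<in>A. c x i) d K = (\<Sum>x\<in>A. ker_form n s (c x) d K)"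
  "ker_form n s c' (\<lambda>i. \<Sum>x\<in>A. c x i) K = (\<Sum>x\<in>A. ker_form n s c' (c x) K)"
  by (induction A rule: infinite_finite_induct) (auto simp: ker_form_coeff_add)

lemma ker_form_two:
  "ker_form 2 (\<lambda>i. if i = 0 then s else t) (\<lambda>i. if i = 0 then u else v)
     (\<lambda>i. if i = 0 then u' else v') K =
   cnj u * u' * K s s + cnj u * v' * K s t + cnj v * u' * K t s + cnj v * v' * K t t"
  by (simp add: ker_form_def numeral_2_eq_2 add_ac)

lemma ker_form_concat:
  "ker_form (n + m) s c d K = ker_form n s c d K +
    (\<Sum>i<n. \<Sum>j<m. cnj (c i) * d (n + j) * K (s i) (s (n + j))) +
    (\<Sum>i<m. \<Sum>j<n. cnj (c (n + i)) * d j * K (s (n + i)) (s j)) +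
    ker_form m (\<lambda>i. s (n + i)) (\<lambda>i. c (n + i)) (\<lambda>i. d (n + i)) K"
  unfolding ker_form_def sum_lessThan_plus sum.distrib by (simp only: add_ac)

section \<open>Positive block matrices of kernels\<close>

lemma block_posD: "block_pos N m \<Longrightarrow> 0 \<le> (\<Sum>a<N. \<Sum>b<N. ker_form n s (C a) (C b) (m a b))"
  by (simp add: block_pos_def)

text \<open>Polarisation: the form is real at the vectors with coefficient u at s in row a and v at
  t in row b. The choices (1, 0), (0, 1), (1, 1) and (1, \<i>) of (u, v) isolate the two mixed
  entries.\<close>

lemma block_pos_adj:
  assumes m: "block_pos N m" and a: "a < N" and b: "b < N"
  shows "m b a = ker_adj (m a b)"
proof (intro ext)
  fix t s
  define C where "C = (\<lambda>u v a' i. if i = (0::nat) then (if a' = a then u else 0)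
    else (if a' = b then v else 0 :: complex))"
  have eq: "(\<Sum>a'<N. \<Sum>b'<N. ker_form 2 (\<lambda>i. if i = 0 then s else t) (C u v a') (C u v b') (m a' b')) =
     cnj u * u * m a a s s + cnj u * v * m a b s t + cnj v * u * m b a t s + cnj v * v * m b b t t"
    for u v
  proof -
    have "ker_form 2 (\<lambda>i. if i = 0 then s else t) (C u v a') (C u v b') (m a' b') =
      (if a' = a then if b' = a then cnj u * u * m a a s s else 0 else 0) +
      (if a' = a then if b' = b then cnj u * v * m a b s t else 0 else 0) +
      (if a' = b then if b' = a then cnj v * u * m b a t s else 0 else 0) +
      (if a' = b then if b' = b then cnj v * v * m b b t t else 0 else 0)" for a' b'
      unfolding C_def ker_form_two by auto
    moreover have "(\<Sum>a'<N. \<Sum>b'<N. if a' = x then if b' = y then z else 0 else 0) = z"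
      if "x < N" "y < N" for x y and z :: complex
    proof -
      have "(\<Sum>b'<N. if a' = x then if b' = y then z else 0 else 0) = (if a' = x then z else 0)" for a'
        using that by simp
      then show ?thesis using that by simp
    qed
    ultimately show ?thesis using a b by (simp only: sum.distrib)
  qed
  have *: "0 \<le> cnj u * u * m a a s s + cnj u * v * m a b s t + cnj v * u * m b a t s +
      cnj v * v * m b b t t" for u v
    using block_posD[OF m, of 2 "\<lambda>i. if i = 0 then s else t" "C u v"] unfolding eq .
  show "m b a t s = ker_adj (m a b) t s"
    using *[of 1 0] *[of 0 1] *[of 1 1] *[of 1 \<i>]
    by (auto simp: ker_adj_def complex_eq_iff less_eq_complex_def)
qed

lemma block_pos_one: "block_pos 1 (\<lambda>a b. K) \<longleftrightarrow> pos_def K"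
proof
  assume "block_pos 1 (\<lambda>a b. K)"
  then show "pos_def K" using block_posD[of 1 "\<lambda>a b. K" _ _ "\<lambda>_. _"] by (auto simp: pos_def_def)
qed (auto simp: block_pos_def pos_def_def)

lemma pos_def_adj: "pos_def K \<Longrightarrow> ker_adj K = K"
  using block_pos_adj[of 1 "\<lambda>a b. K" 0 0] by (simp add: block_pos_one del: One_nat_def)

lemma pos_defD: "pos_def K \<Longrightarrow> 0 \<le> ker_form n s c c K"
  by (simp add: pos_def_def)

lemma block_pos_two:
  "block_pos 2 (block2 P X Y Q) \<longleftrightarrow> (\<forall>n s c d. 0 \<le> ker_form n s c c P + ker_form n s c d X +
     ker_form n s d c Y + ker_form n s d d Q)" (is "?l \<longleftrightarrow> ?r")
proof
  assume l: ?l
  show ?r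
  proof (intro allI)
    fix n s c d
    show "0 \<le> ker_form n s c c P + ker_form n s c d X + ker_form n s d c Y + ker_form n s d d Q"
      using block_posD[OF l, of n s "\<lambda>a. if a = 0 then c else d"]
      by (simp add: numeral_2_eq_2 block2_def add_ac)
  qed
qed (auto simp: block_pos_def numeral_2_eq_2 block2_def add_ac)

text \<open>Cauchy--Schwarz in additive form: a phase k turns both mixed terms into
  \<open>- cmod z\<close>. Keeping the sum of the diagonal values instead of their geometric mean
  avoids square roots.\<close>

lemma block_pos_two_bound:
  assumes m: "block_pos 2 (block2 P X Y Q)"
  shows "2 * cmod (ker_form n s c d X) \<le> Re (ker_form n s c c P) + Re (ker_form n s d d Q)"
proof -
  define z where "z = ker_form n s c d X"
  obtain k where k: "k * z = - of_real (cmod z)" "cnj k * k = 1"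
  proof (cases "z = 0")
    case True then show ?thesis using that[of 1] by simp
  next
    case False
    have zz: "cnj z * z = of_real (cmod z) * of_real (cmod z)"
      using complex_norm_square[of z] by (simp add: power2_eq_square mult.commute)
    show ?thesis
    proof (rule that[of "- cnj z / of_real (cmod z)"])
      show "- cnj z / of_real (cmod z) * z = - of_real (cmod z)"
        using False zz by simp
      show "cnj (- cnj z / of_real (cmod z)) * (- cnj z / of_real (cmod z)) = 1"
        using False zz by (simp add: mult.commute)
    qed
  qed
  have Y: "Y = ker_adj X" using block_pos_adj[OF m, of 0 1] by (simp add: block2_def)
  have e1: "ker_form n s (\<lambda>i. k * d i) c Y = - of_real (cmod z)"
  proof -
    have "ker_form n s (\<lambda>i. k * d i) c Y = cnj (k * z)" by (simp add: Y ker_form_adj z_def)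
    also have "\<dots> = - of_real (cmod z)" unfolding k(1) by simp
    finally show ?thesis .
  qed
  have e2: "ker_form n s c (\<lambda>i. k * d i) X = - of_real (cmod z)"
    using k(1) by (simp add: z_def)
  have e3: "ker_form n s (\<lambda>i. k * d i) (\<lambda>i. k * d i) Q = ker_form n s d d Q"
    using k(2) by (simp flip: mult.assoc)
  have "0 \<le> ker_form n s c c P + ker_form n s c (\<lambda>i. k * d i) X +
     ker_form n s (\<lambda>i. k * d i) c Y + ker_form n s (\<lambda>i. k * d i) (\<lambda>i. k * d i) Q"
    using m[unfolded block_pos_two] by (elim allE)
  then have "0 \<le> ker_form n s c c P + - of_real (cmod z) +
      - of_real (cmod z) + ker_form n s d d Q"
    unfolding e1 e2 e3 .
  then show ?thesis by (simp add: less_eq_complex_def z_def)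
qed

text \<open>With a zero corner the first vector can be scaled by r without changing the diagonal
  terms, so a fixed B bounds \<open>2 * (r * cmod (X s t))\<close> for every r.\<close>

lemma block_pos_two_zero:
  assumes m: "block_pos 2 (block2 0 X Y Q)" shows "X = 0"
proof (intro ext)
  fix s t :: 'a
  define \<sigma> where "\<sigma> = (\<lambda>i::nat. if i = 0 then s else t)"
  define d where "d = (\<lambda>i::nat. if i = 0 then 0 else 1 :: complex)"
  define B where "B = Re (ker_form 2 \<sigma> d d Q)"
  have "2 * (r * cmod (X s t)) \<le> B" if "r > 0" for r
  proof -
    have "ker_form 2 \<sigma> (\<lambda>i. if i = 0 then of_real r else 0) d X = of_real r * X s t"
      by (simp add: \<sigma>_def d_def ker_form_two)
    then show ?thesis
      using block_pos_two_bound[OF m, of 2 \<sigma> "\<lambda>i. if i = 0 then of_real r else 0" d] that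
      by (simp add: norm_mult B_def)
  qed
  from this[of "(\<bar>B\<bar> + 1) / cmod (X s t)"] show "X s t = 0 s t"
    by (cases "X s t = 0") (auto simp: add_nonneg_pos)
qed

text \<open>The pinching of K to the fibres of h. Its form is the sum of the forms of K at the
  restrictions of the vectors to the fibres, so positivity is preserved.\<close>

definition ker_diag :: "('d \<Rightarrow> 'h) \<Rightarrow> 'd kernel \<Rightarrow> 'd kernel" where
  "ker_diag h K = (\<lambda>s t. if h s = h t then K s t else 0)"

lemma ker_form_diag:
  "ker_form n s c d (ker_diag h K) = (\<Sum>f\<in>h ` s ` {..<n}.
     ker_form n s (\<lambda>i. if h (s i) = f then c i else 0) (\<lambda>i. if h (s i) = f then d i else 0) K)"
proof -
  have "(\<Sum>f\<in>h ` s ` {..<n}.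
     ker_form n s (\<lambda>i. if h (s i) = f then c i else 0) (\<lambda>i. if h (s i) = f then d i else 0) K) =
     (\<Sum>i<n. \<Sum>j<n. \<Sum>f\<in>h ` s ` {..<n}. cnj (if h (s i) = f then c i else 0) *
       (if h (s j) = f then d j else 0) * K (s i) (s j))"
    unfolding ker_form_def by (subst sum.swap, rule sum.cong[OF refl], subst sum.swap) simp
  also have "\<dots> = (\<Sum>i<n. \<Sum>j<n. cnj (c i) * d j * ker_diag h K (s i) (s j))"
  proof (intro sum.cong refl)
    fix i j assume i: "i \<in> {..<n}"
    have "(\<Sum>f\<in>h ` s ` {..<n}. cnj (if h (s i) = f then c i else 0) *
       (if h (s j) = f then d j else 0) * K (s i) (s j)) =
      (\<Sum>f\<in>h ` s ` {..<n}. if f = h (s i) then cnj (c i) * d j * ker_diag h K (s i) (s j) else 0)"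
      by (intro sum.cong refl) (auto simp: ker_diag_def)
    then show "(\<Sum>f\<in>h ` s ` {..<n}. cnj (if h (s i) = f then c i else 0) *
       (if h (s j) = f then d j else 0) * K (s i) (s j)) =
       cnj (c i) * d j * ker_diag h K (s i) (s j)"
      using i by (simp add: sum.delta')
  qed
  finally show ?thesis by (simp add: ker_form_def)
qed

lemma pos_def_diag: "pos_def K \<Longrightarrow> pos_def (ker_diag h K)"
  by (auto simp: pos_def_def ker_form_diag intro!: sum_nonneg)

text \<open>The operators of norm at most r on the semi-Hilbert space of U. The usual bound by the
  product of the norms is written with half the sum of their squares; for positive definite U,
  scaling c against d shows that the two are equivalent.\<close>

definition ker_ball :: "'d kernel \<Rightarrow> real \<Rightarrow> 'd kernel set" where
  "ker_ball U r = {K. \<forall>n s c d.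
     2 * cmod (ker_form n s c d K) \<le> r * (Re (ker_form n s c c U) + Re (ker_form n s d d U))}"

definition ker_bdd :: "'d kernel \<Rightarrow> 'd kernel set" where
  "ker_bdd U = (\<Union>r\<in>{0..}. ker_ball U r)"

lemma ker_ballD: "K \<in> ker_ball U r \<Longrightarrow>
    2 * cmod (ker_form n s c d K) \<le> r * (Re (ker_form n s c c U) + Re (ker_form n s d d U))"
  by (simp add: ker_ball_def)

lemma pos_def_Re: "pos_def U \<Longrightarrow> 0 \<le> Re (ker_form n s c c U)"
  and pos_def_Im: "pos_def U \<Longrightarrow> Im (ker_form n s c c U) = 0"
  using pos_defD[of U n s c] by (auto simp: less_eq_complex_def)

lemma ker_ball_add:
  assumes "K \<in> ker_ball U r" "L \<in> ker_ball U r'" shows "K + L \<in> ker_ball U (r + r')"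
  unfolding ker_ball_def
proof (intro CollectI allI)
  fix n s c d
  show "2 * cmod (ker_form n s c d (K + L)) \<le>
      (r + r') * (Re (ker_form n s c c U) + Re (ker_form n s d d U))"
    using ker_ballD[OF assms(1), of n s c d] ker_ballD[OF assms(2), of n s c d]
      norm_triangle_ineq[of "ker_form n s c d K" "ker_form n s c d L"]
    by (simp add: distrib_right)
qed

lemma ker_ball_scale:
  assumes "K \<in> ker_ball U r" shows "ker_scale k K \<in> ker_ball U (cmod k * r)"
  unfolding ker_ball_def
proof (intro CollectI allI)
  fix n s c d
  show "2 * cmod (ker_form n s c d (ker_scale k K)) \<le>
      (cmod k * r) * (Re (ker_form n s c c U) + Re (ker_form n s d d U))"
    using mult_left_mono[OF ker_ballD[OF assms, of n s c d], of "cmod k"]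
    by (simp add: norm_mult mult_ac)
qed

lemma ker_ball_adj: "K \<in> ker_ball U r \<Longrightarrow> ker_adj K \<in> ker_ball U r"
  unfolding ker_ball_def
proof (intro CollectI allI)
  fix n s c d
  assume "K \<in> {K. \<forall>n s c d.
     2 * cmod (ker_form n s c d K) \<le> r * (Re (ker_form n s c c U) + Re (ker_form n s d d U))}"
  then have "2 * cmod (ker_form n s d c K) \<le> r * (Re (ker_form n s d d U) + Re (ker_form n s c c U))"
    by blast
  then show "2 * cmod (ker_form n s c d (ker_adj K)) \<le>
      r * (Re (ker_form n s c c U) + Re (ker_form n s d d U))"
    by (simp add: ker_form_adj add.commute)
qed

lemma ker_bddI: "r \<ge> 0 \<Longrightarrow> K \<in> ker_ball U r \<Longrightarrow> K \<in> ker_bdd U"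
  by (auto simp: ker_bdd_def)

lemma ker_bddE:
  assumes "K \<in> ker_bdd U" obtains r where "r \<ge> 0" "K \<in> ker_ball U r"
  using assms by (auto simp: ker_bdd_def)

lemma ker_bdd_add: "K \<in> ker_bdd U \<Longrightarrow> L \<in> ker_bdd U \<Longrightarrow> K + L \<in> ker_bdd U"
  by (elim ker_bddE) (blast intro: ker_bddI[OF add_nonneg_nonneg] ker_ball_add)

lemma ker_bdd_scale: "K \<in> ker_bdd U \<Longrightarrow> ker_scale k K \<in> ker_bdd U"
  by (elim ker_bddE) (blast intro: ker_bddI[OF mult_nonneg_nonneg] ker_ball_scale norm_ge_zero)

lemma ker_bdd_adj: "K \<in> ker_bdd U \<Longrightarrow> ker_adj K \<in> ker_bdd U"
  by (elim ker_bddE) (blast intro: ker_bddI ker_ball_adj)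

lemma ker_bdd_zero: "0 \<in> ker_bdd U"
  by (rule ker_bddI[of 0]) (auto simp: ker_ball_def)

lemma ker_bdd_subspace: "ker.subspace (ker_bdd U)"
  by (auto simp: ker.subspace_def ker_bdd_add ker_bdd_scale ker_bdd_zero)

lemma ker_bdd_diff: "K \<in> ker_bdd U \<Longrightarrow> L \<in> ker_bdd U \<Longrightarrow> K - L \<in> ker_bdd U"
  using ker.subspace_diff[OF ker_bdd_subspace] .

lemma ker_ball_unit:
  assumes U: "pos_def U" shows "U \<in> ker_ball U 1"
proof -
  have "block_pos 2 (block2 U U U U)"
    unfolding block_pos_two
  proof (intro allI)
    fix n s and c d :: "nat \<Rightarrow> complex"
    have "ker_form n s c c U + ker_form n s c d U + ker_form n s d c U + ker_form n s d d U =
        ker_form n s (\<lambda>i. c i + d i) (\<lambda>i. c i + d i) U"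
      by (simp add: ker_form_coeff_add)
    then show "0 \<le> ker_form n s c c U + ker_form n s c d U + ker_form n s d c U + ker_form n s d d U"
      using pos_defD[OF U] by metis
  qed
  then show "U \<in> ker_ball U 1" using block_pos_two_bound by (auto simp: ker_ball_def)
qed

lemma ker_bdd_unit: "pos_def U \<Longrightarrow> U \<in> ker_bdd U"
  by (rule ker_bddI[of 1]) (simp, rule ker_ball_unit)

lemma ker_ball_entry:
  assumes "K \<in> ker_ball U r" shows "2 * cmod (K s t) \<le> r * (Re (U s s) + Re (U t t))"
  using ker_ballD[OF assms, of 2 "\<lambda>i. if i = 0 then s else t" "\<lambda>i. if i = 0 then 1 else 0"
      "\<lambda>i. if i = 0 then 0 else 1"]
  unfolding ker_form_two by simp

text \<open>The converse of \<open>block_pos_two_bound\<close>: it turns a norm bound into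
  positivity of a block matrix, the form in which completely positive maps can use it.\<close>

lemma ker_ball_block_pos:
  assumes U: "pos_def U" and K: "K \<in> ker_ball U r"
  shows "block_pos 2 (block2 (ker_scale (of_real r) U) K (ker_adj K)
    (ker_scale (of_real r) U))"
  unfolding block_pos_two
proof (intro allI)
  fix n s c d
  have "\<bar>Re (ker_form n s c d K)\<bar> \<le> cmod (ker_form n s c d K)" by (rule abs_Re_le_cmod)
  with ker_ballD[OF K, of n s c d]
  have "0 \<le> r * (Re (ker_form n s c c U) + Re (ker_form n s d d U)) + 2 * Re (ker_form n s c d K)"
    by linarith
  then show "0 \<le> ker_form n s c c (ker_scale (of_real r) U) + ker_form n s c d K +
      ker_form n s d c (ker_adj K) + ker_form n s d d (ker_scale (of_real r) U)"
    using pos_def_Im[OF U] by (simp add: ker_form_adj less_eq_complex_def algebra_simps)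
qed

text \<open>The junk values on unbounded kernels are fixed to \<open>0\<close>, which makes the set of these maps
  Hausdorff and compact under pointwise convergence.\<close>

definition ucp :: "'d kernel \<Rightarrow>
    ('d kernel \<Rightarrow> 'd kernel) \<Rightarrow> bool" where
  "ucp U \<Phi> \<longleftrightarrow> (\<forall>K\<in>ker_bdd U. \<forall>L\<in>ker_bdd U. \<Phi> (K + L) = \<Phi> K + \<Phi> L) \<and>
     (\<forall>k. \<forall>K\<in>ker_bdd U. \<Phi> (ker_scale k K) = ker_scale k (\<Phi> K)) \<and>
     (\<forall>N m. (\<forall>a b. m a b \<in> ker_bdd U) \<longrightarrow> block_pos N m \<longrightarrow> block_pos N (\<lambda>a b. \<Phi> (m a b))) \<and>
     \<Phi> U = U \<and> (\<forall>K. K \<notin> ker_bdd U \<longrightarrow> \<Phi> K = 0)"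

lemma ucp_add: "ucp U \<Phi> \<Longrightarrow> K \<in> ker_bdd U \<Longrightarrow> L \<in> ker_bdd U \<Longrightarrow> \<Phi> (K + L) = \<Phi> K + \<Phi> L"
  and ucp_scale: "ucp U \<Phi> \<Longrightarrow> K \<in> ker_bdd U \<Longrightarrow> \<Phi> (ker_scale k K) = ker_scale k (\<Phi> K)"
  and ucp_pos: "ucp U \<Phi> \<Longrightarrow> (\<And>a b. m a b \<in> ker_bdd U) \<Longrightarrow> block_pos N m \<Longrightarrow>
      block_pos N (\<lambda>a b. \<Phi> (m a b))"
  and ucp_unit: "ucp U \<Phi> \<Longrightarrow> \<Phi> U = U"
  and ucp_unbdd: "ucp U \<Phi> \<Longrightarrow> K \<notin> ker_bdd U \<Longrightarrow> \<Phi> K = 0"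
  by (auto simp: ucp_def)

lemma ucp_zero: "ucp U \<Phi> \<Longrightarrow> \<Phi> 0 = 0"
  using ucp_scale[of U \<Phi> 0 0] ker_bdd_zero[of U] by simp

lemma ucp_diff: "ucp U \<Phi> \<Longrightarrow> K \<in> ker_bdd U \<Longrightarrow> L \<in> ker_bdd U \<Longrightarrow> \<Phi> (K - L) = \<Phi> K - \<Phi> L"
  using ucp_add[of U \<Phi> K "ker_scale (-1) L"] ucp_scale[of U \<Phi> L "-1"] ker_bdd_scale[of L U "-1"]
  by simp

lemma block2_map: "(\<lambda>a b. \<Phi> (block2 P X Y Q a b)) = block2 (\<Phi> P) (\<Phi> X) (\<Phi> Y) (\<Phi> Q)"
  by (auto simp: block2_def fun_eq_iff)

lemma ucp_pos_two:
  assumes "ucp U \<Phi>" "P \<in> ker_bdd U" "X \<in> ker_bdd U" "Y \<in> ker_bdd U" "Q \<in> ker_bdd U"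
    and "block_pos 2 (block2 P X Y Q)"
  shows "block_pos 2 (block2 (\<Phi> P) (\<Phi> X) (\<Phi> Y) (\<Phi> Q))"
  using ucp_pos[of U \<Phi> "block2 P X Y Q" 2] assms unfolding block2_map
  by (simp add: block2_def)

text \<open>Contractivity from 2-positivity: the block matrix of \<open>ker_ball_block_pos\<close>
  keeps its diagonal, a multiple of U, when the map is applied to its entries.\<close>

lemma ucp_ball:
  assumes U: "pos_def U" and \<Phi>: "ucp U \<Phi>" and r: "r \<ge> 0" and K: "K \<in> ker_ball U r"
  shows "\<Phi> K \<in> ker_ball U r"
proof -
  have bdd: "K \<in> ker_bdd U" "U \<in> ker_bdd U" using ker_bddI[OF r K] ker_bdd_unit[OF U] .
  have "block_pos 2 (block2 (\<Phi> (ker_scale (of_real r) U)) (\<Phi> K) (\<Phi> (ker_adj K))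
      (\<Phi> (ker_scale (of_real r) U)))"
    using ucp_pos_two[OF \<Phi> _ _ _ _ ker_ball_block_pos[OF U K]] bdd
    by (simp add: ker_bdd_scale ker_bdd_adj)
  then have "block_pos 2 (block2 (ker_scale (of_real r) U) (\<Phi> K) (\<Phi> (ker_adj K))
      (ker_scale (of_real r) U))"
    using bdd by (simp add: ucp_scale[OF \<Phi>] ucp_unit[OF \<Phi>])
  from block_pos_two_bound[OF this] show ?thesis by (simp add: ker_ball_def distrib_left)
qed

lemma ucp_bdd: "pos_def U \<Longrightarrow> ucp U \<Phi> \<Longrightarrow> \<Phi> K \<in> ker_bdd U"
proof (cases "K \<in> ker_bdd U")
  case True
  assume "pos_def U" "ucp U \<Phi>"
  moreover obtain r where "r \<ge> 0" "K \<in> ker_ball U r" using True by (rule ker_bddE)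
  ultimately show ?thesis using ker_bddI ucp_ball by metis
next
  case False
  assume "ucp U \<Phi>"
  then show ?thesis using False ucp_unbdd ker_bdd_zero by metis
qed

lemma ucp_comp:
  assumes U: "pos_def U" and \<Phi>: "ucp U \<Phi>" and \<Psi>: "ucp U \<Psi>"
  shows "ucp U (\<Phi> \<circ> \<Psi>)"
  unfolding ucp_def comp_def
proof (intro conjI allI ballI impI)
  fix K L k assume K: "K \<in> ker_bdd U"
  show "\<Phi> (\<Psi> (ker_scale k K)) = ker_scale k (\<Phi> (\<Psi> K))"
    using ucp_scale[OF \<Phi> ucp_bdd[OF U \<Psi>]] ucp_scale[OF \<Psi> K] by simp
  assume L: "L \<in> ker_bdd U"
  show "\<Phi> (\<Psi> (K + L)) = \<Phi> (\<Psi> K) + \<Phi> (\<Psi> L)"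
    using ucp_add[OF \<Phi> ucp_bdd[OF U \<Psi>] ucp_bdd[OF U \<Psi>]] ucp_add[OF \<Psi> K L] by simp
next
  fix N m assume "\<forall>a b. m a b \<in> ker_bdd U" "block_pos N m"
  then have "block_pos N (\<lambda>a b. \<Psi> (m a b))" by (intro ucp_pos[OF \<Psi>]) blast+
  then show "block_pos N (\<lambda>a b. \<Phi> (\<Psi> (m a b)))"
    by (rule ucp_pos[OF \<Phi> ucp_bdd[OF U \<Psi>]])
next
  show "\<Phi> (\<Psi> U) = U" by (simp only: ucp_unit[OF \<Phi>] ucp_unit[OF \<Psi>])
next
  fix K assume "K \<notin> ker_bdd U"
  then show "\<Phi> (\<Psi> K) = 0" using ucp_unbdd[OF \<Psi>] ucp_zero[OF \<Phi>] by metis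
qed

section \<open>Compactness of the set of unital completely positive maps\<close>

lemma closed_nonneg_complex: "closed {z :: complex. 0 \<le> z}"
proof -
  have "{z :: complex. 0 \<le> z} = {z. 0 \<le> Re z \<and> Im z = 0}"
    by (auto simp: less_eq_complex_def)
  moreover have "closed {z. 0 \<le> Re z \<and> Im z = 0}"
    by (intro closed_Collect_conj closed_Collect_le closed_Collect_eq continuous_intros)
  ultimately show ?thesis by simp
qed

lemma continuous_on_eval:
  "continuous_on UNIV (\<lambda>\<Phi> :: 'k \<Rightarrow> 'd kernel. \<Phi> K s t)"
  by (rule continuous_on_product_then_coordinatewise[OF
        continuous_on_product_then_coordinatewise[OF continuous_on_product_coordinates]])

lemma compact_Pi_UNIV3:
  fixes X :: "'i \<Rightarrow> 'j \<Rightarrow> 'k \<Rightarrow> 'b::topological_space set"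
  assumes X: "\<And>i j k. compact (X i j k)"
  shows "compact {f. \<forall>i j k. f i j k \<in> X i j k}"
proof -
  have 1: "compact {f. \<forall>k. f k \<in> X i j k}" for i j
    by (rule compact_Pi_UNIV[OF X])
  have 2: "compact {f. \<forall>j. f j \<in> {g. \<forall>k. g k \<in> X i j k}}" for i
    by (rule compact_Pi_UNIV[OF 1])
  have "compact {f. \<forall>i. f i \<in> {f. \<forall>j. f j \<in> {g. \<forall>k. g k \<in> X i j k}}}"
    by (rule compact_Pi_UNIV[OF 2])
  then show ?thesis by simp
qed

text \<open>Contractivity confines each value \<open>\<Phi> K s t\<close> to a fixed disc, so
  Tychonoff's theorem applies. The defining conditions are equations and inequalities between such
  values, hence closed. \<open>R\<close> lists prescribed values.\<close>

lemma compact_ucp: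
  assumes U: "pos_def U"
  shows "compact {\<Phi>. ucp U \<Phi> \<and> (\<forall>(K, L)\<in>R. \<Phi> K = L)}" (is "compact ?S")
proof -
  define r where "r = (\<lambda>K. SOME r. r \<ge> 0 \<and> K \<in> ker_ball U r)"
  have r: "r K \<ge> 0 \<and> K \<in> ker_ball U (r K)" if "K \<in> ker_bdd U" for K
  proof -
    have "\<exists>r. r \<ge> 0 \<and> K \<in> ker_ball U r" using that unfolding ker_bdd_def by blast
    then show ?thesis unfolding r_def by (rule someI_ex)
  qed
  \<comment> \<open>Radius 0 at unbounded kernels matches the default value in
    \<open>ucp\<close>.\<close>
  define b where "b = (\<lambda>K s t. if K \<in> ker_bdd U then r K * (Re (U s s) + Re (U t t)) / 2 else 0)"
  define T :: "('a kernel \<Rightarrow> 'a kernel) set"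
    where "T = {\<Phi>. \<forall>K s t. \<Phi> K s t \<in> cball 0 (b K s t)}"
  have T: "compact T"
    unfolding T_def by (rule compact_Pi_UNIV3) (rule compact_cball)
  have "?S \<subseteq> T"
  proof
    fix \<Phi> assume "\<Phi> \<in> ?S"
    then have \<Phi>: "ucp U \<Phi>" by simp
    have "cmod (\<Phi> K s t) \<le> b K s t" for K s t
    proof (cases "K \<in> ker_bdd U")
      case True
      then have "\<Phi> K \<in> ker_ball U (r K)" using ucp_ball[OF U \<Phi>] r by blast
      then show ?thesis using ker_ball_entry[of "\<Phi> K" U "r K" s t] True by (simp add: b_def)
    next
      case False
      then show ?thesis using ucp_unbdd[OF \<Phi>] by (simp add: b_def)
    qed
    then show "\<Phi> \<in> T" by (simp add: T_def)
  qed
  moreover have "closed ?S"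
  proof -
    note c = continuous_on_eval
    have 1: "closed {\<Phi> :: 'a kernel \<Rightarrow> 'a kernel. \<Phi> (K + L) = \<Phi> K + \<Phi> L}" for K L
      unfolding fun_eq_iff plus_fun_apply
      by (intro closed_Collect_all closed_Collect_eq continuous_intros c)
    have 2: "closed {\<Phi> :: 'a kernel \<Rightarrow> 'a kernel.
        \<Phi> (ker_scale k K) = ker_scale k (\<Phi> K)}" for k K
      unfolding fun_eq_iff ker_scale_def[of k "_ K"]
      by (intro closed_Collect_all closed_Collect_eq continuous_intros c)
    have 3: "closed {\<Phi> :: 'a kernel \<Rightarrow> 'a kernel. \<Phi> K = L}" for K L
      unfolding fun_eq_iff
      by (intro closed_Collect_all closed_Collect_eq continuous_intros c)
    have 4: "closed {\<Phi> :: 'a kernel \<Rightarrow> 'a kernel.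
        block_pos N (\<lambda>a b. \<Phi> (m a b))}" for N m
    proof -
      have "closed ((\<lambda>\<Phi> :: 'a kernel \<Rightarrow> 'a kernel.
          \<Sum>a<N. \<Sum>b<N. ker_form n s (C a) (C b) (\<Phi> (m a b))) -` {z. 0 \<le> z})" for n s C
        unfolding ker_form_def
        by (intro closed_vimage closed_nonneg_complex continuous_intros c)
      then show ?thesis
        unfolding block_pos_def by (intro closed_Collect_all) (simp add: vimage_def)
    qed
    show ?thesis
      unfolding ucp_def Ball_def split_def
      by (intro closed_Collect_conj closed_Collect_all closed_Collect_imp open_Collect_const 1 2 3 4)
  qed
  ultimately show ?thesis
    using compact_Int_closed[OF T, of ?S] by (simp add: Int_absorb1)
qed

text \<open>Composition is continuous in its left argument only.\<close>

lemma idempotent_ucp: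
  assumes U: "pos_def U" and \<Theta>: "ucp U \<Theta>" and \<Theta>R: "\<And>K L. (K, L) \<in> R \<Longrightarrow> \<Theta> K = L"
    and R: "\<And>K L. (K, L) \<in> R \<Longrightarrow> L = 0 \<or> (L, L) \<in> R"
  shows "\<exists>\<Phi>. ucp U \<Phi> \<and> (\<forall>K L. (K, L) \<in> R \<longrightarrow> \<Phi> K = L) \<and> (\<forall>K. \<Phi> (\<Phi> K) = \<Phi> K)"
proof -
  define S where "S = {\<Phi>. ucp U \<Phi> \<and> (\<forall>(K, L)\<in>R. \<Phi> K = L)}"
  have "\<exists>\<Phi>\<in>S. \<Phi> \<circ> \<Phi> = \<Phi>"
  proof (rule compact_semigroup_idempotent[of S "(\<circ>)"])
    show "compact S" unfolding S_def by (rule compact_ucp[OF U])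
    show "S \<noteq> {}" using \<Theta> \<Theta>R by (auto simp: S_def)
    show "\<Phi> \<circ> \<Psi> \<in> S" if "\<Phi> \<in> S" "\<Psi> \<in> S" for \<Phi> \<Psi>
    proof -
      have "ucp U (\<Phi> \<circ> \<Psi>)" using ucp_comp[OF U] that by (auto simp: S_def)
      moreover have "(\<Phi> \<circ> \<Psi>) K = L" if "(K, L) \<in> R" for K L
      proof -
        have "\<Psi> K = L" using \<open>\<Psi> \<in> S\<close> that by (auto simp: S_def)
        \<comment> \<open>A prescribed value is 0 or is itself prescribed to be fixed, which makes
          the set closed under composition.\<close>
        moreover have "\<Phi> L = L"
          using R[OF that] \<open>\<Phi> \<in> S\<close> ucp_zero[of U \<Phi>] by (auto simp: S_def)
        ultimately show ?thesis by simp
      qed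
      ultimately show ?thesis by (auto simp: S_def)
    qed
    show "continuous_on S (\<lambda>\<Phi>. \<Phi> \<circ> \<Psi>)" for \<Psi>
      unfolding comp_def
      by (intro continuous_on_coordinatewise_then_product continuous_on_subset[OF continuous_on_eval]) auto
  qed (auto simp: comp_assoc)
  then obtain \<Phi> where \<Phi>: "\<Phi> \<in> S" "\<Phi> \<circ> \<Phi> = \<Phi>" by (rule bexE)
  show ?thesis
  proof (intro exI[of _ \<Phi>] conjI allI impI)
    show "ucp U \<Phi>" "\<And>K L. (K, L) \<in> R \<Longrightarrow> \<Phi> K = L" using \<Phi>(1) by (auto simp: S_def)
    show "\<Phi> (\<Phi> K) = \<Phi> K" for K using fun_cong[OF \<Phi>(2), of K] by simp
  qed
qed

section \<open>Positivity in matrices over a C*-algebra\<close>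

text \<open>Successive coefficients have ratio \<open>(1/2 - k) / (k + 1)\<close>, of modulus at
  most 1. The bound lets a geometric series dominate the binomial series.\<close>

lemma abs_gbinomial_half_le: "\<bar>(1/2 :: real) gchoose k\<bar> \<le> 1"
proof (induction k)
  case (Suc k)
  have "(1/2 :: real) gchoose Suc k = ((1/2 - real k) / real (Suc k)) * (1/2 gchoose k)"
    using gbinomial_mult_1[of "1/2 :: real" k] by (simp add: field_simps)
  then have "\<bar>(1/2 :: real) gchoose Suc k\<bar> = \<bar>(1/2 - real k) / real (Suc k)\<bar> * \<bar>1/2 gchoose k\<bar>"
    by (simp only: abs_mult)
  also have "\<dots> \<le> 1 * 1"
    by (rule mult_mono) (use Suc in \<open>auto simp: field_simps abs_le_iff\<close>)
  finally show ?case by simp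
qed simp

locale cstar =
  fixes sc :: "complex \<Rightarrow> 'a::{real_normed_algebra_1,banach} \<Rightarrow> 'a" and st :: "'a \<Rightarrow> 'a"
  assumes cstar_alg: "cstar_alg sc st"
begin

lemma sc_of_real: "sc (of_real r) a = r *\<^sub>R a"
  and sc_sc: "sc c (sc d a) = sc (c * d) a"
  and sc_add_left: "sc (c + d) a = sc c a + sc d a"
  and sc_add: "sc c (a + b) = sc c a + sc c b"
  and st_st: "st (st a) = a" and st_add: "st (a + b) = st a + st b"
  and st_sc: "st (sc c a) = sc (cnj c) (st a)" and st_mult: "st (a * b) = st b * st a"
  and norm_st_mult: "norm (st a * a) = (norm a)\<^sup>2"
  using cstar_alg unfolding cstar_alg_def by simp_all

sublocale sc: vector_space sc
  using sc_of_real[of 1] by unfold_locales (auto simp: sc_sc sc_add_left sc_add)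

lemma sc_mult_left: "sc c (a * b) = sc c a * b"
  using cstar_alg unfolding cstar_alg_def by blast

lemma sc_mult_right: "sc c (a * b) = a * sc c b"
  using cstar_alg unfolding cstar_alg_def by blast

lemma st_zero: "st 0 = 0"
  using st_add[of 0 0] by simp

lemma st_one: "st 1 = 1"
  using st_mult[of "st 1" 1] by (simp add: st_st)

lemma st_neg: "st (- a) = - st a"
  using st_add[of a "- a"] by (simp add: st_zero eq_neg_iff_add_eq_0 add.commute)

lemma st_diff: "st (a - b) = st a - st b"
  using st_add[of a "- b"] by (simp add: st_neg)

lemma st_scaleR: "st (r *\<^sub>R a) = r *\<^sub>R st a"
  using st_sc[of "of_real r" a] by (simp add: sc_of_real)

lemma st_sum: "st (sum f A) = (\<Sum>x\<in>A. st (f x))"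
  using sum_comp_morphism[of st f A] by (simp add: st_zero st_add comp_def)

lemma norm_le_norm_st: "norm a \<le> norm (st a)"
proof (cases "a = 0")
  case False
  have "(norm a)\<^sup>2 \<le> norm (st a) * norm a" by (metis norm_st_mult norm_mult_ineq)
  then show ?thesis using False by (simp add: power2_eq_square)
qed simp

lemma norm_st: "norm (st a) = norm a"
  using norm_le_norm_st[of a] norm_le_norm_st[of "st a"] by (simp add: st_st)

lemma st_bounded_linear: "bounded_linear st"
  by (rule bounded_linear_intro[where K = 1]) (auto simp: st_add st_scaleR norm_st)

lemma st_power: "st a = a \<Longrightarrow> st (a ^ k) = a ^ k"
  by (induction k) (auto simp: st_one st_mult power_commutes)

text \<open>The square root is the binomial series \<open>\<Sum>k. (1/2 gchoose k) (-h)^k\<close>.\<close>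

lemma ex_sqrt:
  assumes h: "st h = h" "norm h < 1"
  obtains s where "st s = s" "s * s = 1 - h"
proof -
  define f where "f = (\<lambda>k. ((-1) ^ k * (1/2 gchoose k)) *\<^sub>R h ^ k)"
  have f_le: "norm (f k) \<le> norm h ^ k" for k
  proof -
    have "norm (f k) = \<bar>1/2 gchoose k\<bar> * norm (h ^ k)" by (simp add: f_def abs_mult)
    also have "\<dots> \<le> 1 * norm h ^ k"
      by (intro mult_mono abs_gbinomial_half_le norm_power_ineq) auto
    finally show ?thesis by simp
  qed
  have sum_norm: "summable (\<lambda>k. norm (f k))"
    by (rule summable_comparison_test'[OF summable_geometric[of "norm h"], of 0]) (use f_le h in auto)
  then have sum: "summable f" by (rule summable_norm_cancel)
  define s where "s = (\<Sum>k. f k)"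
  have "st s = (\<Sum>k. st (f k))" unfolding s_def
    using bounded_linear.suminf[OF st_bounded_linear sum] .
  also have "\<dots> = s" by (simp add: s_def f_def st_scaleR st_power h)
  finally have st_s: "st s = s" .
  have "(\<lambda>k. \<Sum>i\<le>k. f i * f (k - i)) sums (s * s)"
    unfolding s_def by (rule Cauchy_product_sums[OF sum_norm sum_norm])
  moreover have "(\<Sum>i\<le>k. f i * f (k - i)) = ((-1) ^ k * (1 gchoose k)) *\<^sub>R h ^ k" for k
  proof -
    have "(\<Sum>i\<le>k. f i * f (k - i)) =
        (\<Sum>i\<le>k. ((-1) ^ k * ((1/2 gchoose i) * (1/2 gchoose (k - i)))) *\<^sub>R h ^ k)"
    proof (rule sum.cong[OF refl])
      fix i assume "i \<in> {..k}"
      then have "i + (k - i) = k" by simp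
      then have "h ^ i * h ^ (k - i) = h ^ k" "(-1) ^ i * (-1) ^ (k - i) = ((-1) ^ k :: real)"
        by (metis power_add)+
      then show "f i * f (k - i) = ((-1) ^ k * ((1/2 gchoose i) * (1/2 gchoose (k - i)))) *\<^sub>R h ^ k"
        unfolding f_def by (simp add: mult_ac)
    qed
    also have "\<dots> = ((-1) ^ k * (\<Sum>i\<le>k. (1/2 gchoose i) * (1/2 gchoose (k - i)))) *\<^sub>R h ^ k"
      by (simp add: scaleR_sum_left sum_distrib_left)
    \<comment> \<open>Vandermonde: the squared series has the coefficients of the first power of
      \<open>1 - h\<close>, which vanish from k = 2 on.\<close>
    also have "(\<Sum>i\<le>k. (1/2 gchoose i) * (1/2 gchoose (k - i))) = (1 :: real) gchoose k"
      using gbinomial_Vandermonde[of "1/2 :: real" "1/2" k] by (simp add: atLeast0AtMost)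
    finally show ?thesis .
  qed
  ultimately have 1: "(\<lambda>k. ((-1) ^ k * (1 gchoose k)) *\<^sub>R h ^ k) sums (s * s)" by simp
  have "(1 :: real) gchoose k = 0" if "k \<notin> {..1}" for k
    using that binomial_gbinomial[of 1 k, where 'a = real] by (simp add: binomial_eq_0)
  then have "(\<lambda>k. ((-1) ^ k * (1 gchoose k)) *\<^sub>R h ^ k) sums
      (\<Sum>k\<in>{..1}. ((-1) ^ k * (1 gchoose k)) *\<^sub>R h ^ k)"
    by (intro sums_finite) auto
  with 1 have "s * s = (\<Sum>k\<in>{..1}. ((-1) ^ k * (1 gchoose k)) *\<^sub>R h ^ k)"
    by (rule sums_unique2)
  then have "s * s = 1 - h" by simp
  then show ?thesis using that st_s by blast
qed

text \<open>The substitute for functional calculus: what completes a block matrix to a sum of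
  squares is always of this shape, with r large.\<close>

lemma ex_sqrt_diff:
  assumes "(norm a)\<^sup>2 < r"
  obtains s where "st s = s" "s * s = r *\<^sub>R 1 - st a * a"
proof -
  have r: "r > 0" using assms by (meson le_less_trans zero_le_power2)
  define h where "h = (1 / r) *\<^sub>R (st a * a)"
  have "st h = h" by (simp add: h_def st_scaleR st_mult st_st)
  moreover have "norm h < 1" using assms r by (simp add: h_def norm_st_mult)
  ultimately obtain s where s: "st s = s" "s * s = 1 - h" by (rule ex_sqrt)
  show ?thesis
  proof (rule that[of "sqrt r *\<^sub>R s"])
    show "st (sqrt r *\<^sub>R s) = sqrt r *\<^sub>R s" by (simp add: st_scaleR s)
    show "(sqrt r *\<^sub>R s) * (sqrt r *\<^sub>R s) = r *\<^sub>R 1 - st a * a"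
      using r by (simp add: s h_def scaleR_diff_right)
  qed
qed

text \<open>Unlike in \<open>mpos\<close>, the number of summands is not tied to the matrix size, which makes
  closure under sums trivial.\<close>

definition sum_squares :: "nat \<Rightarrow> (nat \<Rightarrow> nat \<Rightarrow> 'a) \<Rightarrow> bool" where
  "sum_squares n x \<longleftrightarrow> (\<exists>(M::nat) y. \<forall>i<n. \<forall>j<n. x i j = (\<Sum>m<M. st (y m i) * y m j))"

section \<open>Sums of squares as positive matrices\<close>

lemma sum_squaresI:
  "(\<And>i j. i < n \<Longrightarrow> j < n \<Longrightarrow> x i j = (\<Sum>m<M::nat. st (y m i) * y m j)) \<Longrightarrow> sum_squares n x"
  unfolding sum_squares_def by metis

lemma mpos_sum_squares: "mpos st n x \<Longrightarrow> sum_squares n x"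
  unfolding mpos_def sum_squares_def by blast

lemma sum_squares_zero: "sum_squares n (\<lambda>i j. 0)"
  by (rule sum_squaresI[of _ _ 0]) simp

lemma sum_squares_add:
  assumes "sum_squares n x" "sum_squares n x'" shows "sum_squares n (\<lambda>i j. x i j + x' i j)"
proof -
  obtain M y where y: "\<And>i j. i < n \<Longrightarrow> j < n \<Longrightarrow> x i j = (\<Sum>m<M::nat. st (y m i) * y m j)"
    using assms(1) unfolding sum_squares_def by metis
  obtain M' y' where y': "\<And>i j. i < n \<Longrightarrow> j < n \<Longrightarrow> x' i j = (\<Sum>m<M'::nat. st (y' m i) * y' m j)"
    using assms(2) unfolding sum_squares_def by metis
  define w where "w = (\<lambda>m. if m < M then y m else y' (m - M))"
  show ?thesis
  proof (rule sum_squaresI)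
    fix i j assume ij: "i < n" "j < n"
    show "x i j + x' i j = (\<Sum>m<M + M'. st (w m i) * w m j)"
      unfolding sum_lessThan_plus by (simp add: w_def y[OF ij] y'[OF ij])
  qed
qed

lemma sum_squares_sum:
  "finite A \<Longrightarrow> (\<And>a. a \<in> A \<Longrightarrow> sum_squares n (f a)) \<Longrightarrow>
    sum_squares n (\<lambda>i j. \<Sum>a\<in>A. f a i j)"
proof (induction A rule: finite_induct)
  case empty then show ?case by (simp add: sum_squares_zero)
next
  case (insert a A) then show ?case by (simp add: sum_squares_add)
qed

lemma sum_squares_scale:
  assumes "sum_squares n x" "t \<ge> 0" shows "sum_squares n (\<lambda>i j. t *\<^sub>R x i j)"
proof -
  obtain M y where y: "\<And>i j. i < n \<Longrightarrow> j < n \<Longrightarrow> x i j = (\<Sum>m<M::nat. st (y m i) * y m j)"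
    using assms(1) unfolding sum_squares_def by metis
  show ?thesis
  proof (rule sum_squaresI)
    fix i j assume ij: "i < n" "j < n"
    show "t *\<^sub>R x i j = (\<Sum>m<M. st (sqrt t *\<^sub>R y m i) * (sqrt t *\<^sub>R y m j))"
      using assms(2) by (simp add: y[OF ij] st_scaleR scaleR_sum_right)
  qed
qed

lemma sum_squares_cong:
  "sum_squares n x \<Longrightarrow> (\<And>i j. i < n \<Longrightarrow> j < n \<Longrightarrow> x i j = x' i j) \<Longrightarrow> sum_squares n x'"
  unfolding sum_squares_def by metis

text \<open>The square of the row with 1 at i and \<open>- a\<close> at j has
  \<open>st a * a\<close> at (j, j); a second row, the root s of the defect at j, raises this to r.
  The case i = j is included, where the two entries of the first row add up.\<close>

lemma sum_squares_unit_minus: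
  assumes "i < n" "j < n" and r: "(norm a)\<^sup>2 < r"
  shows "sum_squares n (\<lambda>k l. (if k = i \<and> l = i then 1 else 0) +
    (if k = j \<and> l = j then r *\<^sub>R 1 else 0) -
    (if k = i \<and> l = j then a else 0) - (if k = j \<and> l = i then st a else 0))"
proof -
  obtain s where s: "st s = s" "s * s = r *\<^sub>R 1 - st a * a" using ex_sqrt_diff[OF r] .
  define y where "y = (\<lambda>m::nat. \<lambda>k. if m = 0 then (if k = i then 1 else 0) - (if k = j then a else 0)
    else (if k = j then s else 0))"
  show ?thesis
  proof (rule sum_squaresI[where M = 2 and y = y])
    fix k l
    show "(if k = i \<and> l = i then 1 else 0) + (if k = j \<and> l = j then r *\<^sub>R 1 else 0) -
      (if k = i \<and> l = j then a else 0) - (if k = j \<and> l = i then st a else 0) =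
      (\<Sum>m<2. st (y m k) * y m l)"
    proof -
      have "(\<Sum>m<2. st (y m k) * y m l) =
          ((if k = i then 1 else 0) - (if k = j then st a else 0)) *
          ((if l = i then 1 else 0) - (if l = j then a else 0)) +
          (if k = j then s else 0) * (if l = j then s else 0)"
        by (simp add: numeral_2_eq_2 y_def st_zero st_one st_diff s(1) if_distrib[of st])
      also have "\<dots> = (if k = i \<and> l = i then 1 else 0) - (if k = i \<and> l = j then a else 0) -
          (if k = j \<and> l = i then st a else 0) + (if k = j \<and> l = j then st a * a + s * s else 0)"
        unfolding left_diff_distrib right_diff_distrib by simp
      finally show ?thesis by (simp add: s(2))
    qed
  qed
qed

text \<open>Summing \<open>sum_squares_unit_minus\<close> over all pairs of indices subtracts every
  entry of x twice, once as the adjoint of the transposed entry, from a multiple of the identity;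
  then halve.\<close>

lemma sum_squares_order_unit:
  assumes herm: "\<And>i j. i < n \<Longrightarrow> j < n \<Longrightarrow> st (x j i) = x i j"
  obtains r where "r \<ge> 0" "sum_squares n (\<lambda>i j. (if i = j then r *\<^sub>R 1 else 0) - x i j)"
proof -
  \<comment> \<open>The summand 1 makes R strictly larger than each squared norm.\<close>
  define R where "R = 1 + (\<Sum>i<n. \<Sum>j<n. (norm (x i j))\<^sup>2)"
  have R: "(norm (x i j))\<^sup>2 < R" if "i < n" "j < n" for i j
  proof -
    have "(norm (x i j))\<^sup>2 \<le> (\<Sum>j<n. (norm (x i j))\<^sup>2)"
      using that by (intro member_le_sum) auto
    also have "\<dots> \<le> (\<Sum>i<n. \<Sum>j<n. (norm (x i j))\<^sup>2)"
      using that by (intro member_le_sum[of i _ "\<lambda>i. \<Sum>j<n. (norm (x i j))\<^sup>2"]) (auto intro: sum_nonneg)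
    finally show ?thesis by (simp add: R_def)
  qed
  define f where "f = (\<lambda>i j k l. (if k = i \<and> l = i then 1 else 0) +
    (if k = j \<and> l = j then R *\<^sub>R 1 else 0) -
    (if k = i \<and> l = j then x i j else 0) - (if k = j \<and> l = i then st (x i j) else 0))"
  have f: "sum_squares n (f i j)" if "i < n" "j < n" for i j
    unfolding f_def using sum_squares_unit_minus[OF that R[OF that]] .
  have "sum_squares n (\<lambda>k l. \<Sum>i<n. \<Sum>j<n. f i j k l)"
  proof (rule sum_squares_sum)
    fix i assume "i \<in> {..<n}"
    then show "sum_squares n (\<lambda>k l. \<Sum>j<n. f i j k l)"
      using f by (intro sum_squares_sum) auto
  qed simp
  moreover have "(\<Sum>i<n. \<Sum>j<n. f i j k l) =
      (if k = l then (real n * (1 + R)) *\<^sub>R 1 else 0) - 2 *\<^sub>R x k l" if kl: "k < n" "l < n" for k l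
  proof -
    have 1: "(\<Sum>i<n. \<Sum>j<n. if k = i \<and> l = i then 1 else (0 :: 'a)) =
        (if k = l then real n *\<^sub>R 1 else 0)"
    proof -
      have "(\<Sum>i<n. \<Sum>j<n. if k = i \<and> l = i then 1 else (0 :: 'a)) =
          (\<Sum>i<n. if i = k then (if k = l then real n *\<^sub>R 1 else 0) else 0)"
        by (intro sum.cong refl) (auto simp: scaleR_conv_of_real)
      then show ?thesis using kl by simp
    qed
    have 2: "(\<Sum>i<n. \<Sum>j<n. if k = j \<and> l = j then R *\<^sub>R 1 else (0 :: 'a)) =
        (if k = l then (real n * R) *\<^sub>R 1 else 0)"
    proof -
      have "(\<Sum>j<n. if k = j \<and> l = j then R *\<^sub>R 1 else (0 :: 'a)) =
          (\<Sum>j<n. if j = k then (if k = l then R *\<^sub>R 1 else 0) else 0)"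
        by (intro sum.cong refl) auto
      then have "(\<Sum>j<n. if k = j \<and> l = j then R *\<^sub>R 1 else (0 :: 'a)) =
          (if k = l then R *\<^sub>R 1 else 0)" using kl by simp
      then show ?thesis by (simp add: scaleR_conv_of_real)
    qed
    have 3: "(\<Sum>i<n. \<Sum>j<n. if k = i \<and> l = j then g i j else 0) = g k l" for g :: "nat \<Rightarrow> nat \<Rightarrow> 'a"
    proof -
      have "(\<Sum>i<n. \<Sum>j<n. if k = i \<and> l = j then g i j else 0) =
          (\<Sum>i<n. \<Sum>j<n. if i = k \<and> j = l then g i j else 0)"
        by (intro sum.cong refl) auto
      then show ?thesis using sum_two_deltas[OF kl, of g] by simp
    qed
    have 4: "(\<Sum>i<n. \<Sum>j<n. if k = j \<and> l = i then st (x i j) else 0) = x k l"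
    proof -
      have "(\<Sum>i<n. \<Sum>j<n. if k = j \<and> l = i then st (x i j) else 0) =
          (\<Sum>j<n. \<Sum>i<n. if k = j \<and> l = i then st (x i j) else 0)"
        by (rule sum.swap)
      then show ?thesis using 3[of "\<lambda>j i. st (x i j)"] herm kl by simp
    qed
    show ?thesis
      unfolding f_def sum_subtractf sum.distrib 1 2 3 4
      by (simp add: scaleR_2 distrib_left scaleR_add_left)
  qed
  ultimately have "sum_squares n (\<lambda>k l. (if k = l then (real n * (1 + R)) *\<^sub>R 1 else 0) - 2 *\<^sub>R x k l)"
    by (rule sum_squares_cong)
  then have "sum_squares n (\<lambda>k l. (1/2) *\<^sub>R ((if k = l then (real n * (1 + R)) *\<^sub>R 1 else 0) - 2 *\<^sub>R x k l))"
    by (rule sum_squares_scale) simp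
  then have "sum_squares n (\<lambda>k l. (if k = l then (real n * (1 + R) / 2) *\<^sub>R 1 else 0) - x k l)"
    by (rule sum_squares_cong) (auto simp: scaleR_diff_right)
  moreover have "R \<ge> 0" unfolding R_def by (intro add_nonneg_nonneg sum_nonneg) auto
  ultimately show ?thesis using that[of "real n * (1 + R) / 2"] by simp
qed

end

section \<open>The universal kernel representation\<close>

text \<open>A completely positive map from the algebra to infinite matrices is encoded by its entry
  functionals \<open>f i j\<close>. The kernels \<open>rep a\<close> live on triples \<open>(f, i, d)\<close>, where \<open>(f, i)\<close>
  is the \<open>i\<close>-th cyclic vector of the representation constructed from \<open>f\<close>, moved by \<open>d\<close>.
  Distinct \<open>f\<close> are orthogonal, so that \<open>rep\<close> plays the role of a direct sum of
  representations.\<close>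

type_synonym 'a gns_point = "(nat \<Rightarrow> nat \<Rightarrow> 'a \<Rightarrow> complex) \<times> nat \<times> 'a"

context cstar
begin

text \<open>Positivity of the semi-inner product \<open>f i j (st y * z)\<close> between y times the
  i-th and z times the j-th cyclic vector. The index map may repeat values, since several y may act
  on one cyclic vector.\<close>

definition cp_form :: "(nat \<Rightarrow> nat \<Rightarrow> 'a \<Rightarrow> complex) \<Rightarrow> bool" where
  "cp_form f \<longleftrightarrow> (\<forall>i j a b. f i j (a + b) = f i j a + f i j b) \<and>
     (\<forall>i j c a. f i j (sc c a) = c * f i j a) \<and>
     (\<forall>n i y. 0 \<le> (\<Sum>k<n::nat. \<Sum>l<n. f (i k) (i l) (st (y k) * y l)))"

text \<open>The entry is the inner product of d times the i-th vector with a d' times the j-th. A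
  function that is no \<open>cp_form\<close> contributes 0, so every function can serve as a
  point.\<close>

definition rep :: "'a \<Rightarrow> 'a gns_point kernel" where
  "rep a = (\<lambda>(f, i, d) (g, j, d'). if f = g \<and> cp_form f then f i j (st d * a * d') else 0)"

abbreviation "unit_ker \<equiv> rep 1"

lemma cp_form_add: "cp_form f \<Longrightarrow> f i j (a + b) = f i j a + f i j b"
  and cp_form_sc: "cp_form f \<Longrightarrow> f i j (sc c a) = c * f i j a"
  and cp_form_pos: "cp_form f \<Longrightarrow> 0 \<le> (\<Sum>k<n::nat. \<Sum>l<n. f (\<iota> k) (\<iota> l) (st (y k) * y l))"
  by (simp_all add: cp_form_def)

lemma cp_form_zero: "cp_form f \<Longrightarrow> f i j 0 = 0"
  using cp_form_sc[of f i j 0 0] by simp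

lemma rep_add: "rep (a + b) = rep a + rep b"
  by (intro ext) (auto simp: rep_def split_def cp_form_add distrib_left distrib_right)

lemma rep_sc: "rep (sc c a) = ker_scale c (rep a)"
proof -
  have "st d * sc c a * d' = sc c (st d * a * d')" for d d'
    by (metis sc_mult_left sc_mult_right)
  then show ?thesis by (intro ext) (auto simp: rep_def ker_scale_def split_def cp_form_sc)
qed

lemma rep_zero: "rep 0 = 0"
  using rep_sc[of 0 0] by simp

lemma rep_neg: "rep (- a) = - rep a"
  using rep_sc[of "-1" a] by simp

lemma rep_diff: "rep (a - b) = rep a - rep b"
  using rep_add[of a "- b"] by (simp add: rep_neg)

lemma rep_scaleR: "rep (r *\<^sub>R a) = ker_scale (of_real r) (rep a)"
  using rep_sc[of "of_real r" a] by (simp add: sc_of_real)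

text \<open>With x written through rows \<open>y m\<close>, the coefficients and the points combine
  into algebra elements \<open>g m k\<close>, and the block form becomes a sum of values of the f at
  \<open>st (g m k) * g m l\<close>.\<close>

lemma rep_pos:
  assumes "sum_squares N x" shows "block_pos N (\<lambda>a b. rep (x a b))"
  unfolding block_pos_def
proof (intro allI)
  fix n and s :: "nat \<Rightarrow> 'a gns_point"
    and C :: "nat \<Rightarrow> nat \<Rightarrow> complex"
  obtain M y where y: "\<And>a b. a < N \<Longrightarrow> b < N \<Longrightarrow> x a b = (\<Sum>m<M::nat. st (y m a) * y m b)"
    using assms unfolding sum_squares_def by metis
  define F where "F = (\<lambda>k. fst (s k))"
  define I where "I = (\<lambda>k. fst (snd (s k)))"
  define D where "D = (\<lambda>k. snd (snd (s k)))"
  define T where "T = (\<lambda>k l z. if F k = F l \<and> cp_form (F k) then F k (I k) (I l) z else 0)"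
  have T_add: "T k l (z + z') = T k l z + T k l z'" for k l z z' by (auto simp: T_def cp_form_add)
  have T_zero: "T k l 0 = 0" for k l by (auto simp: T_def cp_form_zero)
  have T_sc: "T k l (sc c z) = c * T k l z" for k l c z by (auto simp: T_def cp_form_sc)
  have T_sum: "T k l (sum h A) = (\<Sum>a\<in>A. T k l (h a))" for k l A and h :: "nat \<Rightarrow> 'a"
    using sum_comp_morphism[of "T k l" h A] by (simp add: T_add T_zero comp_def)
  have rep_T: "rep z (s k) (s l) = T k l (st (D k) * z * D l)" for z k l
    by (auto simp: rep_def T_def F_def I_def D_def split_def)
  define g where "g = (\<lambda>m k. \<Sum>a<N. sc (C a k) (y m a * D k))"
  have "(\<Sum>a<N. \<Sum>b<N. sc (cnj (C a k) * C b l) (st (D k) * x a b * D l)) =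
      (\<Sum>m<M. st (g m k) * g m l)" for k l
  proof -
    have 1: "sc (cnj (C a k) * C b l) (st (D k) * (st (y m a) * y m b) * D l) =
        st (sc (C a k) (y m a * D k)) * sc (C b l) (y m b * D l)" for a b m
    proof -
      have "st (sc (C a k) (y m a * D k)) * sc (C b l) (y m b * D l) =
          sc (cnj (C a k)) (st (D k) * st (y m a)) * sc (C b l) (y m b * D l)"
        by (simp add: st_sc st_mult)
      also have "\<dots> = sc (cnj (C a k)) (sc (C b l) ((st (D k) * st (y m a)) * (y m b * D l)))"
        by (simp only: sc_mult_left[symmetric] sc_mult_right[symmetric] sc.scale_left_commute)
      finally show ?thesis by (simp add: mult.assoc)
    qed
    have "(\<Sum>a<N. \<Sum>b<N. sc (cnj (C a k) * C b l) (st (D k) * x a b * D l)) =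
        (\<Sum>a<N. \<Sum>b<N. \<Sum>m<M. st (sc (C a k) (y m a * D k)) * sc (C b l) (y m b * D l))"
    proof (intro sum.cong refl)
      fix a b assume "a \<in> {..<N}" "b \<in> {..<N}"
      then show "sc (cnj (C a k) * C b l) (st (D k) * x a b * D l) =
          (\<Sum>m<M. st (sc (C a k) (y m a * D k)) * sc (C b l) (y m b * D l))"
        by (simp only: y lessThan_iff sum_distrib_left sum_distrib_right sc.scale_sum_right 1)
    qed
    also have "\<dots> = (\<Sum>m<M. \<Sum>a<N. \<Sum>b<N. st (sc (C a k) (y m a * D k)) * sc (C b l) (y m b * D l))"
      by (simp only: sum.swap[of _ "{..<M}"])
    also have "\<dots> = (\<Sum>m<M. st (g m k) * g m l)"
      by (simp only: g_def st_sum sum_product)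
    finally show ?thesis .
  qed
  then have "(\<Sum>k<n. \<Sum>l<n. T k l (\<Sum>a<N. \<Sum>b<N. sc (cnj (C a k) * C b l) (st (D k) * x a b * D l))) =
      (\<Sum>k<n. \<Sum>l<n. \<Sum>m<M. T k l (st (g m k) * g m l))"
    by (simp add: T_sum)
  also have "\<dots> = (\<Sum>m<M. \<Sum>k<n. \<Sum>l<n. T k l (st (g m k) * g m l))"
    by (simp only: sum.swap[of _ "{..<M}"])
  also have "0 \<le> \<dots>"
  proof (rule sum_nonneg)
    fix m
    \<comment> \<open>Distinct f are orthogonal: split the points according to their f, putting 0
      for all others, and apply \<open>cp_form_pos\<close> to each part.\<close>
    have "(\<Sum>k<n. \<Sum>l<n. T k l (st (g m k) * g m l)) =
       (\<Sum>k<n. \<Sum>l<n. \<Sum>f\<in>F ` {..<n}. if cp_form f then f (I k) (I l)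
          (st (if F k = f then g m k else 0) * (if F l = f then g m l else 0)) else 0)"
    proof (intro sum.cong refl)
      fix k l assume "k \<in> {..<n}"
      then have "T k l (st (g m k) * g m l) =
          (\<Sum>f\<in>F ` {..<n}. if f = F k then T k l (st (g m k) * g m l) else 0)"
        by simp
      also have "\<dots> = (\<Sum>f\<in>F ` {..<n}. if cp_form f then f (I k) (I l)
          (st (if F k = f then g m k else 0) * (if F l = f then g m l else 0)) else 0)"
        by (intro sum.cong refl) (auto simp: T_def st_zero cp_form_zero)
      finally show "T k l (st (g m k) * g m l) = (\<Sum>f\<in>F ` {..<n}. if cp_form f then f (I k) (I l)
          (st (if F k = f then g m k else 0) * (if F l = f then g m l else 0)) else 0)" .
    qed
    also have "\<dots> = (\<Sum>f\<in>F ` {..<n}. \<Sum>k<n. \<Sum>l<n. if cp_form f then f (I k) (I l)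
          (st (if F k = f then g m k else 0) * (if F l = f then g m l else 0)) else 0)"
      by (simp only: sum.swap[of _ "F ` {..<n}"])
    also have "0 \<le> \<dots>"
    proof (rule sum_nonneg)
      fix f
      show "0 \<le> (\<Sum>k<n. \<Sum>l<n. if cp_form f then f (I k) (I l)
          (st (if F k = f then g m k else 0) * (if F l = f then g m l else 0)) else 0)"
        using cp_form_pos[of f I "\<lambda>k. if F k = f then g m k else 0" n] by (cases "cp_form f") simp_all
    qed
    finally show "0 \<le> (\<Sum>k<n. \<Sum>l<n. T k l (st (g m k) * g m l))" .
  qed
  also have "(\<Sum>k<n. \<Sum>l<n. T k l (\<Sum>a<N. \<Sum>b<N. sc (cnj (C a k) * C b l) (st (D k) * x a b * D l))) =
      (\<Sum>a<N. \<Sum>b<N. ker_form n s (C a) (C b) (rep (x a b)))"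
  proof -
    have "(\<Sum>a<N. \<Sum>b<N. ker_form n s (C a) (C b) (rep (x a b))) =
      (\<Sum>a<N. \<Sum>b<N. \<Sum>k<n. \<Sum>l<n. T k l (sc (cnj (C a k) * C b l) (st (D k) * x a b * D l)))"
      by (simp add: ker_form_def rep_T T_sc)
    also have "\<dots> = (\<Sum>k<n. \<Sum>a<N. \<Sum>b<N. \<Sum>l<n. T k l (sc (cnj (C a k) * C b l) (st (D k) * x a b * D l)))"
      by (simp only: sum.swap[of _ "{..<n}" "{..<N}"])
    also have "\<dots> = (\<Sum>k<n. \<Sum>l<n. \<Sum>a<N. \<Sum>b<N. T k l (sc (cnj (C a k) * C b l) (st (D k) * x a b * D l)))"
      by (simp only: sum.swap[of _ "{..<n}" "{..<N}"])
    finally show ?thesis by (simp add: T_sum)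
  qed
  finally show "0 \<le> (\<Sum>a<N. \<Sum>b<N. ker_form n s (C a) (C b) (rep (x a b)))" .
qed

lemma pos_def_rep_square: "pos_def (rep (st a * a))"
proof -
  have "sum_squares 1 (\<lambda>i j. st a * a)" by (rule sum_squaresI[where M = 1 and y = "\<lambda>m i. a"]) simp
  then show ?thesis using rep_pos block_pos_one by blast
qed

lemma pos_def_unit: "pos_def unit_ker"
  using pos_def_rep_square[of 1] by (simp add: st_one)

text \<open>The square of the triangular matrix with rows \<open>(1, a)\<close> and
  \<open>(0, s)\<close>, where s completes \<open>st a * a\<close> to r. This one block matrix
  yields both the adjoint and the norm bound of \<open>rep a\<close>.\<close>

lemma block_pos_rep_two:
  assumes "(norm a)\<^sup>2 < r"
  shows "block_pos 2 (block2 unit_ker (rep a) (rep (st a)) (ker_scale (of_real r) unit_ker))"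
proof -
  obtain s where s: "st s = s" "s * s = r *\<^sub>R 1 - st a * a" using ex_sqrt_diff[OF assms] .
  have "sum_squares 2 (block2 1 a (st a) (r *\<^sub>R 1))"
    by (rule sum_squaresI[where M = 2 and y = "block2 1 a 0 s"])
      (auto simp: block2_def numeral_2_eq_2 st_zero st_one s)
  from rep_pos[OF this] show ?thesis unfolding block2_map by (simp add: rep_scaleR)
qed

lemma rep_adj: "ker_adj (rep a) = rep (st a)"
  using block_pos_adj[OF block_pos_rep_two[of a "(norm a)\<^sup>2 + 1"], of 0 1]
  by (simp add: block2_def)

lemma rep_ball:
  assumes "norm a < 1" shows "rep a \<in> ker_ball unit_ker 1"
proof -
  have "(norm a)\<^sup>2 < 1" using assms by (simp add: power_less_one_iff)
  from block_pos_two_bound[OF block_pos_rep_two[OF this]] show ?thesis by (simp add: ker_ball_def)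
qed

lemma rep_bdd: "rep a \<in> ker_bdd unit_ker"
proof -
  define r where "r = inverse (norm a + 1)"
  have r: "r > 0" by (simp add: r_def add_nonneg_pos)
  have "norm a + 1 > 0" by (simp add: add_nonneg_pos)
  then have "norm (r *\<^sub>R a) < 1" by (simp add: r_def divide_less_eq flip: divide_inverse_commute)
  then have "rep (r *\<^sub>R a) \<in> ker_bdd unit_ker" by (intro ker_bddI[of 1] rep_ball) auto
  then have "ker_scale (of_real (inverse r)) (rep (r *\<^sub>R a)) \<in> ker_bdd unit_ker"
    by (rule ker_bdd_scale)
  then show ?thesis using r unfolding rep_scaleR[symmetric] by simp
qed

end

section \<open>Operator systems inside a C*-algebra\<close>

locale embedded_system =
  fixes sm :: "complex \<Rightarrow> 'v::ab_group_add \<Rightarrow> 'v" and sv :: "'v \<Rightarrow> 'v"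
    and C :: "nat \<Rightarrow> (nat \<Rightarrow> nat \<Rightarrow> 'v) set" and e :: 'v
    and sc :: "complex \<Rightarrow> 'a::{real_normed_algebra_1,banach} \<Rightarrow> 'a" and st :: "'a \<Rightarrow> 'a"
    and \<iota> :: "'v \<Rightarrow> 'a"
  assumes opsys: "operator_system sm sv C e" and alg: "cstar_alg sc st"
    and ucoe: "ucoe sm C e sc st \<iota>"
begin

sublocale cstar sc st
  by unfold_locales (rule alg)

lemma sm_one: "sm 1 v = v" and sm_sm: "sm a (sm b v) = sm (a * b) v"
  and sm_add_left: "sm (a + b) v = sm a v + sm b v" and sm_add: "sm a (v + w) = sm a v + sm a w"
  and sv_sv: "sv (sv v) = v" and sv_add: "sv (v + w) = sv v + sv w"
  and sv_sm: "sv (sm a v) = sm (cnj a) (sv v)"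
  using opsys unfolding operator_system_def by simp_all

sublocale sm: vector_space sm
  by unfold_locales (simp_all add: sm_one sm_sm sm_add_left sm_add)

lemma C_Mat: "x \<in> C n \<Longrightarrow> x \<in> Mat n" and C_herm: "x \<in> C n \<Longrightarrow> mstar sv n x = x"
proof -
  have "\<forall>n. C n \<subseteq> Mat n \<and> (\<forall>x\<in>C n. mstar sv n x = x)"
    using opsys unfolding operator_system_def by (elim conjE)
  then show "x \<in> C n \<Longrightarrow> x \<in> Mat n" "x \<in> C n \<Longrightarrow> mstar sv n x = x" by auto
qed

lemma C_add: "x \<in> C n \<Longrightarrow> y \<in> C n \<Longrightarrow> x + y \<in> C n"
proof -
  have "\<forall>n x y. x \<in> C n \<longrightarrow> y \<in> C n \<longrightarrow> x + y \<in> C n"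
    using opsys unfolding operator_system_def by (elim conjE)
  then show "x \<in> C n \<Longrightarrow> y \<in> C n \<Longrightarrow> x + y \<in> C n" by simp
qed

lemma C_congr: "x \<in> C n \<Longrightarrow> congr sm n m \<alpha> x \<in> C m"
proof -
  have "\<forall>n m \<alpha> x. x \<in> C n \<longrightarrow> congr sm n m \<alpha> x \<in> C m"
    using opsys unfolding operator_system_def by (elim conjE)
  then show "x \<in> C n \<Longrightarrow> congr sm n m \<alpha> x \<in> C m" by simp
qed

lemma C_proper: "C n \<inter> uminus ` C n = {0}"
proof -
  have "\<forall>n. C n \<inter> uminus ` C n = {0}"
    using opsys unfolding operator_system_def by (elim conjE)
  then show ?thesis by simp
qed

lemma C_order_unit: "x \<in> Mat n \<Longrightarrow> mstar sv n x = x \<Longrightarrow>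
    \<exists>r>0. msc sm (of_real r) (dunit n e) + x \<in> C n"
proof -
  have "\<forall>n x. x \<in> Mat n \<and> mstar sv n x = x \<longrightarrow>
      (\<exists>r>0. msc sm (of_real r) (dunit n e) + x \<in> C n)"
    using opsys unfolding operator_system_def by (elim conjE)
  then show "x \<in> Mat n \<Longrightarrow> mstar sv n x = x \<Longrightarrow>
    \<exists>r>0. msc sm (of_real r) (dunit n e) + x \<in> C n"
    by blast
qed

lemma C_archimedean: "x \<in> Mat n \<Longrightarrow> mstar sv n x = x \<Longrightarrow>
    (\<And>\<epsilon>. \<epsilon> > 0 \<Longrightarrow> msc sm (of_real \<epsilon>) (dunit n e) + x \<in> C n) \<Longrightarrow> x \<in> C n"
proof -
  have "\<forall>n x. x \<in> Mat n \<and> mstar sv n x = x \<and>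
      (\<forall>\<epsilon>>0. msc sm (of_real \<epsilon>) (dunit n e) + x \<in> C n) \<longrightarrow> x \<in> C n"
    using opsys unfolding operator_system_def by (elim conjE)
  then show "x \<in> Mat n \<Longrightarrow> mstar sv n x = x \<Longrightarrow>
    (\<And>\<epsilon>. \<epsilon> > 0 \<Longrightarrow> msc sm (of_real \<epsilon>) (dunit n e) + x \<in> C n) \<Longrightarrow> x \<in> C n"
    by blast
qed

lemma \<iota>_add: "\<iota> (v + w) = \<iota> v + \<iota> w" and \<iota>_sm: "\<iota> (sm c v) = sc c (\<iota> v)"
  and \<iota>_e: "\<iota> e = 1"
  using ucoe unfolding ucoe_def by simp_all

lemma C_iff_mpos: "x \<in> Mat n \<Longrightarrow> x \<in> C n \<longleftrightarrow> mpos st n (\<lambda>i j. \<iota> (x i j))"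
proof -
  have "\<forall>n x. x \<in> Mat n \<longrightarrow> (x \<in> C n \<longleftrightarrow> mpos st n (\<lambda>i j. \<iota> (x i j)))"
    using ucoe unfolding ucoe_def by (elim conjE)
  then show "x \<in> Mat n \<Longrightarrow> x \<in> C n \<longleftrightarrow> mpos st n (\<lambda>i j. \<iota> (x i j))" by simp
qed

lemma \<iota>_zero: "\<iota> 0 = 0"
  using \<iota>_sm[of 0 0] by simp

lemma \<iota>_neg: "\<iota> (- v) = - \<iota> v"
  using \<iota>_sm[of "-1" v] by simp

lemma \<iota>_diff: "\<iota> (v - w) = \<iota> v - \<iota> w"
  using \<iota>_add[of v "- w"] by (simp add: \<iota>_neg)

text \<open>Self-adjointness is read off from positivity: for hermitian v some
  \<open>r e + v\<close> is positive, so its image is \<open>st y * y\<close>. The general case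
  follows by decomposing v into hermitian parts.\<close>

lemma \<iota>_st: "\<iota> (sv v) = st (\<iota> v)"
proof -
  have herm: "st (\<iota> v) = \<iota> v" if "sv v = v" for v
  proof -
    have "dunit 1 v \<in> Mat 1" "mstar sv 1 (dunit 1 v) = dunit 1 v"
      using that by (auto simp: Mat_def dunit_def mstar_def fun_eq_iff)
    then obtain r where "msc sm (of_real r) (dunit 1 e) + dunit 1 v \<in> C 1"
      using C_order_unit by blast
    then have "mpos st 1 (\<lambda>i j. \<iota> ((msc sm (of_real r) (dunit 1 e) + dunit 1 v) i j))"
      using C_iff_mpos C_Mat by blast
    then obtain y where "\<iota> (sm (of_real r) e + v) = st y * y"
      by (auto simp: mpos_def msc_def dunit_def)
    then have "r *\<^sub>R 1 + \<iota> v = st y * y" by (simp add: \<iota>_add \<iota>_sm \<iota>_e sc_of_real)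
    then have "\<iota> v = st y * y - r *\<^sub>R 1" by (simp add: algebra_simps)
    then show ?thesis by (simp add: st_mult st_st st_diff st_scaleR st_one)
  qed
  define a where "a = v + sv v"
  define b where "b = sm \<i> (v - sv v)"
  have sv_neg: "sv (- w) = - sv w" for w using sv_sm[of "-1" w] by simp
  have ab: "sv a = a" "sv b = b"
    using sv_add[of v "- sv v"] by (simp_all add: a_def b_def sv_add sv_sv sv_sm add.commute sv_neg
        flip: sm.scale_minus_right)
  have v: "v = sm (1/2) a - sm (\<i>/2) b"
  proof -
    have "sm (1/2) a - sm (\<i>/2) b = sm (1/2) (v + sv v) + sm (1/2) (v - sv v)"
      by (simp add: a_def b_def)
    also have "\<dots> = sm (1/2) (v + v)" by (simp add: sm.scale_right_diff_distrib sm_add)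
    also have "\<dots> = v" by (simp add: sm_add flip: sm_add_left)
    finally show ?thesis by simp
  qed
  have "sv v = sm (1/2) a + sm (\<i>/2) b"
    using sv_add[of "sm (1/2) a" "- sm (\<i>/2) b"] by (subst v) (simp add: sv_neg sv_sm ab)
  then have "\<iota> (sv v) = sc (1/2) (\<iota> a) + sc (\<i>/2) (\<iota> b)" by (simp add: \<iota>_add \<iota>_sm)
  moreover have "st (\<iota> v) = sc (1/2) (\<iota> a) + sc (\<i>/2) (\<iota> b)"
    by (subst v) (simp add: \<iota>_diff \<iota>_sm st_diff st_sc herm ab)
  ultimately show ?thesis by simp
qed

text \<open>\<open>mpos\<close> ties the number of rows to the matrix size. Padding x with zeros to
  size \<open>max n M\<close> leaves room for all M rows; a congruence by a truncated identity cuts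
  the result back to size n.\<close>

lemma C_of_sum_squares:
  assumes x: "x \<in> Mat n" and pos: "sum_squares n (\<lambda>i j. \<iota> (x i j))"
  shows "x \<in> C n"
proof -
  obtain M y where y: "\<And>i j. i < n \<Longrightarrow> j < n \<Longrightarrow> \<iota> (x i j) = (\<Sum>m<M::nat. st (y m i) * y m j)"
    using pos unfolding sum_squares_def by metis
  define N where "N = max n M"
  define y' where "y' = (\<lambda>m i. if m < M \<and> i < n then y m i else 0)"
  have x0: "x i j = 0" if "\<not> (i < n \<and> j < n)" for i j using x that by (auto simp: Mat_def)
  have "x \<in> Mat N"
    unfolding Mat_def N_def by (intro CollectI allI impI x0) auto
  moreover have "mpos st N (\<lambda>i j. \<iota> (x i j))"
    unfolding mpos_def
  proof (intro exI[of _ y'] allI impI)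
    fix i j
    show "\<iota> (x i j) = (\<Sum>k<N. st (y' k i) * y' k j)"
    proof (cases "i < n \<and> j < n")
      case True
      have "(\<Sum>k<N. st (y' k i) * y' k j) = (\<Sum>k<M. st (y' k i) * y' k j)"
        by (rule sum.mono_neutral_right) (auto simp: N_def y'_def)
      then show ?thesis using True y by (simp add: y'_def)
    next
      case False
      then show ?thesis by (auto simp: x0 \<iota>_zero y'_def st_zero intro!: sum.neutral[symmetric])
    qed
  qed
  ultimately have "x \<in> C N" using C_iff_mpos by blast
  then have "congr sm N n (\<lambda>k i. if k = i then 1 else 0) x \<in> C n" by (rule C_congr)
  moreover have "congr sm N n (\<lambda>k i. if k = i then 1 else 0) x = x"
  proof (intro ext)
    fix i j
    show "congr sm N n (\<lambda>k i. if k = i then 1 else 0) x i j = x i j"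
    proof (cases "i < n \<and> j < n")
      case True
      have "(\<Sum>k<N. \<Sum>l<N. sm (cnj (if k = i then 1 else 0) * (if l = j then 1 else 0)) (x k l)) =
          (\<Sum>k<N. \<Sum>l<N. if k = i \<and> l = j then x k l else 0)"
        by (intro sum.cong refl) auto
      also have "\<dots> = x i j" by (rule sum_two_deltas) (use True in \<open>auto simp: N_def\<close>)
      finally show ?thesis using True by (simp add: congr_def)
    next
      case False
      then show ?thesis by (auto simp: congr_def x0)
    qed
  qed
  ultimately show ?thesis by simp
qed

lemma sum_squares_of_C: "x \<in> C n \<Longrightarrow> sum_squares n (\<lambda>i j. \<iota> (x i j))"
  using C_iff_mpos[of x n] C_Mat[of x n] mpos_sum_squares by blast

lemma C_msc:
  assumes x: "x \<in> C n" and t: "t \<ge> 0" shows "msc sm (of_real t) x \<in> C n"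
proof (rule C_of_sum_squares)
  show "msc sm (of_real t) x \<in> Mat n" using C_Mat[OF x] by (auto simp: Mat_def msc_def)
  show "sum_squares n (\<lambda>i j. \<iota> (msc sm (of_real t) x i j))"
    using sum_squares_scale[OF sum_squares_of_C[OF x] t] by (simp add: msc_def \<iota>_sm sc_of_real)
qed

end

section \<open>Separating matrices from the sums of squares\<close>

context cstar
begin

text \<open>\<open>mstar st n\<close> truncates to size n and is an involution on
  \<open>Mat n\<close> only, which is why the laws of \<open>star_space\<close> are relative to a
  subspace.\<close>

lemma star_space_Mat: "star_space (msc sc) (mstar st n) (Mat n)"
proof -
  interpret m: vector_space "msc sc :: complex \<Rightarrow> (nat \<Rightarrow> nat \<Rightarrow> 'a) \<Rightarrow> _"
    by unfold_locales (auto simp: msc_def fun_eq_iff sc_add sc_add_left sc_sc sc.scale_one)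
  show ?thesis
  proof unfold_locales
    show "m.subspace (Mat n)"
      by (auto simp: m.subspace_def Mat_def msc_def)
  qed (auto simp: Mat_def mstar_def msc_def fun_eq_iff st_add st_sc st_st)
qed

text \<open>Hahn--Banach separation of X from the sums of squares, where the gap \<delta> replaces
  closedness of their cone. A positive functional F on matrices corresponds to a completely positive
  matrix of functionals: its (i, j) entry is F on the matrices supported at (i, j).\<close>

lemma separating_cp_form:
  assumes X: "X \<in> Mat n" "mstar st n X = X" and \<delta>: "\<delta> > 0"
    and sep: "\<not> sum_squares n (msc sc (of_real \<delta>) (dunit n 1) + X)"
  obtains f where "cp_form f" "\<not> 0 \<le> (\<Sum>i<n. \<Sum>j<n. f i j (X i j))"
proof -
  interpret star_space "msc sc" "mstar st n" "Mat n" by (rule star_space_Mat)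
  define One where "One = (dunit n 1 :: nat \<Rightarrow> nat \<Rightarrow> 'a)"
  have One: "One \<in> Mat n" "mstar st n One = One"
    by (auto simp: One_def Mat_def dunit_def mstar_def fun_eq_iff st_one st_zero)
  define P where "P = {a \<in> Mat n. mstar st n a = a \<and> sum_squares n a}"
  define R where "R = (\<lambda>t. msc sc (of_real t) :: (nat \<Rightarrow> nat \<Rightarrow> 'a) \<Rightarrow> _)"
  \<comment> \<open>These bounds force \<open>F One = 1\<close> and
    \<open>Re (F X) \<le> - \<delta>\<close>.\<close>
  define G where "G = {(R t One + R l X, t - \<delta> * l) | t l. l \<ge> 0}"
  have R_ss: "sum_squares n (R t a)" if "sum_squares n a" "t \<ge> 0" for t a
    using sum_squares_scale[OF that] by (simp add: R_def msc_def sc_of_real)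
  have add_ss: "sum_squares n (a + b)" if "sum_squares n a" "sum_squares n b" for a b
    using sum_squares_add[OF that] by (simp add: plus_fun_def)
  have One_ss: "sum_squares n One"
  proof (rule sum_squaresI[where M = n and y = "\<lambda>m i. if m = i then 1 else 0"])
    fix i j assume ij: "i < n" "j < n"
    have "(\<Sum>m<n. st (if m = i then 1 else 0) * (if m = j then 1 else 0)) =
        (\<Sum>m<n. if m = i then (if i = j then 1 else 0) else 0)"
      by (intro sum.cong refl) (auto simp: st_one st_zero)
    then show "One i j = (\<Sum>m<n. st (if m = i then 1 else 0) * (if m = j then 1 else 0))"
      using ij by (simp add: One_def dunit_def)
  qed
  have Rsum: "R s a + R t a = R (s + t) a" for s t a
    by (simp add: R_def scale_left_distrib)
  have RR: "R s (R t a) = R (s * t) a" for s t a by (simp add: R_def)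
  have Radd: "R s (a + b) = R s a + R s b" for s a b by (simp add: R_def scale_right_distrib)
  have R1: "R 1 a = a" for a by (simp add: R_def)
  have R0: "R 0 a = 0" for a by (simp add: R_def)
  have sep': "\<not> sum_squares n (R \<delta> One + X)" using sep unfolding R_def One_def .
  have not: "\<not> sum_squares n (R t One + X)" if "t \<le> \<delta>" for t
  proof
    assume "sum_squares n (R t One + X)"
    moreover have "sum_squares n (R (\<delta> - t) One)" using R_ss[OF One_ss] that by simp
    ultimately have "sum_squares n ((R t One + X) + R (\<delta> - t) One)" using add_ss by blast
    also have "(R t One + X) + R (\<delta> - t) One = (R t One + R (\<delta> - t) One) + X" by (simp only: add_ac)
    also have "\<dots> = R \<delta> One + X" unfolding Rsum by simp
    finally show False by (rule notE[OF sep'])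
  qed
  have major: "\<exists>r. R r One - a \<in> P" if a: "a \<in> Mat n" "mstar st n a = a" for a
  proof -
    have herm: "st (a j i) = a i j" if "i < n" "j < n" for i j
      using fun_cong[OF fun_cong[OF a(2), of i], of j] that by (simp add: mstar_def)
    obtain r where r: "sum_squares n (\<lambda>i j. (if i = j then r *\<^sub>R 1 else 0) - a i j)"
      using sum_squares_order_unit[of n a, OF herm] by blast
    have "sum_squares n (R r One - a)"
      using r by (rule sum_squares_cong) (auto simp: R_def One_def msc_def dunit_def sc_of_real)
    moreover have "R r One - a \<in> Mat n" using One a E_diff E_scale by (simp add: R_def)
    moreover have "mstar st n (R r One - a) = R r One - a"
      using star_add[of "R r One" "- a"] star_scale[of a "-1"] One a E_neg[OF a(1)]
      by (simp add: R_def E_scale star_scale)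
    ultimately show ?thesis by (auto simp: P_def)
  qed
  have G_iff: "(w, r) \<in> G \<longleftrightarrow> (\<exists>t l. w = R t One + R l X \<and> r = t - \<delta> * l \<and> l \<ge> 0)" for w r
    unfolding G_def by blast
  have G_pos: "r \<ge> 0" if wr: "(w, r) \<in> G" and wP: "w \<in> P" for w r
  proof (rule ccontr)
    assume "\<not> r \<ge> 0"
    obtain t l where w: "w = R t One + R l X" "r = t - \<delta> * l" "l \<ge> 0"
      using wr unfolding G_iff by blast
    have wss: "sum_squares n w" using wP by (simp add: P_def)
    show False
    proof (cases "l = 0")
      case False
      then have l: "l > 0" using w by simp
      have tl: "t / l \<le> \<delta>" using \<open>\<not> r \<ge> 0\<close> w l by (simp add: field_simps)
      have "sum_squares n (R (1 / l) w)" using R_ss[OF wss] l by simp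
      also have "R (1 / l) w = R (t / l) One + X"
        using l by (simp add: w Radd RR R1)
      finally show False by (rule notE[OF not[OF tl]])
    next
      case True
      \<comment> \<open>A negative multiple of the unit would be a sum of squares; adding k times it
        to \<open>R r' One + X\<close>, with \<open>k * t = - \<bar>r'\<bar>\<close>, lowers the
        coefficient of \<open>One\<close> below \<delta>.\<close>
      then have t: "t < 0" using \<open>\<not> r \<ge> 0\<close> w by simp
      obtain r' where "R r' One - (- X) \<in> P"
        using major[of "- X"] X E_neg star_scale[of X "-1"] by auto
      then have r': "sum_squares n (R r' One + X)" by (simp add: P_def)
      define k where "k = \<bar>r'\<bar> / (- t)"
      have kt: "k * t + r' \<le> \<delta>" using t \<delta> by (simp add: k_def)
      have "k \<ge> 0" unfolding k_def by (rule divide_nonneg_pos) (use t in auto)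
      then have "sum_squares n (R k w)" using R_ss[OF wss] by blast
      then have "sum_squares n (R k w + (R r' One + X))" using r' add_ss by blast
      also have "R k w + (R r' One + X) = (R (k * t) One + R r' One) + X"
        by (simp add: w True R0 RR add.assoc)
      also have "\<dots> = R (k * t + r') One + X" unfolding Rsum ..
      finally show False by (rule notE[OF not[OF kt]])
    qed
  qed
  have "\<exists>F. (\<forall>x\<in>Mat n. \<forall>y\<in>Mat n. F (x + y) = F x + F y) \<and>
    (\<forall>c. \<forall>x\<in>Mat n. F (msc sc c x) = c * F x) \<and> (\<forall>x\<in>Mat n. F (mstar st n x) = cnj (F x)) \<and>
    (\<forall>x\<in>P. 0 \<le> F x) \<and> (\<forall>w r. (w, r) \<in> G \<longrightarrow> Re (F w) \<le> r)"
  proof (rule positive_functional[of P G])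
    show "P \<subseteq> Mat n" "\<And>x. x \<in> P \<Longrightarrow> mstar st n x = x" by (auto simp: P_def)
    show "x + y \<in> P" if "x \<in> P" "y \<in> P" for x y
      using that E_add star_add add_ss by (auto simp: P_def)
    show "msc sc (of_real t) x \<in> P" if "x \<in> P" "t > 0" for x t
      using that E_scale star_scale R_ss[of x t] by (auto simp: P_def R_def)
    show "0 \<in> P"
    proof -
      have "mstar st n 0 = 0" using star_scale[OF E_zero, of 0] by simp
      moreover have "sum_squares n 0" using R_ss[OF One_ss, of 0] unfolding R0 by simp
      ultimately show ?thesis using E_zero by (simp only: P_def mem_Collect_eq)
    qed
    show "w \<in> Mat n \<and> mstar st n w = w" if wr: "(w, r) \<in> G" for w r
    proof -
      obtain t l where "w = R t One + R l X" using wr unfolding G_iff by blast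
      then show ?thesis using X One by (simp add: R_def E_add E_scale star_add star_scale)
    qed
    show "(w + w', r + r') \<in> G" if wr: "(w, r) \<in> G" "(w', r') \<in> G" for w r w' r'
    proof -
      obtain t l t' l' where *: "w = R t One + R l X" "r = t - \<delta> * l" "l \<ge> 0"
        "w' = R t' One + R l' X" "r' = t' - \<delta> * l'" "l' \<ge> 0"
        using wr unfolding G_iff by blast
      have "w + w' = (R t One + R t' One) + (R l X + R l' X)" unfolding * by (simp only: add_ac)
      then have "w + w' = R (t + t') One + R (l + l') X" unfolding Rsum .
      moreover have "r + r' = (t + t') - \<delta> * (l + l')" using * by (simp add: algebra_simps)
      ultimately show ?thesis using * unfolding G_iff by (intro exI[of _ "t + t'"] exI[of _ "l + l'"]) simp
    qed
    show "(msc sc (of_real u) w, u * r) \<in> G" if wr: "(w, r) \<in> G" and u: "u > 0" for w r u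
    proof -
      obtain t l where *: "w = R t One + R l X" "r = t - \<delta> * l" "l \<ge> 0"
        using wr unfolding G_iff by blast
      have "R u w = R (u * t) One + R (u * l) X" by (simp add: * Radd RR)
      moreover have "u * r = u * t - \<delta> * (u * l)" unfolding *(2) by (simp add: algebra_simps)
      ultimately show ?thesis using * u unfolding G_iff
        by (intro exI[of _ "u * t"] exI[of _ "u * l"]) (simp add: R_def)
    qed
    show "\<exists>w r. (w, r) \<in> G \<and> w - x \<in> P" if x: "x \<in> Mat n" "mstar st n x = x" for x
    proof -
      obtain r where "R r One - x \<in> P" using major[OF x] by blast
      moreover have "(R r One, r) \<in> G" unfolding G_iff by (rule exI[of _ r], rule exI[of _ 0]) (simp add: R0)
      ultimately show ?thesis by blast
    qed
    show "r \<ge> 0" if "(w, r) \<in> G" "w \<in> P" for w r using G_pos that .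
  qed
  then obtain F where F': "\<forall>x\<in>Mat n. \<forall>y\<in>Mat n. F (x + y) = F x + F y"
    "\<forall>c. \<forall>x\<in>Mat n. F (msc sc c x) = c * F x" "\<forall>x\<in>P. 0 \<le> F x"
    "\<forall>w r. (w, r) \<in> G \<longrightarrow> Re (F w) \<le> r" by (elim exE conjE)
  have F: "\<And>x y. x \<in> Mat n \<Longrightarrow> y \<in> Mat n \<Longrightarrow> F (x + y) = F x + F y"
    "\<And>c x. x \<in> Mat n \<Longrightarrow> F (msc sc c x) = c * F x" "\<And>x. x \<in> P \<Longrightarrow> 0 \<le> F x"
    "\<And>w r. (w, r) \<in> G \<Longrightarrow> Re (F w) \<le> r"
    using F' by simp_all
  have "(X, - \<delta>) \<in> G" unfolding G_iff by (rule exI[of _ 0], rule exI[of _ 1]) (simp add: R0 R1)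
  then have FX: "Re (F X) < 0" using F(4)[of X "- \<delta>"] \<delta> by simp
  define E where "E = (\<lambda>i j a k l. if k = i \<and> l = j \<and> i < n \<and> j < n then a else (0 :: 'a))"
  have E: "E i j a \<in> Mat n" for i j a by (auto simp: E_def Mat_def)
  define f where "f = (\<lambda>i j a. F (E i j a))"
  have F0: "F 0 = 0" using F(2)[OF E_zero, of 0] by simp
  have F_sum: "F (sum g A) = (\<Sum>a\<in>A. F (g a)) \<and> sum g A \<in> Mat n"
    if "finite A" "\<And>a. g a \<in> Mat n" for g :: "nat \<Rightarrow> nat \<Rightarrow> nat \<Rightarrow> 'a" and A
    using that(1)
  proof (induction A rule: finite_induct)
    case empty then show ?case using F0 E_zero by (simp only: sum.empty)
  next
    case (insert a A)
    then show ?case using F(1)[of "g a" "sum g A"] that(2)[of a] E_add[of "g a" "sum g A"]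
      unfolding sum.insert[OF insert.hyps(1,2)] by metis
  qed
  have "cp_form f"
    unfolding cp_form_def
  proof (intro conjI allI)
    fix i j a b
    have "E i j (a + b) = E i j a + E i j b" by (auto simp: E_def fun_eq_iff)
    then show "f i j (a + b) = f i j a + f i j b" using F(1) E by (simp add: f_def)
  next
    fix i j c a
    have "E i j (sc c a) = msc sc c (E i j a)" by (auto simp: E_def msc_def fun_eq_iff)
    then show "f i j (sc c a) = c * f i j a" using F(2) E by (simp add: f_def)
  next
    fix N :: nat and i and y :: "nat \<Rightarrow> 'a"
    define Z where "Z = (\<Sum>k<N. \<Sum>l<N. E (i k) (i l) (st (y k) * y l))"
    have inner: "F (\<Sum>l<N. E (i k) (i l) (st (y k) * y l)) = (\<Sum>l<N. f (i k) (i l) (st (y k) * y l))"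
      "(\<Sum>l<N. E (i k) (i l) (st (y k) * y l)) \<in> Mat n" for k
      using F_sum[of "{..<N}" "\<lambda>l. E (i k) (i l) (st (y k) * y l)"] E by (auto simp: f_def)
    have FZ: "F Z = (\<Sum>k<N. \<Sum>l<N. f (i k) (i l) (st (y k) * y l))" and Z: "Z \<in> Mat n"
      using F_sum[of "{..<N}" "\<lambda>k. \<Sum>l<N. E (i k) (i l) (st (y k) * y l)"] inner
      by (auto simp: Z_def)
    \<comment> \<open>Entries of y with the same row index add up, so Z is the square of a single
      row.\<close>
    define g where "g = (\<lambda>k'. \<Sum>k<N. if i k = k' then y k else 0)"
    have Zg: "Z k' l' = st (g k') * g l'" if "k' < n" "l' < n" for k' l'
    proof -
      have "st (g k') * g l' = (\<Sum>k<N. \<Sum>l<N. st (if i k = k' then y k else 0) * (if i l = l' then y l else 0))"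
        by (simp add: g_def st_sum sum_product)
      also have "\<dots> = Z k' l'" unfolding Z_def sum_fun_apply2
        using that by (intro sum.cong refl) (auto simp: E_def st_zero)
      finally show ?thesis by simp
    qed
    have "sum_squares n Z"
      by (rule sum_squaresI[where M = 1 and y = "\<lambda>m. g"]) (simp add: Zg)
    moreover have "mstar st n Z = Z"
      using Z by (auto simp: mstar_def fun_eq_iff Mat_def Zg st_mult st_st)
    ultimately have "Z \<in> P" using Z by (simp add: P_def)
    then show "0 \<le> (\<Sum>k<N. \<Sum>l<N. f (i k) (i l) (st (y k) * y l))" using F(3) FZ by metis
  qed
  moreover have "\<not> 0 \<le> (\<Sum>i<n. \<Sum>j<n. f i j (X i j))"
  proof -
    have inner: "F (\<Sum>j<n. E i j (X i j)) = (\<Sum>j<n. f i j (X i j))" "(\<Sum>j<n. E i j (X i j)) \<in> Mat n" for i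
      using F_sum[of "{..<n}" "\<lambda>j. E i j (X i j)"] E by (auto simp: f_def)
    have "F (\<Sum>i<n. \<Sum>j<n. E i j (X i j)) = (\<Sum>i<n. \<Sum>j<n. f i j (X i j))"
      using F_sum[of "{..<n}" "\<lambda>i. \<Sum>j<n. E i j (X i j)"] inner by auto
    moreover have "(\<Sum>i<n. \<Sum>j<n. E i j (X i j)) = X"
    proof (intro ext)
      fix k l
      show "(\<Sum>i<n. \<Sum>j<n. E i j (X i j)) k l = X k l"
      proof (cases "k < n \<and> l < n")
        case True
        have "(\<Sum>i<n. \<Sum>j<n. E i j (X i j)) k l = (\<Sum>i<n. \<Sum>j<n. if i = k \<and> j = l then X i j else 0)"
          unfolding sum_fun_apply2 by (intro sum.cong refl) (auto simp: E_def)
        then show ?thesis using True by (simp add: sum_two_deltas)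
      next
        case False
        then have "X k l = 0" using X by (auto simp: Mat_def)
        moreover have "(\<Sum>i<n. \<Sum>j<n. E i j (X i j)) k l = 0"
          unfolding sum_fun_apply2 using False by (intro sum.neutral ballI) (auto simp: E_def)
        ultimately show ?thesis by simp
      qed
    qed
    ultimately show ?thesis using FX by (auto simp: less_eq_complex_def)
  qed
  ultimately show ?thesis using that by blast
qed

end

section \<open>Positivity recovered from the kernel representation\<close>

context embedded_system
begin

text \<open>If x were not in the cone, the Archimedean axiom would leave a gap \<delta>, hence a
  separating \<open>cp_form\<close> f. As every such f supplies points of \<open>rep\<close>, its
  cyclic vectors \<open>(f, k, 1)\<close> then violate block positivity.\<close>

lemma C_of_rep:
  assumes x: "x \<in> Mat n" "mstar sv n x = x" and pos: "block_pos n (\<lambda>i j. rep (\<iota> (x i j)))"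
  shows "x \<in> C n"
proof (rule ccontr)
  assume "x \<notin> C n"
  then obtain \<delta> where \<delta>: "\<delta> > 0" "msc sm (of_real \<delta>) (dunit n e) + x \<notin> C n"
    using C_archimedean[OF x] by blast
  define X where "X = (\<lambda>i j. \<iota> (x i j))"
  have x0: "x i j = 0" if "\<not> (i < n \<and> j < n)" for i j using x(1) that by (auto simp: Mat_def)
  have "sv (x j i) = x i j" if "i < n" "j < n" for i j
    using fun_cong[OF fun_cong[OF x(2), of i], of j] that by (simp add: mstar_def)
  then have X: "X \<in> Mat n" "mstar st n X = X"
    by (auto simp: X_def Mat_def x0 \<iota>_zero mstar_def fun_eq_iff \<iota>_st[symmetric])
  have "msc sm (of_real \<delta>) (dunit n e) + x \<in> Mat n"
    using x by (auto simp: Mat_def msc_def dunit_def)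
  then have "\<not> sum_squares n (\<lambda>i j. \<iota> ((msc sm (of_real \<delta>) (dunit n e) + x) i j))"
    using C_of_sum_squares \<delta>(2) by blast
  moreover have "(\<lambda>i j. \<iota> ((msc sm (of_real \<delta>) (dunit n e) + x) i j)) =
      msc sc (of_real \<delta>) (dunit n 1) + X"
    by (auto simp: fun_eq_iff msc_def dunit_def X_def \<iota>_add \<iota>_sm \<iota>_e \<iota>_zero)
  ultimately have "\<not> sum_squares n (msc sc (of_real \<delta>) (dunit n 1) + X)" by metis
  then obtain f where f: "cp_form f" "\<not> 0 \<le> (\<Sum>i<n. \<Sum>j<n. f i j (X i j))"
    by (rule separating_cp_form[OF X \<delta>(1)])
  have "0 \<le> (\<Sum>a<n. \<Sum>b<n. ker_form n (\<lambda>k. (f, k, 1)) (\<lambda>k. if k = a then 1 else 0)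
      (\<lambda>k. if k = b then 1 else 0) (rep (X a b)))"
    using block_posD[OF pos, of n "\<lambda>k. (f, k, 1)" "\<lambda>a k. if k = a then 1 else 0"] by (simp add: X_def)
  also have "\<dots> = (\<Sum>a<n. \<Sum>b<n. f a b (X a b))"
  proof (intro sum.cong refl)
    fix a b assume ab: "a \<in> {..<n}" "b \<in> {..<n}"
    have "ker_form n (\<lambda>k. (f, k, 1)) (\<lambda>k. if k = a then 1 else 0) (\<lambda>k. if k = b then 1 else 0) (rep (X a b)) =
        (\<Sum>k<n. \<Sum>l<n. if k = a \<and> l = b then f k l (X a b) else 0)"
      unfolding ker_form_def using f(1) by (intro sum.cong refl) (auto simp: rep_def st_one)
    then show "ker_form n (\<lambda>k. (f, k, 1)) (\<lambda>k. if k = a then 1 else 0) (\<lambda>k. if k = b then 1 else 0)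
        (rep (X a b)) = f a b (X a b)"
      using ab by (simp add: sum_two_deltas)
  qed
  finally show False using f(2) by blast
qed

end

section \<open>Finitely supported matrices of bounded kernels\<close>

text \<open>A matrix of kernels with rows and columns indexed by the points themselves is stored as a
  single kernel on pairs.\<close>

definition ker_block :: "('c \<times> 'd) kernel \<Rightarrow> 'c \<Rightarrow> 'c \<Rightarrow> 'd kernel" where
  "ker_block z s t = (\<lambda>x y. z (s, x) (t, y))"

definition ker_unit_block :: "'c \<Rightarrow> 'c \<Rightarrow> 'd kernel \<Rightarrow> ('c \<times> 'd) kernel" where
  "ker_unit_block s t K = (\<lambda>x y. if fst x = s \<and> fst y = t then K (snd x) (snd y) else 0)"

text \<open>The identity tensored with K. It may have infinite support, so it enters through its
  form and not as an element of \<open>fin_ker\<close>.\<close>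

definition ker_const_diag :: "'d kernel \<Rightarrow> ('c \<times> 'd) kernel" where
  "ker_const_diag K = ker_diag fst (\<lambda>x y. K (snd x) (snd y))"

definition fin_ker :: "'d kernel \<Rightarrow> ('c \<times> 'd) kernel set" where
  "fin_ker U = {z. \<exists>S. finite S \<and> (\<forall>s t. s \<notin> S \<or> t \<notin> S \<longrightarrow> ker_block z s t = 0) \<and>
     (\<forall>s t. ker_block z s t \<in> ker_bdd U)}"

lemma ker_block_simps:
  "ker_block (z + w) s t = ker_block z s t + ker_block w s t"
  "ker_block (ker_scale k z) s t = ker_scale k (ker_block z s t)"
  "ker_block 0 s t = 0" "ker_block (ker_adj z) s t = ker_adj (ker_block z t s)"
  "ker_block (ker_unit_block s' t' K) s t = (if s = s' \<and> t = t' then K else 0)"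
  by (auto simp: ker_block_def ker_scale_def ker_adj_def ker_unit_block_def fun_eq_iff)

lemma fin_kerI:
  "finite S \<Longrightarrow> (\<And>s t. s \<notin> S \<or> t \<notin> S \<Longrightarrow> ker_block z s t = 0) \<Longrightarrow>
    (\<And>s t. ker_block z s t \<in> ker_bdd U) \<Longrightarrow> z \<in> fin_ker U"
  unfolding fin_ker_def by (intro CollectI exI[of _ S] conjI allI impI)

lemma fin_kerD:
  "z \<in> fin_ker U \<Longrightarrow> \<exists>S. finite S \<and> (\<forall>s t. s \<notin> S \<or> t \<notin> S \<longrightarrow> ker_block z s t = 0) \<and>
     (\<forall>s t. ker_block z s t \<in> ker_bdd U)"
  by (simp only: fin_ker_def mem_Collect_eq)

lemma star_space_fin_ker:
  fixes U :: "'a kernel"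
  shows "star_space ker_scale ker_adj (fin_ker U :: ('b \<times> 'a) kernel set)"
proof unfold_locales
  show "ker.subspace (fin_ker U :: ('b \<times> 'a) kernel set)"
    unfolding ker.subspace_def
  proof (intro conjI ballI allI)
    show "0 \<in> fin_ker U" by (rule fin_kerI[of "{}"]) (simp_all add: ker_block_simps ker_bdd_zero)
  next
    fix z w :: "('b \<times> 'a) kernel"
    assume z: "z \<in> fin_ker U" and w: "w \<in> fin_ker U"
    obtain S where S': "finite S" "\<forall>s t. s \<notin> S \<or> t \<notin> S \<longrightarrow> ker_block z s t = 0"
      "\<forall>s t. ker_block z s t \<in> ker_bdd U" using fin_kerD[OF z] by (elim exE conjE)
    note S = S'(1) S'(2)[rule_format] S'(3)[rule_format]
    obtain T where T': "finite T" "\<forall>s t. s \<notin> T \<or> t \<notin> T \<longrightarrow> ker_block w s t = 0"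
      "\<forall>s t. ker_block w s t \<in> ker_bdd U" using fin_kerD[OF w] by (elim exE conjE)
    note T = T'(1) T'(2)[rule_format] T'(3)[rule_format]
    show "z + w \<in> fin_ker U"
    proof (rule fin_kerI[of "S \<union> T"])
      show "ker_block (z + w) s t \<in> ker_bdd U" for s t
        unfolding ker_block_simps using S(3) T(3) by (rule ker_bdd_add)
      show "ker_block (z + w) s t = 0" if "s \<notin> S \<union> T \<or> t \<notin> S \<union> T" for s t
      proof -
        have "s \<notin> S \<or> t \<notin> S" "s \<notin> T \<or> t \<notin> T" using that by auto
        then show ?thesis unfolding ker_block_simps by (simp only: S(2) T(2) add_0)
      qed
    qed (use S T in simp)
  next
    fix k and z :: "('b \<times> 'a) kernel"
    assume z: "z \<in> fin_ker U"
    obtain S where S': "finite S" "\<forall>s t. s \<notin> S \<or> t \<notin> S \<longrightarrow> ker_block z s t = 0"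
      "\<forall>s t. ker_block z s t \<in> ker_bdd U" using fin_kerD[OF z] by (elim exE conjE)
    note S = S'(1) S'(2)[rule_format] S'(3)[rule_format]
    show "ker_scale k z \<in> fin_ker U"
    proof (rule fin_kerI[of S])
      show "ker_block (ker_scale k z) s t \<in> ker_bdd U" for s t
        unfolding ker_block_simps using S(3) by (rule ker_bdd_scale)
      show "ker_block (ker_scale k z) s t = 0" if "s \<notin> S \<or> t \<notin> S" for s t
        unfolding ker_block_simps S(2)[OF that] by simp
    qed (rule S(1))
  qed
  show "ker_adj z \<in> fin_ker U" if z: "z \<in> fin_ker U"
    for z :: "('b \<times> 'a) kernel"
  proof -
    obtain S where S': "finite S" "\<forall>s t. s \<notin> S \<or> t \<notin> S \<longrightarrow> ker_block z s t = 0"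
      "\<forall>s t. ker_block z s t \<in> ker_bdd U" using fin_kerD[OF z] by (elim exE conjE)
    note S = S'(1) S'(2)[rule_format] S'(3)[rule_format]
    show ?thesis
    proof (rule fin_kerI[of S])
      show "ker_block (ker_adj z) s t \<in> ker_bdd U" for s t
        unfolding ker_block_simps using S(3) by (rule ker_bdd_adj)
      show "ker_block (ker_adj z) s t = 0" if "s \<notin> S \<or> t \<notin> S" for s t
      proof -
        have "t \<notin> S \<or> s \<notin> S" using that by auto
        then show ?thesis unfolding ker_block_simps by (simp only: S(2) ker_adj_simps)
      qed
    qed (rule S(1))
  qed
qed simp_all

definition row_coeff :: "(nat \<Rightarrow> 'c \<times> 'd) \<Rightarrow> 'c \<Rightarrow> (nat \<Rightarrow> complex) \<Rightarrow> nat \<Rightarrow> complex" where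
  "row_coeff \<sigma> s c = (\<lambda>k. if fst (\<sigma> k) = s then c k else 0)"

lemma row_coeff_add: "row_coeff \<sigma> s (\<lambda>k. c k + d k) = (\<lambda>k. row_coeff \<sigma> s c k + row_coeff \<sigma> s d k)"
  by (auto simp: row_coeff_def)

lemma ker_form_unit_block:
  "ker_form n \<sigma> c d (ker_unit_block s t K) =
    ker_form n (snd \<circ> \<sigma>) (row_coeff \<sigma> s c) (row_coeff \<sigma> t d) K"
  unfolding ker_form_def by (intro sum.cong refl) (simp add: ker_unit_block_def row_coeff_def)

lemma ker_eq_sum_blocks:
  assumes S: "finite S" "\<And>s t. s \<notin> S \<or> t \<notin> S \<Longrightarrow> ker_block z s t = 0"
  shows "z = (\<Sum>s\<in>S. \<Sum>t\<in>S. ker_unit_block s t (ker_block z s t))"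
proof (intro ext)
  fix x y
  have "(\<Sum>s\<in>S. \<Sum>t\<in>S. ker_unit_block s t (ker_block z s t)) x y =
      (\<Sum>s\<in>S. \<Sum>t\<in>S. if s = fst x then if t = fst y then z x y else 0 else 0)"
    unfolding sum_fun_apply2 by (intro sum.cong refl) (auto simp: ker_unit_block_def ker_block_def)
  also have "\<dots> = (\<Sum>s\<in>S. if s = fst x then (if fst y \<in> S then z x y else 0) else 0)"
    using S(1) by (intro sum.cong refl) simp
  also have "\<dots> = (if fst x \<in> S \<and> fst y \<in> S then z x y else 0)"
    using S(1) by simp
  also have "\<dots> = z x y"
  proof (cases "fst x \<in> S \<and> fst y \<in> S")
    case False
    then have "ker_block z (fst x) (fst y) (snd x) (snd y) = 0" using S(2) by simp
    then show ?thesis by (simp add: ker_block_def)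
  qed simp
  finally show "z x y = (\<Sum>s\<in>S. \<Sum>t\<in>S. ker_unit_block s t (ker_block z s t)) x y" by simp
qed

lemma ker_form_blocks:
  assumes "finite S" "\<And>s t. s \<notin> S \<or> t \<notin> S \<Longrightarrow> ker_block z s t = 0"
  shows "ker_form n \<sigma> c d z = (\<Sum>s\<in>S. \<Sum>t\<in>S.
    ker_form n (snd \<circ> \<sigma>) (row_coeff \<sigma> s c) (row_coeff \<sigma> t d) (ker_block z s t))"
  by (subst ker_eq_sum_blocks[OF assms]) (simp_all only: ker_form_sum ker_form_unit_block)

lemma pos_def_snd: "pos_def K \<Longrightarrow> pos_def (\<lambda>x y. K (snd x) (snd y))"
proof -
  assume K: "pos_def K"
  show ?thesis
    unfolding pos_def_def
  proof (intro allI)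
    fix n and s :: "nat \<Rightarrow> 'b \<times> 'a" and c
    show "0 \<le> ker_form n s c c (\<lambda>x y. K (snd x) (snd y))"
      using pos_defD[OF K, of n "snd \<circ> s" c] by (simp add: ker_form_def)
  qed
qed

lemma pos_def_const_diag: "pos_def K \<Longrightarrow> pos_def (ker_const_diag K)"
  unfolding ker_const_diag_def by (intro pos_def_diag pos_def_snd)

lemma ker_form_const_diag:
  "ker_form n \<sigma> c d (ker_const_diag K) = (\<Sum>s\<in>fst ` \<sigma> ` {..<n}.
    ker_form n (snd \<circ> \<sigma>) (row_coeff \<sigma> s c) (row_coeff \<sigma> s d) K)"
  unfolding ker_const_diag_def ker_form_diag row_coeff_def by (simp add: ker_form_def)

lemma ker_form_const_diag_ge:
  assumes K: "pos_def K"
  shows "ker_form n (snd \<circ> \<sigma>) (row_coeff \<sigma> s c) (row_coeff \<sigma> s c) K \<le> ker_form n \<sigma> c c (ker_const_diag K)"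
proof (cases "s \<in> fst ` \<sigma> ` {..<n}")
  case True
  then show ?thesis unfolding ker_form_const_diag
    by (intro member_le_sum) (auto intro: pos_defD[OF K])
next
  case False
  then have "ker_form n (snd \<circ> \<sigma>) (row_coeff \<sigma> s c) (row_coeff \<sigma> s c) K = 0"
    unfolding ker_form_def by (intro sum.neutral ballI) (auto simp: row_coeff_def)
  then show ?thesis using pos_defD[OF pos_def_const_diag[OF K]] by simp
qed

lemma ker_unit_block_fin_ker: "K \<in> ker_bdd U \<Longrightarrow> ker_unit_block s t K \<in> fin_ker U"
  by (rule fin_kerI[of "{s, t}"]) (auto simp: ker_block_simps ker_bdd_zero)

text \<open>The identity has infinite support in general; instead each z has its own majorant, a
  multiple of the identity on its support. The sum of the norm bounds of all blocks suffices as the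
  factor, because the squared length of each component is at most the total
  \<open>T\<close>.\<close>

lemma fin_ker_order_unit:
  fixes U :: "'a kernel" and z :: "('b \<times> 'a) kernel"
  assumes U: "pos_def U" and z: "z \<in> fin_ker U" "ker_adj z = z"
  obtains S r where "finite S"
    "pos_def ((\<Sum>s\<in>S. ker_scale (of_real r) (ker_unit_block s s U)) - z)"
proof -
  obtain S where S': "finite S" "\<forall>s t. s \<notin> S \<or> t \<notin> S \<longrightarrow> ker_block z s t = 0"
      "\<forall>s t. ker_block z s t \<in> ker_bdd U" using fin_kerD[OF z(1)] by (elim exE conjE)
    note S = S'(1) S'(2)[rule_format] S'(3)[rule_format]
  have "\<exists>r. r \<ge> 0 \<and> ker_block z s t \<in> ker_ball U r" for s t
    using S(3)[of s t] unfolding ker_bdd_def by blast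
  then obtain r where r: "\<And>s t. r s t \<ge> 0" "\<And>s t. ker_block z s t \<in> ker_ball U (r s t)"
    by metis
  define R where "R = (\<Sum>s\<in>S. \<Sum>t\<in>S. r s t)"
  have "pos_def ((\<Sum>s\<in>S. ker_scale (of_real R) (ker_unit_block s s U)) - z)"
    unfolding pos_def_def
  proof (intro allI)
    fix n and \<sigma> :: "nat \<Rightarrow> 'b \<times> 'a" and c :: "nat \<Rightarrow> complex"
    define u where "u = (\<lambda>s. Re (ker_form n (snd \<circ> \<sigma>) (row_coeff \<sigma> s c) (row_coeff \<sigma> s c) U))"
    have u: "u s \<ge> 0" for s unfolding u_def by (rule pos_def_Re[OF U])
    have uI: "ker_form n (snd \<circ> \<sigma>) (row_coeff \<sigma> s c) (row_coeff \<sigma> s c) U = of_real (u s)" for s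
      using pos_def_Im[OF U] by (simp add: u_def complex_eq_iff)
    define T where "T = (\<Sum>s\<in>S. u s)"
    have uT: "u s \<le> T" if "s \<in> S" for s
      unfolding T_def using that S(1) u by (intro member_le_sum) auto
    have "cmod (ker_form n \<sigma> c c z) \<le> (\<Sum>s\<in>S. \<Sum>t\<in>S.
        cmod (ker_form n (snd \<circ> \<sigma>) (row_coeff \<sigma> s c) (row_coeff \<sigma> t c) (ker_block z s t)))"
    proof -
      have "ker_form n \<sigma> c c z = (\<Sum>s\<in>S. \<Sum>t\<in>S.
          ker_form n (snd \<circ> \<sigma>) (row_coeff \<sigma> s c) (row_coeff \<sigma> t c) (ker_block z s t))"
        using S(1,2) by (rule ker_form_blocks)
      then show ?thesis by (simp only:) (rule order.trans[OF norm_sum sum_mono[OF norm_sum]])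
    qed
    also have "\<dots> \<le> (\<Sum>s\<in>S. \<Sum>t\<in>S. r s t * T)"
    proof (intro sum_mono)
      fix s t assume st: "s \<in> S" "t \<in> S"
      have "2 * cmod (ker_form n (snd \<circ> \<sigma>) (row_coeff \<sigma> s c) (row_coeff \<sigma> t c) (ker_block z s t)) \<le>
          r s t * (u s + u t)"
        using ker_ballD[OF r(2)] by (simp add: u_def)
      also have "\<dots> \<le> r s t * (T + T)"
        using uT st r(1) by (intro mult_left_mono add_mono) auto
      finally show "cmod (ker_form n (snd \<circ> \<sigma>) (row_coeff \<sigma> s c) (row_coeff \<sigma> t c) (ker_block z s t)) \<le>
          r s t * T" by simp
    qed
    also have "\<dots> = R * T" by (simp add: R_def sum_distrib_right)
    finally have le: "cmod (ker_form n \<sigma> c c z) \<le> R * T" .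
    have "cnj (ker_form n \<sigma> c c z) = ker_form n \<sigma> c c z"
      using ker_form_adj[of n \<sigma> c c z] unfolding z(2) by simp
    then have "Im (ker_form n \<sigma> c c z) = 0" by (simp add: complex_eq_iff)
    moreover have "Re (ker_form n \<sigma> c c z) \<le> R * T"
      using le complex_Re_le_cmod[of "ker_form n \<sigma> c c z"] by linarith
    moreover have "ker_form n \<sigma> c c (\<Sum>s\<in>S. ker_scale (of_real R) (ker_unit_block s s U)) =
        of_real (R * T)"
      by (simp add: ker_form_sum ker_form_unit_block uI T_def sum_distrib_left)
    ultimately show "0 \<le> ker_form n \<sigma> c c
        ((\<Sum>s\<in>S. ker_scale (of_real R) (ker_unit_block s s U)) - z)"
      by (simp add: less_eq_complex_def)
  qed
  then show ?thesis using that S(1) by blast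
qed

lemma sum_div_mod:
  fixes N n :: nat and F :: "nat \<Rightarrow> nat \<Rightarrow> 'b::comm_monoid_add"
  shows "(\<Sum>m<N * n. F (m div n) (m mod n)) = (\<Sum>i<N. \<Sum>k<n. F i k)"
proof (induction N)
  case (Suc N)
  have "(\<Sum>m<Suc N * n. F (m div n) (m mod n)) = (\<Sum>m<N * n + n. F (m div n) (m mod n))"
    by (simp add: add.commute)
  also have "\<dots> = (\<Sum>m<N * n. F (m div n) (m mod n)) + (\<Sum>k<n. F N k)"
    unfolding sum_lessThan_plus by (intro arg_cong2[where f = "(+)"] sum.cong refl) simp
  finally show ?case using Suc by simp
qed simp

text \<open>The index m enumerates the pairs \<open>(m div n, m mod n)\<close>, so a form of a
  kernel on pairs of points turns into a form of a block matrix.\<close>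

lemma ker_form_grid:
  "ker_form (N * n) (\<lambda>m. (g (m div n), \<delta> (m mod n))) (\<lambda>m. c (m div n) (m mod n))
     (\<lambda>m. d (m div n) (m mod n)) z =
   (\<Sum>i<N. \<Sum>j<N. ker_form n \<delta> (c i) (d j) (ker_block z (g i) (g j)))"
proof -
  have "ker_form (N * n) (\<lambda>m. (g (m div n), \<delta> (m mod n))) (\<lambda>m. c (m div n) (m mod n))
     (\<lambda>m. d (m div n) (m mod n)) z =
     (\<Sum>i<N. \<Sum>k<n. \<Sum>j<N. \<Sum>l<n. cnj (c i k) * d j l * z (g i, \<delta> k) (g j, \<delta> l))"
    unfolding ker_form_def
    using sum_div_mod[of "\<lambda>i k. \<Sum>m'<N * n. cnj (c i k) * d (m' div n) (m' mod n) *
        z (g i, \<delta> k) (g (m' div n), \<delta> (m' mod n))" n N]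
      sum_div_mod[of "\<lambda>j l. cnj (c _ _) * d j l * z (g _, \<delta> _) (g j, \<delta> l)" n N]
    by simp
  also have "\<dots> = (\<Sum>i<N. \<Sum>j<N. \<Sum>k<n. \<Sum>l<n. cnj (c i k) * d j l * z (g i, \<delta> k) (g j, \<delta> l))"
    by (simp only: sum.swap[of _ "{..<n}" "{..<N}"])
  finally show ?thesis by (simp add: ker_form_def ker_block_def)
qed

section \<open>The compression associated with an abstract projection\<close>

lemma sum_even_odd:
  fixes G :: "nat \<Rightarrow> 'b::comm_monoid_add"
  shows "(\<Sum>a<2 * N. G a) = (\<Sum>i<N. G (2 * i) + G (2 * i + 1))"
  by (induction N) (simp_all add: add.assoc)

lemma ker_form_delta:
  assumes "a < n" "b < n"
  shows "ker_form n s (\<lambda>k. if k = a then 1 else 0) (\<lambda>k. if k = b then 1 else 0) K = K (s a) (s b)"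
proof -
  have "ker_form n s (\<lambda>k. if k = a then 1 else 0) (\<lambda>k. if k = b then 1 else 0) K =
      (\<Sum>k<n. \<Sum>l<n. if k = a \<and> l = b then K (s k) (s l) else 0)"
    unfolding ker_form_def by (intro sum.cong refl) auto
  then show ?thesis using assms by (simp add: sum_two_deltas)
qed

lemma ker_block_const_diag: "ker_block (ker_const_diag K) s t = (if s = t then K else 0)"
  by (auto simp: ker_block_def ker_const_diag_def ker_diag_def fun_eq_iff)

text \<open>The vector functional at the sum of all \<delta>_s \<otimes> \<delta>_s: it adds the (s,
  t) entries of the blocks (s, t). On matrices over the system it is the functional that corresponds
  to the identity map.\<close>

definition diag_sum :: "'d set \<Rightarrow> ('d \<times> 'd) kernel \<Rightarrow> complex" where
  "diag_sum S w = (\<Sum>s\<in>S. \<Sum>t\<in>S. w (s, s) (t, t))"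

lemma diag_sum_add: "diag_sum S (w + w') = diag_sum S w + diag_sum S w'"
  by (simp add: diag_sum_def sum.distrib)

lemma diag_sum_scale: "diag_sum S (ker_scale k w) = k * diag_sum S w"
  by (simp add: diag_sum_def ker_scale_def sum_distrib_left)

lemma diag_sum_adj: "diag_sum S (ker_adj w) = cnj (diag_sum S w)"
  unfolding diag_sum_def ker_adj_def by (subst sum.swap) simp

lemma diag_sum_unit_block:
  assumes "finite S" "s \<in> S" "t \<in> S"
  shows "diag_sum S (ker_unit_block s t K) = K s t"
proof -
  have "diag_sum S (ker_unit_block s t K) = (\<Sum>a\<in>S. \<Sum>b\<in>S. if b = t then if a = s then K s t else 0 else 0)"
    unfolding diag_sum_def by (intro sum.cong refl) (simp add: ker_unit_block_def)
  also have "\<dots> = (\<Sum>a\<in>S. if a = s then K s t else 0)"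
    using assms by (intro sum.cong refl) simp
  also have "\<dots> = K s t" using assms by simp
  finally show ?thesis .
qed

locale projection_system = embedded_system sm sv C e sc st \<iota>
  for sm :: "complex \<Rightarrow> 'v::ab_group_add \<Rightarrow> 'v" and sv C e
    and sc :: "complex \<Rightarrow> 'a::{real_normed_algebra_1,banach} \<Rightarrow> 'a" and st \<iota> +
  fixes p :: 'v
  assumes abs_proj: "abstract_projection sm sv C e p"
begin

lemma p_pos: "dunit 1 p \<in> C 1" and q_pos: "dunit 1 (e - p) \<in> C 1"
  using abs_proj unfolding abstract_projection_def by simp_all

lemma pimat_iff: "x \<in> Mat n \<Longrightarrow> x \<in> C n \<longleftrightarrow>
    (\<exists>y. blocks_in n (Jpq sm sv C e p) y \<and> pimat n x + y \<in> C (2 * n))"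
proof -
  have "\<forall>n x. x \<in> Mat n \<longrightarrow> (x \<in> C n \<longleftrightarrow>
      (\<exists>y. blocks_in n (Jpq sm sv C e p) y \<and> pimat n x + y \<in> C (2 * n)))"
    using abs_proj unfolding abstract_projection_def by (elim conjE)
  then show "x \<in> Mat n \<Longrightarrow> ?thesis" by simp
qed

lemma ex_square: "dunit 1 a \<in> C 1 \<Longrightarrow> \<exists>y. \<iota> a = st y * y"
  using C_iff_mpos[of "dunit 1 a" 1] C_Mat[of "dunit 1 a" 1] by (auto simp: mpos_def dunit_def)

lemma pos_def_rep: "dunit 1 a \<in> C 1 \<Longrightarrow> pos_def (rep (\<iota> a))"
  using ex_square[of a] pos_def_rep_square by force

lemma sv_pos: "dunit 1 a \<in> C 1 \<Longrightarrow> sv a = a"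
  using fun_cong[OF fun_cong[OF C_herm[of "dunit 1 a" 1], of 0], of 0]
  by (simp add: mstar_def dunit_def)

lemma dpq_pos:
  assumes "dunit 1 a \<in> C 1" "dunit 1 b \<in> C 1" shows "dpq n a b \<in> C (2 * n)"
proof (rule C_of_sum_squares)
  obtain y z where yz: "\<iota> a = st y * y" "\<iota> b = st z * z" using assms ex_square by metis
  show "dpq n a b \<in> Mat (2 * n)" by (auto simp: Mat_def dpq_def)
  show "sum_squares (2 * n) (\<lambda>i j. \<iota> (dpq n a b i j))"
  proof (rule sum_squaresI[where M = "2 * n" and y = "\<lambda>m i. if m = i then if even i then y else z else 0"])
    fix i j assume ij: "i < 2 * n" "j < 2 * n"
    have "(\<Sum>m<2 * n. st (if m = i then if even i then y else z else 0) *
        (if m = j then if even j then y else z else 0)) =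
        (\<Sum>m<2 * n. if m = i then if i = j then if even i then st y * y else st z * z else 0 else 0)"
      by (intro sum.cong refl) (auto simp: st_zero)
    then show "\<iota> (dpq n a b i j) = (\<Sum>m<2 * n. st (if m = i then if even i then y else z else 0) *
        (if m = j then if even j then y else z else 0))"
      using ij by (simp add: dpq_def yz \<iota>_zero)
  qed
qed

text \<open>In \<open>Cpq\<close> the choice t = 1 serves both signs: it doubles or cancels
  \<open>q \<oplus> p\<close>, and \<open>\<epsilon> (p \<oplus> q)\<close> is positive. Hence
  \<open>q \<oplus> p\<close> lies in J.\<close>

lemma Cpq_qp: "dpq 1 (e - p) p \<in> Cpq sm sv C e p 1" "- dpq 1 (e - p) p \<in> Cpq sm sv C e p 1"
proof -
  have pq: "dpq 1 p (e - p) \<in> C (2 * 1)" and qp: "dpq 1 (e - p) p \<in> C (2 * 1)"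
    using dpq_pos p_pos q_pos by blast+
  have M: "dpq 1 (e - p) p \<in> Mat (2 * 1)" "- dpq 1 (e - p) p \<in> Mat (2 * 1)"
    using C_Mat[OF qp] by (auto simp: Mat_def)
  have H: "mstar sv (2 * 1) (dpq 1 (e - p) p) = dpq 1 (e - p) p" using C_herm[OF qp] .
  have H': "mstar sv (2 * 1) (- dpq 1 (e - p) p) = - dpq 1 (e - p) p"
  proof -
    have "sv (- w) = - sv w" for w using sv_sm[of "-1" w] by simp
    then have "mstar sv (2 * 1) (- dpq 1 (e - p) p) = - mstar sv (2 * 1) (dpq 1 (e - p) p)"
      by (auto simp: mstar_def fun_eq_iff)
    then show ?thesis unfolding H .
  qed
  have 1: "msc sm (of_real 1) x = x" for x by (simp add: msc_def sm_one)
  have "dpq 1 (e - p) p + msc sm (of_real \<epsilon>) (dpq 1 p (e - p)) +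
      msc sm (of_real 1) (dpq 1 (e - p) p) \<in> C (2 * 1)" if "\<epsilon> > 0" for \<epsilon>
    unfolding 1 using C_add C_msc pq qp that by (simp only: less_imp_le)
  then show "dpq 1 (e - p) p \<in> Cpq sm sv C e p 1"
    unfolding Cpq_def using M H zero_less_one by blast
  have "- dpq 1 (e - p) p + msc sm (of_real \<epsilon>) (dpq 1 p (e - p)) +
      msc sm (of_real 1) (dpq 1 (e - p) p) \<in> C (2 * 1)" if "\<epsilon> > 0" for \<epsilon>
  proof -
    have "- dpq 1 (e - p) p + msc sm (of_real \<epsilon>) (dpq 1 p (e - p)) + dpq 1 (e - p) p =
        msc sm (of_real \<epsilon>) (dpq 1 p (e - p))" by simp
    then show ?thesis unfolding 1 using C_msc[OF pq, of \<epsilon>] that by (simp only: less_imp_le)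
  qed
  then show "- dpq 1 (e - p) p \<in> Cpq sm sv C e p 1"
    unfolding Cpq_def using M H' zero_less_one by blast
qed

text \<open>Each block of the added matrix is a multiple of \<open>q \<oplus> p\<close> and so lies
  in J; the class of \<open>pimat n x\<close> is unchanged. This is how the order isomorphism
  \<open>\<pi>\<^sub>p\<close> enters.\<close>

lemma C_of_pimat:
  assumes x: "x \<in> Mat n"
    and pos: "pimat n x + msc sm c (dpq n (e - p) p) \<in> C (2 * n)"
  shows "x \<in> C n"
proof -
  have mem: "dpq 1 (e - p) p \<in> Cpq sm sv C e p 1 \<inter> uminus ` Cpq sm sv C e p 1"
    using Cpq_qp image_eqI[of "dpq 1 (e - p) p" uminus "- dpq 1 (e - p) p"] by simp
  have J: "msc sm c (dpq 1 (e - p) p) \<in> Jpq sm sv C e p" for c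
    unfolding Jpq_def cspan_def
    by (intro CollectI exI[of _ "[c]"] exI[of _ "[dpq 1 (e - p) p]"]) (use mem in simp)
  have "blocks_in n (Jpq sm sv C e p) (msc sm c (dpq n (e - p) p))"
    unfolding blocks_in_def
  proof (intro conjI allI impI)
    show "msc sm c (dpq n (e - p) p) \<in> Mat (2 * n)" by (auto simp: Mat_def msc_def dpq_def)
    fix i j assume ij: "i < n" "j < n"
    have "(\<lambda>k l. if k < 2 \<and> l < 2 then msc sm c (dpq n (e - p) p) (2 * i + k) (2 * j + l) else 0) =
        msc sm (if i = j then c else 0) (dpq 1 (e - p) p)"
    proof (intro ext)
      fix k l :: nat
      have "2 * i + k = 2 * j + l \<longleftrightarrow> i = j \<and> k = l" if "k < 2" "l < 2" using that by presburger
      then show "(if k < 2 \<and> l < 2 then msc sm c (dpq n (e - p) p) (2 * i + k) (2 * j + l) else 0) =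
          msc sm (if i = j then c else 0) (dpq 1 (e - p) p) k l"
        using ij by (auto simp: msc_def dpq_def)
    qed
    then show "(\<lambda>k l. if k < 2 \<and> l < 2 then msc sm c (dpq n (e - p) p) (2 * i + k) (2 * j + l) else 0)
        \<in> Jpq sm sv C e p" using J by (simp only:)
  qed
  then show ?thesis using pimat_iff[OF x] pos by blast
qed

text \<open>If \<open>rep (\<iota> h) = 0\<close> with h hermitian, \<open>C_of_rep\<close> puts h
  and \<open>- h\<close> into the cone, so properness gives h = 0. Then both hermitian parts of v
  are treated this way.\<close>

lemma rep_\<iota>_eq_zero:
  assumes "rep (\<iota> v) = 0" shows "v = 0"
proof -
  have herm: "h = 0" if h: "sv h = h" "rep (\<iota> h) = 0" for h
  proof -
    have mem: "dunit 1 g \<in> C 1" if g: "sv g = g" "rep (\<iota> g) = 0" for g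
    proof (rule C_of_rep)
      show "dunit 1 g \<in> Mat 1" "mstar sv 1 (dunit 1 g) = dunit 1 g"
        using g by (auto simp: Mat_def dunit_def mstar_def fun_eq_iff)
      show "block_pos 1 (\<lambda>i j. rep (\<iota> (dunit 1 g i j)))"
        unfolding block_pos_def using g by (simp add: dunit_def)
    qed
    have "sv (- h) = - h" using sv_sm[of "-1" h] h by simp
    then have "dunit 1 (- h) \<in> C 1" using mem[of "- h"] h by (simp add: \<iota>_neg rep_neg)
    moreover have "dunit 1 h = - dunit 1 (- h)" by (auto simp: dunit_def fun_eq_iff)
    ultimately have "dunit 1 h \<in> C 1 \<inter> uminus ` C 1" using mem[OF h] by blast
    then have "dunit 1 h = 0" using C_proper by blast
    then have "dunit 1 h 0 0 = 0" by simp
    then show "h = 0" by (simp add: dunit_def)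
  qed
  have r: "rep (\<iota> (sv v)) = 0" using assms rep_adj[of "\<iota> v"] by (simp add: \<iota>_st)
  have "v + sv v = 0"
    by (rule herm) (simp_all add: sv_add sv_sv add.commute \<iota>_add rep_add r assms)
  moreover have "sm \<i> (v - sv v) = 0"
  proof (rule herm)
    show "sv (sm \<i> (v - sv v)) = sm \<i> (v - sv v)"
      using sv_add[of v "sm (-1) (sv v)"] sv_sm[of "-1" "sv v"]
      by (simp add: sv_sm sv_sv flip: sm.scale_minus_right)
    show "rep (\<iota> (sm \<i> (v - sv v))) = 0"
      unfolding \<iota>_sm rep_sc \<iota>_diff rep_diff assms r by simp
  qed
  ultimately have "v + v = 0" by (simp add: eq_neg_iff_add_eq_0)
  then have "sm 2 v = 0" using sm_add_left[of 1 1 v] by (simp add: sm_one)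
  then show ?thesis by simp
qed

text \<open>Matrices over the system supported in S: the domain on which the functional
  \<open>diag_sum S\<close> is prescribed. By \<open>diag_sum_mono\<close> its value does not change
  when S grows.\<close>

definition V_fin :: "'a gns_point set \<Rightarrow>
    ('a gns_point \<times> 'a gns_point) kernel \<Rightarrow> bool" where
  "V_fin S w \<longleftrightarrow> (\<exists>x. (\<forall>s t. ker_block w s t = rep (\<iota> (x s t))) \<and>
    (\<forall>s t. s \<notin> S \<or> t \<notin> S \<longrightarrow> x s t = 0))"

lemma V_finD: "V_fin S w \<Longrightarrow> \<exists>x. (\<forall>s t. ker_block w s t = rep (\<iota> (x s t))) \<and>
    (\<forall>s t. s \<notin> S \<or> t \<notin> S \<longrightarrow> x s t = 0)"
  by (simp only: V_fin_def)

lemma V_finI: "(\<And>s t. ker_block w s t = rep (\<iota> (x s t))) \<Longrightarrow>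
    (\<And>s t. s \<notin> S \<or> t \<notin> S \<Longrightarrow> x s t = 0) \<Longrightarrow> V_fin S w"
  unfolding V_fin_def by (intro exI[of _ x] conjI allI impI)

lemma V_fin_fin_ker:
  assumes "finite S" "V_fin S w" shows "w \<in> fin_ker unit_ker"
proof -
  obtain x where x': "\<forall>s t. ker_block w s t = rep (\<iota> (x s t))" "\<forall>s t. s \<notin> S \<or> t \<notin> S \<longrightarrow> x s t = 0"
    using V_finD[OF assms(2)] by (elim exE conjE)
  note x = x'[rule_format]
  show ?thesis
    by (rule fin_kerI[OF assms(1)]) (simp_all add: x rep_bdd \<iota>_zero rep_zero)
qed

lemma V_fin_mono: "V_fin S w \<Longrightarrow> S \<subseteq> T \<Longrightarrow> V_fin T w"
proof -
  assume w: "V_fin S w" and ST: "S \<subseteq> T"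
  obtain x where x': "\<forall>s t. ker_block w s t = rep (\<iota> (x s t))" "\<forall>s t. s \<notin> S \<or> t \<notin> S \<longrightarrow> x s t = 0"
    using V_finD[OF w] by (elim exE conjE)
  note x = x'[rule_format]
  show "V_fin T w"
    by (rule V_finI[where x = x]) (use x ST in \<open>blast+\<close>)
qed

lemma V_fin_add:
  assumes "V_fin S w" "V_fin S w'" shows "V_fin S (w + w')"
proof -
  obtain x where x': "\<forall>s t. ker_block w s t = rep (\<iota> (x s t))" "\<forall>s t. s \<notin> S \<or> t \<notin> S \<longrightarrow> x s t = 0"
    using V_finD[OF assms(1)] by (elim exE conjE)
  note x = x'[rule_format]
  obtain y where y': "\<forall>s t. ker_block w' s t = rep (\<iota> (y s t))" "\<forall>s t. s \<notin> S \<or> t \<notin> S \<longrightarrow> y s t = 0"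
    using V_finD[OF assms(2)] by (elim exE conjE)
  note y = y'[rule_format]
  show ?thesis
    by (rule V_finI[where x = "\<lambda>s t. x s t + y s t"])
      (simp_all only: ker_block_simps x y rep_add \<iota>_add add_0)
qed

lemma V_fin_scale:
  assumes "V_fin S w" shows "V_fin S (ker_scale k w)"
proof -
  obtain x where x': "\<forall>s t. ker_block w s t = rep (\<iota> (x s t))" "\<forall>s t. s \<notin> S \<or> t \<notin> S \<longrightarrow> x s t = 0"
    using V_finD[OF assms(1)] by (elim exE conjE)
  note x = x'[rule_format]
  show ?thesis
    by (rule V_finI[where x = "\<lambda>s t. sm k (x s t)"])
      (simp_all only: ker_block_simps x rep_sc \<iota>_sm sm.scale_zero_right)
qed

lemma V_fin_adj:
  assumes "V_fin S w" shows "V_fin S (ker_adj w)"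
proof -
  obtain x where x': "\<forall>s t. ker_block w s t = rep (\<iota> (x s t))" "\<forall>s t. s \<notin> S \<or> t \<notin> S \<longrightarrow> x s t = 0"
    using V_finD[OF assms(1)] by (elim exE conjE)
  note x = x'[rule_format]
  show ?thesis
  proof (rule V_finI[where x = "\<lambda>s t. sv (x t s)"])
    show "ker_block (ker_adj w) s t = rep (\<iota> (sv (x t s)))" for s t
      by (simp only: ker_block_simps x rep_adj \<iota>_st)
    show "sv (x t s) = 0" if "s \<notin> S \<or> t \<notin> S" for s t
    proof -
      have "x t s = 0" by (rule x(2)) (use that in blast)
      then show ?thesis using sv_sm[of 0 0] by simp
    qed
  qed
qed

lemma diag_sum_mono:
  assumes "V_fin S w" "S \<subseteq> T" "finite T" shows "diag_sum T w = diag_sum S w"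
proof -
  obtain x where x': "\<forall>s t. ker_block w s t = rep (\<iota> (x s t))" "\<forall>s t. s \<notin> S \<or> t \<notin> S \<longrightarrow> x s t = 0"
    using V_finD[OF assms(1)] by (elim exE conjE)
  note x = x'[rule_format]
  have 0: "w (s, s) (t, t) = 0" if "s \<notin> S \<or> t \<notin> S" for s t
  proof -
    have "ker_block w s t = 0" unfolding x(1) x(2)[OF that] \<iota>_zero rep_zero ..
    then have "ker_block w s t s t = 0" by simp
    then show ?thesis by (simp add: ker_block_def)
  qed
  have "diag_sum T w = (\<Sum>s\<in>T. \<Sum>t\<in>S. w (s, s) (t, t))"
    unfolding diag_sum_def
    by (intro sum.cong refl sum.mono_neutral_right) (use assms 0 in auto)
  also have "\<dots> = diag_sum S w"
    unfolding diag_sum_def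
    by (intro sum.mono_neutral_right) (use assms 0 in \<open>auto intro: sum.neutral\<close>)
  finally show ?thesis .
qed

text \<open>The form of \<open>[[z, z], [z, z]] + r (q \<oplus> p)\<close> at the pair of vectors
  (c, d), with \<open>q \<oplus> p\<close> amplified to all rows.\<close>

definition cone_form where
  "cone_form r n \<sigma> c d z = ker_form n \<sigma> (\<lambda>k. c k + d k) (\<lambda>k. c k + d k) z + of_real r *
       (ker_form n \<sigma> c c (ker_const_diag (rep (\<iota> (e - p)))) +
        ker_form n \<sigma> d d (ker_const_diag (rep (\<iota> p))))"

text \<open>Positivity modulo multiples of \<open>q \<oplus> p\<close>: the stand-in, for matrices
  of arbitrary bounded kernels, for positivity in the quotient by J.\<close>

definition cone :: "('a gns_point \<times> 'a gns_point) kernel set" where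
  "cone = {z \<in> fin_ker unit_ker. ker_adj z = z \<and> (\<exists>r\<ge>0. \<forall>n \<sigma> c d.
     0 \<le> cone_form r n \<sigma> c d z)}"

text \<open>The consistency condition of the Hahn--Banach extension. For w over the system,
  membership in the cone says that \<open>pimat N X + r (q \<oplus> p)\<close> is positive under
  \<open>rep\<close>, hence in \<open>C (2 * N)\<close>, and X is in \<open>C N\<close>. So w is a
  positive matrix, and \<open>diag_sum S w\<close> is its form at one vector.\<close>

lemma diag_sum_nonneg:
  assumes S: "finite S" and w: "V_fin S w" "w \<in> cone"
  shows "0 \<le> diag_sum S w"
proof -
  obtain x where x': "\<forall>s t. ker_block w s t = rep (\<iota> (x s t))" "\<forall>s t. s \<notin> S \<or> t \<notin> S \<longrightarrow> x s t = 0"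
    using V_finD[OF w(1)] by (elim exE conjE)
  note x = x'[rule_format]
  have wadj: "ker_adj w = w" using w(2) by (simp only: cone_def mem_Collect_eq)
  have "\<exists>r\<ge>0. \<forall>n \<sigma> c d. 0 \<le> cone_form r n \<sigma> c d w"
    using w(2) by (simp only: cone_def mem_Collect_eq)
  then obtain r where r: "\<forall>n \<sigma> c d. 0 \<le> cone_form r n \<sigma> c d w" by (elim exE conjE)
  define N where "N = card S"
  obtain g where g: "bij_betw g {..<N} S"
    using ex_bij_betw_nat_finite[OF S] by (auto simp: N_def atLeast0LessThan)
  define X where "X = (\<lambda>i j. if i < N \<and> j < N then x (g i) (g j) else 0)"
  have X: "X \<in> Mat N" by (auto simp: X_def Mat_def)
  have sv_x: "sv (x s t) = x t s" for s t
  proof -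
    have "rep (\<iota> (x t s)) = ker_block (ker_adj w) t s" unfolding wadj x(1) ..
    also have "\<dots> = rep (\<iota> (sv (x s t)))" by (simp only: ker_block_simps x(1) rep_adj \<iota>_st)
    finally have "rep (\<iota> (x t s - sv (x s t))) = 0" by (simp add: \<iota>_diff rep_diff)
    then show ?thesis using rep_\<iota>_eq_zero by (metis eq_iff_diff_eq_0)
  qed
  define Y where "Y = pimat N X + msc sm (of_real r) (dpq N (e - p) p)"
  have Y: "Y a b = X (a div 2) (b div 2) +
      sm (of_real r) (if a = b then if even a then e - p else p else 0)"
    if "a < 2 * N" "b < 2 * N" for a b
    using that by (simp add: Y_def pimat_def msc_def dpq_def)
  have Y0: "Y a b = 0" if "\<not> (a < 2 * N \<and> b < 2 * N)" for a b
    using that by (auto simp: Y_def pimat_def msc_def dpq_def)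
  have svX: "sv (X j i) = X i j" for i j
    using sv_x sv_sm[of 0 0] by (simp add: X_def)
  have "Y \<in> C (2 * N)"
  proof (rule C_of_rep)
    show "Y \<in> Mat (2 * N)" using Y0 by (auto simp: Mat_def)
    show "mstar sv (2 * N) Y = Y"
    proof (intro ext)
      fix a b
      show "mstar sv (2 * N) Y a b = Y a b"
        using sv_sm[of 0 0]
        by (auto simp: mstar_def Y Y0 sv_add svX sv_sm sv_pos[OF p_pos] sv_pos[OF q_pos])
    qed
    show "block_pos (2 * N) (\<lambda>a b. rep (\<iota> (Y a b)))"
      unfolding block_pos_def
    proof (intro allI)
      fix n and \<delta> :: "nat \<Rightarrow> 'a gns_point"
        and A :: "nat \<Rightarrow> nat \<Rightarrow> complex"
      define F where "F = (\<lambda>a b. ker_form n \<delta> (A a) (A b))"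
      \<comment> \<open>Even rows carry the first, odd rows the second component of the doubled
        vector.\<close>
      define c where "c = (\<lambda>i. A (2 * i))"
      define d where "d = (\<lambda>i. A (2 * i + 1))"
      define \<sigma> where "\<sigma> = (\<lambda>m. (g (m div n), \<delta> (m mod n)))"
      have inj: "g i = g j \<longleftrightarrow> i = j" if "i < N" "j < N" for i j
        using bij_betw_imp_inj_on[OF g] that by (auto simp: inj_on_def)
      have diag: "(\<Sum>i<N. \<Sum>j<N. ker_form n \<delta> (f i) (f j) (ker_block (ker_const_diag K) (g i) (g j))) =
          (\<Sum>i<N. ker_form n \<delta> (f i) (f i) K)" for f K
      proof (intro sum.cong refl)
        fix i assume i: "i \<in> {..<N}"
        have "(\<Sum>j<N. ker_form n \<delta> (f i) (f j) (ker_block (ker_const_diag K) (g i) (g j))) =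
            (\<Sum>j<N. if j = i then ker_form n \<delta> (f i) (f i) K else 0)"
          using i inj by (intro sum.cong refl) (auto simp: ker_block_const_diag)
        then show "(\<Sum>j<N. ker_form n \<delta> (f i) (f j) (ker_block (ker_const_diag K) (g i) (g j))) =
            ker_form n \<delta> (f i) (f i) K" using i by simp
      qed
      have "(\<Sum>a<2 * N. \<Sum>b<2 * N. F a b (rep (\<iota> (Y a b)))) =
          (\<Sum>a<2 * N. \<Sum>b<2 * N. F a b (rep (\<iota> (X (a div 2) (b div 2)))) +
            (if b = a then of_real r * F a a (rep (\<iota> (if even a then e - p else p))) else 0))"
        by (intro sum.cong refl)
          (auto simp: Y \<iota>_add rep_add \<iota>_sm rep_sc F_def \<iota>_zero rep_zero)
      also have "\<dots> = (\<Sum>a<2 * N. \<Sum>b<2 * N. F a b (rep (\<iota> (X (a div 2) (b div 2))))) +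
          of_real r * (\<Sum>a<2 * N. F a a (rep (\<iota> (if even a then e - p else p))))"
        by (simp add: sum.distrib sum_distrib_left)
      also have "(\<Sum>a<2 * N. \<Sum>b<2 * N. F a b (rep (\<iota> (X (a div 2) (b div 2))))) =
          (\<Sum>i<N. \<Sum>j<N. ker_form n \<delta> (\<lambda>k. c i k + d i k) (\<lambda>k. c j k + d j k) (ker_block w (g i) (g j)))"
        unfolding sum_even_odd sum.distrib[symmetric]
        by (intro sum.cong refl) (simp add: F_def c_def d_def ker_form_coeff_add x X_def)
      also have "\<dots> = ker_form (N * n) \<sigma> (\<lambda>m. c (m div n) (m mod n) + d (m div n) (m mod n))
          (\<lambda>m. c (m div n) (m mod n) + d (m div n) (m mod n)) w"
        unfolding \<sigma>_def ker_form_grid[where c = "\<lambda>i k. c i k + d i k" and d = "\<lambda>i k. c i k + d i k"] ..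
      also have "(\<Sum>a<2 * N. F a a (rep (\<iota> (if even a then e - p else p)))) =
          (\<Sum>i<N. ker_form n \<delta> (c i) (c i) (rep (\<iota> (e - p)))) +
          (\<Sum>i<N. ker_form n \<delta> (d i) (d i) (rep (\<iota> p)))"
        unfolding sum_even_odd by (simp add: sum.distrib F_def c_def d_def)
      also have "(\<Sum>i<N. ker_form n \<delta> (c i) (c i) (rep (\<iota> (e - p)))) =
          ker_form (N * n) \<sigma> (\<lambda>m. c (m div n) (m mod n)) (\<lambda>m. c (m div n) (m mod n))
            (ker_const_diag (rep (\<iota> (e - p))))"
        unfolding \<sigma>_def ker_form_grid diag ..
      also have "(\<Sum>i<N. ker_form n \<delta> (d i) (d i) (rep (\<iota> p))) =
          ker_form (N * n) \<sigma> (\<lambda>m. d (m div n) (m mod n)) (\<lambda>m. d (m div n) (m mod n))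
            (ker_const_diag (rep (\<iota> p)))"
        unfolding \<sigma>_def ker_form_grid diag ..
      finally show "0 \<le> (\<Sum>a<2 * N. \<Sum>b<2 * N. ker_form n \<delta> (A a) (A b) (rep (\<iota> (Y a b))))"
        using r[rule_format, of "N * n" \<sigma> "\<lambda>m. c (m div n) (m mod n)" "\<lambda>m. d (m div n) (m mod n)"]
        unfolding F_def cone_form_def by simp
    qed
  qed
  then have "X \<in> C N" unfolding Y_def by (rule C_of_pimat[OF X])
  then have "block_pos N (\<lambda>i j. rep (\<iota> (X i j)))" by (intro rep_pos sum_squares_of_C)
  \<comment> \<open>Row a is tested with the unit vector at the point \<open>g a\<close>, which
    picks the diagonal pairs of \<open>diag_sum\<close>.\<close>
  then have "0 \<le> (\<Sum>a<N. \<Sum>b<N. ker_form N g (\<lambda>k. if k = a then 1 else 0) (\<lambda>k. if k = b then 1 else 0)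
      (rep (\<iota> (X a b))))"
    by (rule block_posD)
  also have "\<dots> = (\<Sum>a<N. \<Sum>b<N. w (g a, g a) (g b, g b))"
  proof (intro sum.cong refl)
    fix a b assume ab: "a \<in> {..<N}" "b \<in> {..<N}"
    have "rep (\<iota> (X a b)) (g a) (g b) = ker_block w (g a) (g b) (g a) (g b)"
      using ab x by (simp add: X_def)
    then show "ker_form N g (\<lambda>k. if k = a then 1 else 0) (\<lambda>k. if k = b then 1 else 0)
      (rep (\<iota> (X a b))) = w (g a, g a) (g b, g b)"
      using ab by (simp add: ker_form_delta ker_block_def)
  qed
  also have "\<dots> = diag_sum S w"
  proof -
    have inner: "(\<Sum>b<N. w (s, s) (g b, g b)) = (\<Sum>t\<in>S. w (s, s) (t, t))" for s
      by (rule sum.reindex_bij_betw[OF g])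
    show ?thesis unfolding diag_sum_def inner by (rule sum.reindex_bij_betw[OF g])
  qed
  finally show ?thesis .
qed

end

lemma pos_def_add: "pos_def K \<Longrightarrow> pos_def L \<Longrightarrow> pos_def (K + L)"
  by (simp add: pos_def_def)

lemma ker_adj_diff: "ker_adj (K - L) = ker_adj K - ker_adj L"
  by (auto simp: ker_adj_def fun_eq_iff)

lemma ker_unit_block_simps:
  "ker_unit_block s t (K + L) = ker_unit_block s t K + ker_unit_block s t L"
  "ker_unit_block s t (ker_scale k K) = ker_scale k (ker_unit_block s t K)"
  by (auto simp: ker_unit_block_def ker_scale_def fun_eq_iff)

lemma pos_def_unit_block: "pos_def K \<Longrightarrow> pos_def (ker_unit_block s s K)"
  by (simp add: pos_def_def ker_form_unit_block)

lemma pos_def_zero_diagonal: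
  assumes "pos_def K" "\<And>s. K s s = 0" shows "K = 0"
proof (intro ext)
  fix s t
  show "K s t = 0 s t"
    using ker_ball_entry[OF ker_ball_unit[OF assms(1)], of s t] assms(2) by simp
qed

section \<open>The cone and the functional that is positive on it\<close>

context projection_system
begin

lemma coneI:
  "z \<in> fin_ker unit_ker \<Longrightarrow> ker_adj z = z \<Longrightarrow> r \<ge> 0 \<Longrightarrow> (\<And>n \<sigma> c d.
     0 \<le> cone_form r n \<sigma> c d z) \<Longrightarrow> z \<in> cone"
  unfolding cone_def by (intro CollectI conjI exI[of _ r] allI)

lemma coneD:
  assumes "z \<in> cone"
  shows "z \<in> fin_ker unit_ker" "ker_adj z = z" "\<exists>r\<ge>0. \<forall>n \<sigma> c d.
     0 \<le> cone_form r n \<sigma> c d z"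
  using assms by (simp_all only: cone_def mem_Collect_eq)

lemma cone_pos_def: "z \<in> fin_ker unit_ker \<Longrightarrow> pos_def z \<Longrightarrow> z \<in> cone"
  by (rule coneI[of z 0]) (auto simp: cone_form_def intro: pos_def_adj pos_defD)

lemma cone_add:
  assumes "z \<in> cone" "w \<in> cone" shows "z + w \<in> cone"
proof -
  interpret E: star_space ker_scale ker_adj "fin_ker unit_ker" by (rule star_space_fin_ker)
  obtain r where r: "r \<ge> 0" "\<forall>n \<sigma> c d.
     0 \<le> cone_form r n \<sigma> c d z"
    using coneD(3)[OF assms(1)] by (elim exE conjE)
  obtain r' where r': "r' \<ge> 0" "\<forall>n \<sigma> c d.
     0 \<le> cone_form r' n \<sigma> c d w"
    using coneD(3)[OF assms(2)] by (elim exE conjE)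
  show ?thesis
  proof (rule coneI[of _ "r + r'"])
    show "z + w \<in> fin_ker unit_ker" using coneD(1) assms by (intro E.E_add) auto
    show "ker_adj (z + w) = z + w"
      unfolding ker_adj_simps coneD(2)[OF assms(1)] coneD(2)[OF assms(2)] ..
    show "r + r' \<ge> 0" using r r' by simp
    fix n \<sigma> c d
    show "0 \<le> cone_form (r + r') n \<sigma> c d (z + w)"
      using add_nonneg_nonneg[OF r(2)[rule_format, of n \<sigma> c d] r'(2)[rule_format, of n \<sigma> c d]]
      by (simp add: cone_form_def algebra_simps)
  qed
qed

lemma cone_scale:
  assumes "z \<in> cone" "t > 0" shows "ker_scale (of_real t) z \<in> cone"
proof -
  interpret E: star_space ker_scale ker_adj "fin_ker unit_ker" by (rule star_space_fin_ker)
  obtain r where r: "r \<ge> 0" "\<forall>n \<sigma> c d.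
     0 \<le> cone_form r n \<sigma> c d z"
    using coneD(3)[OF assms(1)] by (elim exE conjE)
  show ?thesis
  proof (rule coneI[of _ "t * r"])
    show "ker_scale (of_real t) z \<in> fin_ker unit_ker"
      using coneD(1) assms by (intro E.E_scale) auto
    show "ker_adj (ker_scale (of_real t) z) = ker_scale (of_real t) z"
      unfolding ker_adj_simps coneD(2)[OF assms(1)] by simp
    show "t * r \<ge> 0" using r assms by simp
    fix n \<sigma> c d
    have "0 \<le> complex_of_real t" using assms by (simp add: less_eq_complex_def)
    from mult_nonneg_nonneg[OF this r(2)[rule_format, of n \<sigma> c d]]
    show "0 \<le> cone_form (t * r) n \<sigma> c d (ker_scale (of_real t) z)"
      by (simp add: cone_form_def algebra_simps)
  qed
qed

lemma st_p: "st (\<iota> p) = \<iota> p" and st_q: "st (\<iota> (e - p)) = \<iota> (e - p)"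
  using \<iota>_st[of p] \<iota>_st[of "e - p"] sv_pos[OF p_pos] sv_pos[OF q_pos] by simp_all

lemma \<iota>_q: "\<iota> (e - p) = 1 - \<iota> p"
  by (simp add: \<iota>_diff \<iota>_e)

text \<open>From p + q = 1 follows \<open>p q = p q p + q p q\<close>, and both summands are squares
  by those of q and p.\<close>

lemma pq_squares:
  obtains y z where "\<iota> p * \<iota> (e - p) = st y * y + st z * z"
proof -
  obtain y z where yz: "\<iota> p = st y * y" "\<iota> (e - p) = st z * z"
    using ex_square[OF p_pos] ex_square[OF q_pos] by blast
  have "\<iota> p * \<iota> (e - p) = \<iota> p * \<iota> (e - p) * \<iota> p + \<iota> (e - p) * \<iota> p * \<iota> (e - p)"
    by (simp add: \<iota>_q algebra_simps)
  also have "\<iota> p * \<iota> (e - p) * \<iota> p = st (z * \<iota> p) * (z * \<iota> p)"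
    by (simp add: st_mult st_p yz(2) mult.assoc)
  also have "\<iota> (e - p) * \<iota> p * \<iota> (e - p) = st (y * \<iota> (e - p)) * (y * \<iota> (e - p))"
    unfolding st_mult st_q by (subst yz(1)) (simp add: mult.assoc)
  finally show ?thesis by (rule that)
qed

lemma pos_def_pq: "pos_def (rep (\<iota> p * \<iota> (e - p)))"
proof -
  obtain y z where "\<iota> p * \<iota> (e - p) = st y * y + st z * z" by (rule pq_squares)
  then show ?thesis by (simp only: rep_add pos_def_add pos_def_rep_square)
qed

text \<open>For \<open>K = p q\<close>, \<open>[[K, K], [K, K]] \<le> 2 (K \<oplus> K) \<le> 2 (q
  \<oplus> p)\<close>, because \<open>q - p q = q q\<close> and \<open>p - p q = p p\<close>; hence
  r = 2. As the block of K itself also lies in the cone, a functional positive on the cone vanishes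
  there.\<close>

lemma cone_neg_pq: "ker_scale (-1) (ker_unit_block s s (rep (\<iota> p * \<iota> (e - p)))) \<in> cone"
proof -
  interpret E: star_space ker_scale ker_adj "fin_ker unit_ker" by (rule star_space_fin_ker)
  define K where "K = rep (\<iota> p * \<iota> (e - p))"
  have K: "pos_def K" unfolding K_def by (rule pos_def_pq)
  have q: "pos_def (rep (\<iota> (e - p)) - K)"
  proof -
    have "\<iota> (e - p) - \<iota> p * \<iota> (e - p) = st (\<iota> (e - p)) * \<iota> (e - p)"
      unfolding st_q by (simp add: \<iota>_q algebra_simps)
    then show ?thesis unfolding K_def rep_diff[symmetric] using pos_def_rep_square by metis
  qed
  have p: "pos_def (rep (\<iota> p) - K)"
  proof -
    have "\<iota> p - \<iota> p * \<iota> (e - p) = st (\<iota> p) * \<iota> p"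
      unfolding st_p by (simp add: \<iota>_q algebra_simps)
    then show ?thesis unfolding K_def rep_diff[symmetric] using pos_def_rep_square by metis
  qed
  show ?thesis
    unfolding K_def[symmetric]
  proof (rule coneI[of _ 2])
    show "ker_scale (-1) (ker_unit_block s s K) \<in> fin_ker unit_ker"
      unfolding K_def by (intro E.E_scale ker_unit_block_fin_ker rep_bdd)
    show "ker_adj (ker_scale (-1) (ker_unit_block s s K)) = ker_scale (-1) (ker_unit_block s s K)"
      unfolding ker_adj_simps pos_def_adj[OF pos_def_unit_block[OF K]] by simp
    fix n and \<sigma> :: "nat \<Rightarrow> 'a gns_point \<times> 'a gns_point" and c d :: "nat \<Rightarrow> complex"
    define \<tau> where "\<tau> = snd \<circ> \<sigma>"
    define x where "x = row_coeff \<sigma> s c"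
    define y where "y = row_coeff \<sigma> s d"
    have 1: "ker_form n \<sigma> (\<lambda>k. c k + d k) (\<lambda>k. c k + d k) (ker_scale (-1) (ker_unit_block s s K)) =
        - (ker_form n \<tau> x x K + ker_form n \<tau> x y K + ker_form n \<tau> y x K + ker_form n \<tau> y y K)"
      by (simp add: ker_form_unit_block row_coeff_add ker_form_coeff_add \<tau>_def x_def y_def)
    have "0 \<le> ker_form n \<tau> (\<lambda>k. x k + - y k) (\<lambda>k. x k + - y k) K" by (rule pos_defD[OF K])
    then have 2: "0 \<le> ker_form n \<tau> x x K - ker_form n \<tau> x y K - ker_form n \<tau> y x K + ker_form n \<tau> y y K"
      unfolding ker_form_coeff_add ker_form_coeff_neg by (simp add: algebra_simps)
    have 3: "0 \<le> ker_form n \<tau> x x (rep (\<iota> (e - p))) - ker_form n \<tau> x x K"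
      using pos_defD[OF q, of n \<tau> x] unfolding ker_form_diff .
    have 4: "0 \<le> ker_form n \<tau> y y (rep (\<iota> p)) - ker_form n \<tau> y y K"
      using pos_defD[OF p, of n \<tau> y] unfolding ker_form_diff .
    have 5: "ker_form n \<tau> x x (rep (\<iota> (e - p))) \<le> ker_form n \<sigma> c c (ker_const_diag (rep (\<iota> (e - p))))"
      unfolding \<tau>_def x_def by (rule ker_form_const_diag_ge[OF pos_def_rep[OF q_pos]])
    have 6: "ker_form n \<tau> y y (rep (\<iota> p)) \<le> ker_form n \<sigma> d d (ker_const_diag (rep (\<iota> p)))"
      unfolding \<tau>_def y_def by (rule ker_form_const_diag_ge[OF pos_def_rep[OF p_pos]])
    show "0 \<le> cone_form 2 n \<sigma> c d (ker_scale (-1) (ker_unit_block s s K))"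
      unfolding cone_form_def 1 using 2 3 4 5 6 pos_defD[OF K, of n \<tau> x] pos_defD[OF K, of n \<tau> y]
      by (simp add: less_eq_complex_def)
  qed simp
qed

lemma V_fin_unit_block:
  assumes "s \<in> S" "t \<in> S" shows "V_fin S (ker_unit_block s t (rep (\<iota> v)))"
proof (rule V_finI[where x = "\<lambda>a b. if a = s \<and> b = t then v else 0"])
  show "ker_block (ker_unit_block s t (rep (\<iota> v))) a b = rep (\<iota> (if a = s \<and> b = t then v else 0))"
    for a b
    by (cases "a = s \<and> b = t") (auto simp: ker_block_simps \<iota>_zero rep_zero)
qed (use assms in auto)

lemma V_fin_unit_sum:
  "finite A \<Longrightarrow> A \<subseteq> S \<Longrightarrow> V_fin S (\<Sum>s\<in>A. ker_scale k (ker_unit_block s s unit_ker))"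
proof (induction A rule: finite_induct)
  case empty
  show ?case unfolding sum.empty
    by (rule V_finI[where x = "\<lambda>s t. 0"]) (simp_all only: ker_block_simps \<iota>_zero rep_zero)
next
  case (insert a A)
  have "V_fin S (ker_scale k (ker_unit_block a a unit_ker))"
    using V_fin_scale[OF V_fin_unit_block[of a S a e]] insert.prems by (simp add: \<iota>_e)
  then show ?case unfolding sum.insert[OF insert.hyps(1,2)]
    by (rule V_fin_add) (use insert in simp)
qed

text \<open>The compression is the Hahn--Banach extension, along \<open>x \<mapsto> pimat x\<close>, of the inverse of
  the embedding of the operator system; the cone makes it vanish on \<open>q \<oplus> p\<close> and hence on
  \<open>p q\<close>.\<close>

lemma ex_compression:
  "\<exists>\<Theta>. ucp unit_ker \<Theta> \<and> (\<forall>v. \<Theta> (rep (\<iota> v)) = rep (\<iota> v)) \<and> \<Theta> (rep (\<iota> p * \<iota> (e - p))) = 0"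
proof -
  interpret E: star_space ker_scale ker_adj "fin_ker unit_ker ::
      ('a gns_point \<times> 'a gns_point) kernel set"
    by (rule star_space_fin_ker)
  \<comment> \<open>A bound on real parts at hermitian w suffices: applied to
    \<open>w + ker_adj w\<close> and to scalar multiples of w it becomes the equality
    \<open>F w = diag_sum S w\<close>.\<close>
  define G where "G = {(w, r). \<exists>S. finite S \<and> V_fin S w \<and> ker_adj w = w \<and> r = Re (diag_sum S w)}"
  have GI: "(w, Re (diag_sum S w)) \<in> G" if "finite S" "V_fin S w" "ker_adj w = w" for S w
    unfolding G_def by (intro CollectI case_prodI exI[of _ S] conjI that refl)
  have GD: "\<exists>S. finite S \<and> V_fin S w \<and> ker_adj w = w \<and> r = Re (diag_sum S w)" if "(w, r) \<in> G" for w r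
    using that by (simp only: G_def mem_Collect_eq case_prod_conv)
  have "\<exists>F. (\<forall>x\<in>fin_ker unit_ker. \<forall>y\<in>fin_ker unit_ker. F (x + y) = F x + F y) \<and>
    (\<forall>c. \<forall>x\<in>fin_ker unit_ker. F (ker_scale c x) = c * F x) \<and>
    (\<forall>x\<in>fin_ker unit_ker. F (ker_adj x) = cnj (F x)) \<and> (\<forall>x\<in>cone. 0 \<le> F x) \<and>
    (\<forall>w r. (w, r) \<in> G \<longrightarrow> Re (F w) \<le> r)"
  proof (rule E.positive_functional[of cone G])
    show "cone \<subseteq> fin_ker unit_ker" using coneD(1) by (rule subsetI)
    show "ker_adj x = x" if "x \<in> cone" for x using coneD(2)[OF that] .
    show "x + y \<in> cone" if "x \<in> cone" "y \<in> cone" for x y using cone_add[OF that] .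
    show "ker_scale (of_real t) x \<in> cone" if "x \<in> cone" "t > 0" for x t using cone_scale[OF that] .
    show "0 \<in> cone" by (rule cone_pos_def[OF E.E_zero]) (simp add: pos_def_def)
    show "w \<in> fin_ker unit_ker \<and> ker_adj w = w" if "(w, r) \<in> G" for w r
      using GD[OF that] V_fin_fin_ker by (elim exE conjE) simp
    show "(w + w', r + r') \<in> G" if wr: "(w, r) \<in> G" "(w', r') \<in> G" for w r w' r'
    proof -
      obtain S where S: "finite S" "V_fin S w" "ker_adj w = w" "r = Re (diag_sum S w)"
        using GD[OF wr(1)] by (elim exE conjE)
      obtain T where T: "finite T" "V_fin T w'" "ker_adj w' = w'" "r' = Re (diag_sum T w')"
        using GD[OF wr(2)] by (elim exE conjE)
      have fin: "finite (S \<union> T)" using S T by simp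
      have "(w + w', Re (diag_sum (S \<union> T) (w + w'))) \<in> G"
        by (rule GI[OF fin]) (simp_all add: V_fin_add V_fin_mono[OF S(2)] V_fin_mono[OF T(2)] S(3) T(3))
      also have "Re (diag_sum (S \<union> T) (w + w')) = r + r'"
        using diag_sum_mono[OF S(2) Un_upper1 fin] diag_sum_mono[OF T(2) Un_upper2 fin] S(4) T(4)
        by (simp add: diag_sum_add)
      finally show ?thesis .
    qed
    show "(ker_scale (of_real t) w, t * r) \<in> G" if wr: "(w, r) \<in> G" and t: "t > 0" for w r t
    proof -
      obtain S where S: "finite S" "V_fin S w" "ker_adj w = w" "r = Re (diag_sum S w)"
        using GD[OF wr] by (elim exE conjE)
      have "(ker_scale (of_real t) w, Re (diag_sum S (ker_scale (of_real t) w))) \<in> G"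
        by (rule GI[OF S(1) V_fin_scale[OF S(2)]]) (simp add: S(3))
      then show ?thesis by (simp add: diag_sum_scale S(4))
    qed
    show "\<exists>w r. (w, r) \<in> G \<and> w - x \<in> cone" if x: "x \<in> fin_ker unit_ker" "ker_adj x = x" for x
    proof -
      obtain S r where S: "finite S"
        "pos_def ((\<Sum>s\<in>S. ker_scale (of_real r) (ker_unit_block s s unit_ker)) - x)"
        using fin_ker_order_unit[OF pos_def_unit x] .
      \<comment> \<open>The blocks of this majorant are multiples of the unit, so it is a matrix
        over the system and may enter \<open>G\<close>.\<close>
      define W where "W = (\<Sum>s\<in>S. ker_scale (of_real r) (ker_unit_block s s unit_ker))"
      have W: "V_fin S W" unfolding W_def by (rule V_fin_unit_sum[OF S(1) order_refl])
      have "ker_adj (W - x) = W - x" using pos_def_adj[OF S(2)] by (simp only: W_def)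
      then have "ker_adj W = W" unfolding ker_adj_diff x(2) by (simp only: diff_right_commute add_right_cancel diff_conv_add_uminus)
      then have "(W, Re (diag_sum S W)) \<in> G" by (rule GI[OF S(1) W])
      moreover have "W - x \<in> cone"
        using S(2) unfolding W_def[symmetric]
        by (rule cone_pos_def[OF E.E_diff[OF V_fin_fin_ker[OF S(1) W] x(1)]])
      ultimately show ?thesis by (intro exI conjI)
    qed
    show "r \<ge> 0" if wr: "(w, r) \<in> G" "w \<in> cone" for w r
    proof -
      obtain S where S: "finite S" "V_fin S w" "ker_adj w = w" "r = Re (diag_sum S w)"
        using GD[OF wr(1)] by (elim exE conjE)
      then show ?thesis using diag_sum_nonneg[OF S(1,2) wr(2)] by (simp add: less_eq_complex_def)
    qed
  qed
  then obtain F where F': "\<forall>x\<in>fin_ker unit_ker. \<forall>y\<in>fin_ker unit_ker. F (x + y) = F x + F y"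
    "\<forall>c. \<forall>x\<in>fin_ker unit_ker. F (ker_scale c x) = c * F x"
    "\<forall>x\<in>fin_ker unit_ker. F (ker_adj x) = cnj (F x)" "\<forall>x\<in>cone. 0 \<le> F x"
    "\<forall>w r. (w, r) \<in> G \<longrightarrow> Re (F w) \<le> r" by (elim exE conjE)
  note F_add = F'(1)[rule_format] and F_scale = F'(2)[rule_format] and F_adj = F'(3)[rule_format]
    and F_pos = F'(4)[rule_format] and F_G = F'(5)[rule_format]
  have F_le: "Re (F w) \<le> Re (diag_sum S w)" if S: "finite S" "V_fin S w" for S w
  proof -
    have w: "w \<in> fin_ker unit_ker" using V_fin_fin_ker[OF S] .
    have "(w + ker_adj w, Re (diag_sum S (w + ker_adj w))) \<in> G"
      by (rule GI[OF S(1) V_fin_add[OF S(2) V_fin_adj[OF S(2)]]]) (simp add: add.commute)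
    from F_G[OF this] show ?thesis
      by (simp add: F_add[OF w E.star_in[OF w]] F_adj[OF w] diag_sum_add diag_sum_adj)
  qed
  have F_val: "F w = diag_sum S w" if S: "finite S" "V_fin S w" for S w
  proof -
    have w: "w \<in> fin_ker unit_ker" using V_fin_fin_ker[OF S] .
    have "Re (k * F w) \<le> Re (k * diag_sum S w)" for k
      using F_le[OF S(1) V_fin_scale[OF S(2), of k]] by (simp add: F_scale[OF w] diag_sum_scale)
    from this[of 1] this[of "-1"] this[of \<i>] this[of "-\<i>"] show ?thesis by (simp add: complex_eq_iff)
  qed
  have E_sum: "sum g A \<in> fin_ker unit_ker" if "\<And>a. a \<in> A \<Longrightarrow> g a \<in> fin_ker unit_ker"
    for g :: "nat \<Rightarrow> ('a gns_point \<times> 'a gns_point) kernel" and A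
    using ker.subspace_sum[OF E.E_sub that] .
  have F_zero: "F 0 = 0" using F_scale[OF E.E_zero, of 0] by simp
  have F_sum: "F (sum g A) = (\<Sum>a\<in>A. F (g a))"
    if "finite A" "\<And>a. a \<in> A \<Longrightarrow> g a \<in> fin_ker unit_ker"
    for g :: "nat \<Rightarrow> ('a gns_point \<times> 'a gns_point) kernel" and A
    using that
  proof (induction A rule: finite_induct)
    case empty show ?case unfolding sum.empty by (rule F_zero)
  next
    case (insert a A)
    have "F (sum g (insert a A)) = F (g a) + F (sum g A)"
      unfolding sum.insert[OF insert.hyps(1,2)]
      by (rule F_add) (use insert.prems in \<open>auto intro!: E_sum\<close>)
    also have "F (sum g A) = (\<Sum>a\<in>A. F (g a))" using insert.IH insert.prems by simp
    also have "F (g a) + (\<Sum>a\<in>A. F (g a)) = (\<Sum>a\<in>insert a A. F (g a))"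
      by (rule sum.insert[OF insert.hyps(1,2), symmetric])
    finally show ?case .
  qed
  \<comment> \<open>The map whose associated functional is F. On a single block over the system F is
    \<open>diag_sum\<close>, which returns the (s, t) entry; so the system is fixed.\<close>
  define \<Theta> where "\<Theta> = (\<lambda>b. if b \<in> ker_bdd unit_ker then (\<lambda>s t. F (ker_unit_block s t b)) else 0)"
  have \<Theta>: "\<Theta> b s t = F (ker_unit_block s t b)" if "b \<in> ker_bdd unit_ker" for b s t
    using that by (simp add: \<Theta>_def)
  have fixed: "\<Theta> (rep (\<iota> v)) = rep (\<iota> v)" for v
  proof (intro ext)
    fix s t
    show "\<Theta> (rep (\<iota> v)) s t = rep (\<iota> v) s t"
      using F_val[of "{s, t}", OF _ V_fin_unit_block] diag_sum_unit_block[of "{s, t}" s t]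
      by (simp add: \<Theta> rep_bdd)
  qed
  have "ucp unit_ker \<Theta>"
    unfolding ucp_def
  proof (intro conjI ballI allI impI)
    fix K L assume KL: "K \<in> ker_bdd unit_ker" "L \<in> ker_bdd unit_ker"
    show "\<Theta> (K + L) = \<Theta> K + \<Theta> L"
      using KL by (intro ext)
        (simp add: \<Theta> ker_bdd_add ker_unit_block_simps F_add ker_unit_block_fin_ker)
  next
    fix k K assume K: "K \<in> ker_bdd unit_ker"
    have "\<Theta> (ker_scale k K) s t = ker_scale k (\<Theta> K) s t" for s t
      using \<Theta>[OF ker_bdd_scale[OF K]] \<Theta>[OF K] F_scale[OF ker_unit_block_fin_ker[OF K]]
      by (simp only: ker_unit_block_simps ker_scale_def[of k "\<Theta> K"])
    then show "\<Theta> (ker_scale k K) = ker_scale k (\<Theta> K)" by (intro ext)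
  next
    fix N m assume bdd: "\<forall>a b. m a b \<in> ker_bdd unit_ker" and m: "block_pos N m"
    show "block_pos N (\<lambda>a b. \<Theta> (m a b))"
      unfolding block_pos_def
    proof (intro allI)
      fix n and s :: "nat \<Rightarrow> 'a gns_point" and A :: "nat \<Rightarrow> nat \<Rightarrow> complex"
      \<comment> \<open>Testing complete positivity at A and s is evaluating F at this one matrix,
        which is positive because its form is a form of the block matrix m at combined vectors
        \<open>B a\<close>.\<close>
      define z where "z = (\<Sum>a<N. \<Sum>b<N. \<Sum>i<n. \<Sum>j<n.
        ker_scale (cnj (A a i) * A b j) (ker_unit_block (s i) (s j) (m a b)))"
      have mem: "ker_scale k (ker_unit_block s t (m a b)) \<in> fin_ker unit_ker"
        for k a b and s t :: "'a gns_point"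
        using bdd by (intro E.E_scale ker_unit_block_fin_ker) blast
      have z: "z \<in> fin_ker unit_ker" unfolding z_def by (intro E_sum mem)
      have "F z = (\<Sum>a<N. \<Sum>b<N. \<Sum>i<n. \<Sum>j<n.
        F (ker_scale (cnj (A a i) * A b j) (ker_unit_block (s i) (s j) (m a b))))"
        unfolding z_def by (subst F_sum, simp, intro E_sum mem, intro sum.cong refl)+
      also have "\<dots> = (\<Sum>a<N. \<Sum>b<N. ker_form n s (A a) (A b) (\<Theta> (m a b)))"
        using bdd unfolding ker_form_def
        by (intro sum.cong refl) (simp add: F_scale ker_unit_block_fin_ker \<Theta>)
      finally have Fz: "F z = (\<Sum>a<N. \<Sum>b<N. ker_form n s (A a) (A b) (\<Theta> (m a b)))" .
      have "pos_def z"
        unfolding pos_def_def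
      proof (intro allI)
        fix M and \<sigma> :: "nat \<Rightarrow> 'a gns_point \<times> 'a gns_point" and c :: "nat \<Rightarrow> complex"
        define B where "B = (\<lambda>a k. \<Sum>i<n. A a i * row_coeff \<sigma> (s i) c k)"
        have "ker_form M \<sigma> c c z = (\<Sum>a<N. \<Sum>b<N. ker_form M (snd \<circ> \<sigma>) (B a) (B b) (m a b))"
          unfolding z_def B_def ker_form_sum ker_form_scale ker_form_unit_block ker_form_coeff_sum
            ker_form_coeff
          by (simp only: sum_distrib_left mult.assoc)
        then show "0 \<le> ker_form M \<sigma> c c z" using block_posD[OF m] by (simp only:)
      qed
      then have "0 \<le> F z" using F_pos[OF cone_pos_def[OF z]] by blast
      then show "0 \<le> (\<Sum>a<N. \<Sum>b<N. ker_form n s (A a) (A b) (\<Theta> (m a b)))" unfolding Fz .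
    qed
  next
    show "\<Theta> unit_ker = unit_ker" using fixed[of e] by (simp only: \<iota>_e)
  next
    fix K assume "K \<notin> ker_bdd unit_ker"
    then show "\<Theta> K = 0" by (simp only: \<Theta>_def if_False)
  qed
  moreover have "\<Theta> (rep (\<iota> p * \<iota> (e - p))) = 0"
  \<comment> \<open>Each diagonal value is F at a block that lies in the cone together with its
    negative.\<close>
  proof (rule pos_def_zero_diagonal)
    let ?K = "rep (\<iota> p * \<iota> (e - p))"
    have "block_pos 1 (\<lambda>a b. \<Theta> ?K)"
      by (rule ucp_pos[OF \<open>ucp unit_ker \<Theta>\<close>, of "\<lambda>a b. ?K"])
        (simp_all only: rep_bdd block_pos_one pos_def_pq)
    then show "pos_def (\<Theta> ?K)" by (simp only: block_pos_one)
    fix s :: "'a gns_point"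
    have z: "ker_unit_block s s ?K \<in> fin_ker unit_ker" by (rule ker_unit_block_fin_ker[OF rep_bdd])
    have "0 \<le> F (ker_unit_block s s ?K)"
      by (rule F_pos[OF cone_pos_def[OF z pos_def_unit_block[OF pos_def_pq]]])
    moreover have "0 \<le> - F (ker_unit_block s s ?K)"
      using F_pos[OF cone_neg_pq[of s]] F_scale[OF z, of "-1"] by (simp only: mult_minus1)
    ultimately have "F (ker_unit_block s s ?K) = 0" by (simp add: less_eq_complex_def complex_eq_iff)
    then show "\<Theta> ?K s s = 0" by (simp only: \<Theta>[OF rep_bdd])
  qed
  ultimately show ?thesis using fixed by blast
qed

end

section \<open>The boundary ideal of an idempotent completely positive map\<close>

context cstar
begin

text \<open>Left multiplication by b on the vectors of the representation. Kernels carry no product,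
  so multiplying a represented element by b amounts to moving a point.\<close>

definition move :: "'a \<Rightarrow> 'a gns_point \<Rightarrow>
    'a gns_point" where
  "move b = (\<lambda>(f, i, d). (f, i, b * d))"

lemma rep_move_right: "rep a x (move b y) = rep (a * b) x y"
  by (cases x; cases y) (auto simp: rep_def move_def mult.assoc)

lemma rep_move_left: "rep a (move b x) y = rep (st b * a) x y"
  by (cases x; cases y) (auto simp: rep_def move_def st_mult mult.assoc)

text \<open>Boundedness comes from \<open>ucp_ball\<close> on the open unit ball, by rescaling.
  Continuity is what makes the set of multipliers and the ideal below closed.\<close>

lemma continuous_ucp_rep:
  assumes \<Phi>: "ucp unit_ker \<Phi>"
  shows "continuous_on UNIV (\<lambda>a. \<Phi> (rep a) x y)"
proof -
  define B where "B = Re (unit_ker x x) + Re (unit_ker y y)"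
  have ball: "2 * cmod (\<Phi> (rep a) x y) \<le> B" if "norm a < 1" for a
    using ker_ball_entry[OF ucp_ball[OF pos_def_unit \<Phi> _ rep_ball[OF that]], of x y]
    by (simp add: B_def)
  have scale: "\<Phi> (rep (r *\<^sub>R a)) x y = of_real r * \<Phi> (rep a) x y" for r a
    unfolding rep_scaleR ucp_scale[OF \<Phi> rep_bdd] by (simp add: ker_scale_def)
  have "bounded_linear (\<lambda>a. \<Phi> (rep a) x y)"
  proof (rule bounded_linear_intro[where K = B])
    show "\<Phi> (rep (a + b)) x y = \<Phi> (rep a) x y + \<Phi> (rep b) x y" for a b
      unfolding rep_add ucp_add[OF \<Phi> rep_bdd rep_bdd] by simp
    show "\<Phi> (rep (r *\<^sub>R a)) x y = r *\<^sub>R \<Phi> (rep a) x y" for r a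
      unfolding scale by (simp add: scaleR_conv_of_real)
    show "norm (\<Phi> (rep a) x y) \<le> norm a * B" for a
    proof (cases "a = 0")
      case True
      then show ?thesis using scale[of 0 a] by simp
    next
      case False
      define r where "r = inverse (2 * norm a)"
      have "norm (r *\<^sub>R a) < 1" using False by (simp add: r_def)
      moreover have "r > 0" using False by (simp add: r_def)
      ultimately have "2 * (r * cmod (\<Phi> (rep a) x y)) \<le> B"
        using ball[of "r *\<^sub>R a"] by (simp add: scale norm_mult)
      then show ?thesis using False by (simp add: r_def field_simps)
    qed
  qed
  then show ?thesis by (rule linear_continuous_on)
qed

end

context projection_system
begin

text \<open>This is the identity \<open>\<Phi> (v * a) = \<Phi> (v * \<Phi> a)\<close> of Choi and Effros in the case \<open>\<Phi> a = 0\<close>. The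
  Schur complement of \<open>\<Phi>\<close> applied to the square of the row \<open>(v*, 1, a)\<close> has the corner
  \<open>\<Phi> (v v*) - v v*\<close>, which \<open>\<Phi>\<close> annihilates.\<close>

lemma ucp_zero_left:
  assumes \<Phi>: "ucp unit_ker \<Phi>" and fixed: "\<And>v. \<Phi> (rep (\<iota> v)) = rep (\<iota> v)"
    and idem: "\<And>K. \<Phi> (\<Phi> K) = \<Phi> K" and a: "\<Phi> (rep a) = 0"
  shows "\<Phi> (rep (\<iota> v * a)) = 0"
proof -
  define V where "V = \<iota> v"
  define R where "R = (norm a)\<^sup>2 + 1"
  have "(norm a)\<^sup>2 < R" by (simp add: R_def)
  then obtain s where s: "st s = s" "s * s = R *\<^sub>R 1 - st a * a" by (rule ex_sqrt_diff)
  \<comment> \<open>Rows \<open>(st V, 1, a)\<close> and \<open>(0, 0, s)\<close>; the second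
    replaces the corner \<open>st a * a\<close> by \<open>R *\<^sub>R 1\<close>.\<close>
  define y where "y = (\<lambda>m i :: nat. if m = (0::nat) then (if i = 0 then st V else if i = 1 then 1 else a)
    else (if i = 2 then s else 0))"
  define X where "X = (\<lambda>i j. st (y 0 i) * y 0 j + st (y 1 i) * y 1 j)"
  have "sum_squares 3 X"
    by (rule sum_squaresI[where M = 2 and y = y]) (simp add: X_def numeral_2_eq_2)
  then have "block_pos 3 (\<lambda>i j. rep (X i j))" by (rule rep_pos)
  then have pos: "block_pos 3 (\<lambda>i j. \<Phi> (rep (X i j)))" by (rule ucp_pos[OF \<Phi> rep_bdd])
  have X: "X 0 0 = V * st V" "X 0 1 = V" "X 0 2 = V * a" "X 1 0 = st V" "X 1 1 = 1" "X 1 2 = a"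
    "X 2 0 = st a * st V" "X 2 1 = st a" "X 2 2 = R *\<^sub>R 1"
    by (simp_all add: X_def y_def st_st st_one st_zero s)
  have n01: "\<Phi> (rep V) = rep V" and n10: "\<Phi> (rep (st V)) = rep (st V)" and n11: "\<Phi> (rep 1) = rep 1"
    using fixed[of v] fixed[of "sv v"] fixed[of e] by (simp_all add: V_def \<iota>_st \<iota>_e)
  have n21: "\<Phi> (rep (st a)) = 0"
  proof -
    have "\<Phi> (rep (X 2 1)) = ker_adj (\<Phi> (rep (X 1 2)))"
      by (rule block_pos_adj[OF pos]) simp_all
    then show ?thesis unfolding X a by simp
  qed
  have n22: "\<Phi> (rep (R *\<^sub>R 1)) = ker_scale (of_real R) unit_ker"
    unfolding rep_scaleR ucp_scale[OF \<Phi> rep_bdd] n11 ..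
  define P where "P = \<Phi> (rep (V * st V)) - rep (V * st V)"
  have "block_pos 2 (block2 P (\<Phi> (rep (V * a))) (\<Phi> (rep (st a * st V)))
      (ker_scale (of_real R) unit_ker))"
    unfolding block_pos_two
  proof (intro allI)
    fix n :: nat and s :: "nat \<Rightarrow> 'a gns_point" and c d :: "nat \<Rightarrow> complex"
    \<comment> \<open>The points are doubled and the copies moved by \<open>st V\<close>: the test
      vector is \<open>(c, - st V c, d)\<close>, which eliminates the middle row inside the
      form.\<close>
    define S where "S = (\<lambda>m. if m < n then s m else move (st V) (s (m - n)))"
    define A where "A = (\<lambda>(i::nat) m. if i = 0 then (if m < n then c m else 0) else if i = 1 then
      (if m < n then 0 else - c (m - n)) else (if m < n then d m else 0))"
    have "0 \<le> (\<Sum>i<3. \<Sum>j<3. ker_form (n + n) S (A i) (A j) (\<Phi> (rep (X i j))))"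
      by (rule block_posD[OF pos])
    also have "\<dots> = ker_form (n + n) S (A 0) (A 0) (\<Phi> (rep (V * st V))) +
        ker_form (n + n) S (A 0) (A 1) (rep V) + ker_form (n + n) S (A 0) (A 2) (\<Phi> (rep (V * a))) +
        (ker_form (n + n) S (A 1) (A 0) (rep (st V)) + ker_form (n + n) S (A 1) (A 1) (rep 1) +
         ker_form (n + n) S (A 1) (A 2) 0) +
        (ker_form (n + n) S (A 2) (A 0) (\<Phi> (rep (st a * st V))) + ker_form (n + n) S (A 2) (A 1) 0 +
         ker_form (n + n) S (A 2) (A 2) (ker_scale (of_real R) unit_ker))"
    proof -
      have sum3: "(\<Sum>i<3. h i) = h 0 + h 1 + h 2" for h :: "nat \<Rightarrow> complex"
        by (simp add: eval_nat_numeral)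
      show ?thesis unfolding sum3 X n01 n10 n11 n21 n22 a ..
    qed
    also have "ker_form (n + n) S (A 0) (A 0) K = ker_form n s c c K" for K
      unfolding ker_form_concat by (simp add: ker_form_def S_def A_def)
    also have "ker_form (n + n) S (A 0) (A 2) K = ker_form n s c d K" for K
      unfolding ker_form_concat by (simp add: ker_form_def S_def A_def)
    also have "ker_form (n + n) S (A 2) (A 0) K = ker_form n s d c K" for K
      unfolding ker_form_concat by (simp add: ker_form_def S_def A_def)
    also have "ker_form (n + n) S (A 2) (A 2) K = ker_form n s d d K" for K
      unfolding ker_form_concat by (simp add: ker_form_def S_def A_def)
    also have "ker_form (n + n) S (A 0) (A 1) (rep V) = - ker_form n s c c (rep (V * st V))"
      unfolding ker_form_concat by (simp add: ker_form_def S_def A_def rep_move_right sum_negf)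
    also have "ker_form (n + n) S (A 1) (A 0) (rep (st V)) = - ker_form n s c c (rep (V * st V))"
      unfolding ker_form_concat by (simp add: ker_form_def S_def A_def rep_move_left st_st sum_negf)
    also have "ker_form (n + n) S (A 1) (A 1) (rep 1) = ker_form n s c c (rep (V * st V))"
      unfolding ker_form_concat
      by (simp add: ker_form_def S_def A_def rep_move_left rep_move_right st_st)
    finally show "0 \<le> ker_form n s c c P + ker_form n s c d (\<Phi> (rep (V * a))) +
       ker_form n s d c (\<Phi> (rep (st a * st V))) +
       ker_form n s d d (ker_scale (of_real R) unit_ker)"
      unfolding P_def ker_form_diff ker_form_zero by (simp add: algebra_simps)
  qed
  moreover have "P \<in> ker_bdd unit_ker"
    unfolding P_def by (intro ker_bdd_diff ucp_bdd[OF pos_def_unit \<Phi>] rep_bdd)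
  moreover have "ker_scale (of_real R) unit_ker \<in> ker_bdd unit_ker"
    by (intro ker_bdd_scale rep_bdd)
  ultimately have "block_pos 2 (block2 (\<Phi> P) (\<Phi> (\<Phi> (rep (V * a)))) (\<Phi> (\<Phi> (rep (st a * st V))))
      (\<Phi> (ker_scale (of_real R) unit_ker)))"
    using ucp_bdd[OF pos_def_unit \<Phi>] by (intro ucp_pos_two[OF \<Phi>])
  moreover have "\<Phi> P = 0"
    unfolding P_def ucp_diff[OF \<Phi> ucp_bdd[OF pos_def_unit \<Phi>] rep_bdd] idem by simp
  ultimately have "block_pos 2 (block2 0 (\<Phi> (rep (V * a))) (\<Phi> (rep (st a * st V)))
      (\<Phi> (ker_scale (of_real R) unit_ker)))"
    by (simp only: idem)
  then show ?thesis unfolding V_def by (rule block_pos_two_zero)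
qed

text \<open>As \<open>p q\<close> is a sum of squares, so is the block matrix with diagonal
  \<open>p q\<close> and \<open>st c * (p q) * c\<close>. Since \<Phi> annihilates the first corner,
  it also annihilates the entry beside it.\<close>

lemma ucp_zero_right:
  assumes \<Phi>: "ucp unit_ker \<Phi>" and pq: "\<Phi> (rep (\<iota> p * \<iota> (e - p))) = 0"
  shows "\<Phi> (rep (\<iota> p * \<iota> (e - p) * c)) = 0"
proof -
  obtain y z where yz: "\<iota> p * \<iota> (e - p) = st y * y + st z * z" by (rule pq_squares)
  define w where "w = (\<lambda>m i :: nat. if m = (0::nat) then (if i = 0 then y else y * c)
    else (if i = 0 then z else z * c))"
  have "sum_squares 2 (block2 (\<iota> p * \<iota> (e - p)) (\<iota> p * \<iota> (e - p) * c)
      (st c * (\<iota> p * \<iota> (e - p))) (st c * (\<iota> p * \<iota> (e - p)) * c))"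
    by (rule sum_squaresI[where M = 2 and y = w])
      (simp add: yz block2_def w_def numeral_2_eq_2 st_mult algebra_simps)
  from ucp_pos[OF \<Phi> rep_bdd rep_pos[OF this]]
  have "block_pos 2 (block2 (\<Phi> (rep (\<iota> p * \<iota> (e - p)))) (\<Phi> (rep (\<iota> p * \<iota> (e - p) * c)))
      (\<Phi> (rep (st c * (\<iota> p * \<iota> (e - p))))) (\<Phi> (rep (st c * (\<iota> p * \<iota> (e - p)) * c))))"
    unfolding block2_map[of "\<lambda>a. \<Phi> (rep a)"] .
  then show ?thesis unfolding pq by (rule block_pos_two_zero)
qed

text \<open>\<open>ucp_zero_left\<close> gives stability of the kernel under left multiplication by
  the system. The left multipliers form a closed star subalgebra, hence are the whole generated
  algebra, and with \<open>ucp_zero_right\<close> all \<open>b * pq * c\<close> lie in the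
  kernel.\<close>

lemma projection_if_no_boundary_ideal:
  assumes gen: "cstar_gen sc st (range \<iota>) = UNIV"
    and trivial: "\<And>I. boundary_ideal sm C sc st \<iota> I \<Longrightarrow> I = {0}"
  shows "\<iota> p * \<iota> p = \<iota> p"
proof -
  define pq where "pq = \<iota> p * \<iota> (e - p)"
  obtain \<Theta> where \<Theta>: "ucp unit_ker \<Theta>" "\<forall>v. \<Theta> (rep (\<iota> v)) = rep (\<iota> v)" "\<Theta> (rep pq) = 0"
    using ex_compression unfolding pq_def by (elim exE conjE)
  define R where "R = {(K, L). (\<exists>v. K = rep (\<iota> v) \<and> L = K) \<or> (K = rep pq \<and> L = 0)}"
  have "\<exists>\<Phi>. ucp unit_ker \<Phi> \<and> (\<forall>K L. (K, L) \<in> R \<longrightarrow> \<Phi> K = L) \<and> (\<forall>K. \<Phi> (\<Phi> K) = \<Phi> K)"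
    by (rule idempotent_ucp[OF pos_def_unit \<Theta>(1)]) (use \<Theta>(2,3) in \<open>auto simp: R_def\<close>)
  then obtain \<Phi> where \<Phi>: "ucp unit_ker \<Phi>" and \<Phi>R: "\<forall>K L. (K, L) \<in> R \<longrightarrow> \<Phi> K = L"
    and idem': "\<forall>K. \<Phi> (\<Phi> K) = \<Phi> K" by (elim exE conjE)
  have idem: "\<Phi> (\<Phi> K) = \<Phi> K" for K using idem' by (rule spec)
  have fixed: "\<Phi> (rep (\<iota> v)) = rep (\<iota> v)" for v
    by (rule \<Phi>R[rule_format]) (auto simp: R_def)
  have \<Phi>pq: "\<Phi> (rep pq) = 0" by (rule \<Phi>R[rule_format]) (auto simp: R_def)
  have \<Phi>add: "\<Phi> (rep (a + b)) = \<Phi> (rep a) + \<Phi> (rep b)" for a b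
    unfolding rep_add by (rule ucp_add[OF \<Phi> rep_bdd rep_bdd])
  have \<Phi>sc: "\<Phi> (rep (sc c a)) = ker_scale c (\<Phi> (rep a))" for c a
    unfolding rep_sc by (rule ucp_scale[OF \<Phi> rep_bdd])
  have closed: "closed {b. \<Phi> (rep (b * y)) = 0}" "closed {b. \<Phi> (rep (st b * y)) = 0}"
    "closed {b. \<Phi> (rep (x * b * y)) = 0}" for x y
  proof -
    have c: "continuous_on UNIV (\<lambda>b. \<Phi> (rep (f b)) k l)" if "continuous_on UNIV f" for f :: "'a \<Rightarrow> 'a" and k l
      by (rule continuous_on_compose2[OF continuous_ucp_rep[OF \<Phi>] that]) simp
    have st: "continuous_on UNIV st" by (rule linear_continuous_on[OF st_bounded_linear])
    have cl: "closed {b. \<Phi> (rep (f b)) = 0}" if "continuous_on UNIV f" for f :: "'a \<Rightarrow> 'a"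
      unfolding fun_eq_iff by (intro closed_Collect_all closed_Collect_eq c that continuous_on_const)
    show "closed {b. \<Phi> (rep (b * y)) = 0}" "closed {b. \<Phi> (rep (st b * y)) = 0}"
      "closed {b. \<Phi> (rep (x * b * y)) = 0}"
      by (intro cl continuous_on_mult continuous_on_const continuous_on_id st)+
  qed
  \<comment> \<open>Stability under \<open>st b\<close> is included to make T closed under the
    star.\<close>
  define T where "T = {b. \<forall>y. \<Phi> (rep y) = 0 \<longrightarrow> \<Phi> (rep (b * y)) = 0 \<and> \<Phi> (rep (st b * y)) = 0}"
  have TI: "b \<in> T" if "\<And>y. \<Phi> (rep y) = 0 \<Longrightarrow> \<Phi> (rep (b * y)) = 0"
    "\<And>y. \<Phi> (rep y) = 0 \<Longrightarrow> \<Phi> (rep (st b * y)) = 0" for b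
    unfolding T_def using that by simp
  have TD: "\<Phi> (rep (b * y)) = 0" "\<Phi> (rep (st b * y)) = 0" if "b \<in> T" "\<Phi> (rep y) = 0" for b y
    using that by (auto simp: T_def)
  have "cstar_sub sc st T"
    unfolding cstar_sub_def
  proof (intro conjI ballI allI)
    show "1 \<in> T" by (rule TI) (simp_all add: st_one)
    show "a + b \<in> T" if "a \<in> T" "b \<in> T" for a b
      by (rule TI) (simp_all only: st_add distrib_right \<Phi>add TD[OF that(1)] TD[OF that(2)] add_0)
    show "a * b \<in> T" if "a \<in> T" "b \<in> T" for a b
      by (rule TI) (simp_all only: st_mult mult.assoc TD[OF that(1)] TD[OF that(2)])
    show "sc c a \<in> T" if "a \<in> T" for c a
      by (rule TI)
        (simp_all only: st_sc sc_mult_left[symmetric] \<Phi>sc TD[OF that] ker.scale_zero_right)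
    show "st a \<in> T" if "a \<in> T" for a
      by (rule TI) (simp_all only: st_st TD[OF that])
    have "T = (\<Inter>y\<in>{y. \<Phi> (rep y) = 0}. {b. \<Phi> (rep (b * y)) = 0} \<inter> {b. \<Phi> (rep (st b * y)) = 0})"
      by (auto simp: T_def)
    also have "closed \<dots>" by (intro closed_INT ballI closed_Int closed)
    finally show "closed T" .
  qed
  moreover have "range \<iota> \<subseteq> T"
  proof (rule subsetI, elim rangeE)
    fix b v assume "b = \<iota> v"
    then show "b \<in> T"
      using ucp_zero_left[OF \<Phi> fixed idem, of _ v] ucp_zero_left[OF \<Phi> fixed idem, of _ "sv v"]
      by (intro TI) (simp_all add: \<iota>_st)
  qed
  ultimately have "cstar_gen sc st (range \<iota>) \<subseteq> T" unfolding cstar_gen_def by blast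
  then have T: "b \<in> T" for b using gen by blast
  define I where "I = {a. \<forall>b c. \<Phi> (rep (b * a * c)) = 0}"
  have II: "a \<in> I" if "\<And>b c. \<Phi> (rep (b * a * c)) = 0" for a
    unfolding I_def using that by simp
  have ID: "\<Phi> (rep (b * a * c)) = 0" if "a \<in> I" for a b c
    using that by (simp only: I_def mem_Collect_eq)
  have \<iota>I: "v = 0" if "\<iota> v \<in> I" for v
  proof (rule rep_\<iota>_eq_zero)
    show "rep (\<iota> v) = 0" using ID[OF that, of 1 1] fixed[of v] by simp
  qed
  have zero_I: "0 \<in> I" by (rule II) (simp only: mult_zero_left mult_zero_right rep_zero ucp_zero[OF \<Phi>])
  have "closed_ideal sc I"
    unfolding closed_ideal_def
  proof (intro conjI ballI allI)
    have "1 \<notin> I"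
    proof
      assume "1 \<in> I"
      then have "e = 0" using \<iota>I[of e] by (simp only: \<iota>_e)
      then show False using \<iota>_e \<iota>_zero by simp
    qed
    then show "I \<noteq> UNIV" by blast
    show "0 \<in> I" by (rule zero_I)
    show "a + b \<in> I" if "a \<in> I" "b \<in> I" for a b
      by (rule II) (simp only: distrib_left distrib_right \<Phi>add ID[OF that(1)] ID[OF that(2)] add_0)
    show "sc c a \<in> I" if "a \<in> I" for c a
      by (rule II)
        (simp only: sc_mult_left[symmetric] sc_mult_right[symmetric] \<Phi>sc ID[OF that] ker.scale_zero_right)
    show "a * b \<in> I" if "b \<in> I" for a b
    proof (rule II)
      fix x y show "\<Phi> (rep (x * (a * b) * y)) = 0" using ID[OF that, of "x * a" y] by (simp add: mult.assoc)
    qed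
    show "b * a \<in> I" if "b \<in> I" for a b
    proof (rule II)
      fix x y show "\<Phi> (rep (x * (b * a) * y)) = 0" using ID[OF that, of x "a * y"] by (simp add: mult.assoc)
    qed
    have "I = (\<Inter>b. \<Inter>c. {a. \<Phi> (rep (b * a * c)) = 0})" by (auto simp: I_def)
    also have "closed \<dots>" by (intro closed_INT ballI closed)
    finally show "closed I" .
  qed
  moreover have "x \<in> C n \<longleftrightarrow> (\<exists>y. mpos st n y \<and> (\<forall>i<n. \<forall>j<n. \<iota> (x i j) - y i j \<in> I))"
    if x: "x \<in> Mat n" for n x
  proof
    assume "x \<in> C n"
    then have "mpos st n (\<lambda>i j. \<iota> (x i j))" using C_iff_mpos[OF x] by blast
    then show "\<exists>y. mpos st n y \<and> (\<forall>i<n. \<forall>j<n. \<iota> (x i j) - y i j \<in> I)"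
      by (intro exI[of _ "\<lambda>i j. \<iota> (x i j)"] conjI allI impI) (simp_all only: diff_self zero_I)
  next
    assume "\<exists>y. mpos st n y \<and> (\<forall>i<n. \<forall>j<n. \<iota> (x i j) - y i j \<in> I)"
    then obtain y where y: "mpos st n y" "\<forall>i<n. \<forall>j<n. \<iota> (x i j) - y i j \<in> I"
      by (elim exE conjE)
    \<comment> \<open>With b = c = 1, \<Phi> annihilates \<open>rep\<close> of I, so it sends a
      positive representative of the class to the element of the system itself.\<close>
    have eq: "\<Phi> (rep (y i j)) = rep (\<iota> (x i j))" if "i < n" "j < n" for i j
    proof -
      have "\<Phi> (rep (\<iota> (x i j) - y i j)) = 0"
        using ID[of "\<iota> (x i j) - y i j" 1 1] y(2) that by simp
      then show ?thesis unfolding rep_diff ucp_diff[OF \<Phi> rep_bdd rep_bdd] fixed by simp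
    qed
    have "block_pos n (\<lambda>i j. \<Phi> (rep (y i j)))"
      by (rule ucp_pos[OF \<Phi> rep_bdd rep_pos[OF mpos_sum_squares[OF y(1)]]])
    then have pos: "block_pos n (\<lambda>i j. rep (\<iota> (x i j)))"
      unfolding block_pos_def by (simp add: eq cong: sum.cong_simp)
    \<comment> \<open>\<open>C_of_rep\<close> asks for a hermitian matrix; positive block matrices
      are hermitian and \<open>rep\<close> is injective on the system.\<close>
    have herm: "sv (x j i) = x i j" if "i < n" "j < n" for i j
    proof -
      have "rep (\<iota> (x i j)) = ker_adj (rep (\<iota> (x j i)))" using block_pos_adj[OF pos that(2,1)] .
      then have "rep (\<iota> (sv (x j i) - x i j)) = 0"
        unfolding \<iota>_diff rep_diff \<iota>_st rep_adj by simp
      then show ?thesis using rep_\<iota>_eq_zero by (metis eq_iff_diff_eq_0)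
    qed
    have "mstar sv n x = x"
      using x by (auto simp: mstar_def fun_eq_iff Mat_def herm)
    then show "x \<in> C n" using C_of_rep[OF x _ pos] by blast
  qed
  ultimately have "boundary_ideal sm C sc st \<iota> I"
    unfolding boundary_ideal_def using \<iota>I by simp
  then have "I = {0}" by (rule trivial)
  moreover have "pq \<in> I"
  proof (rule II)
    fix b c
    have "\<Phi> (rep (pq * c)) = 0"
      using ucp_zero_right[OF \<Phi> \<Phi>pq[unfolded pq_def]] by (simp only: pq_def)
    then show "\<Phi> (rep (b * pq * c)) = 0" using TD(1)[OF T] by (simp only: mult.assoc)
  qed
  ultimately have "pq = 0" by blast
  then show ?thesis by (simp add: pq_def \<iota>_q right_diff_distrib)
qed

end

theorem theorem5p8:
  fixes sm :: "complex \<Rightarrow> 'v::ab_group_add \<Rightarrow> 'v" and st :: "'v \<Rightarrow> 'v"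
    and C :: "nat \<Rightarrow> (nat \<Rightarrow> nat \<Rightarrow> 'v) set" and e p :: 'v
    and scA :: "complex \<Rightarrow> 'a::{real_normed_algebra_1,banach} \<Rightarrow> 'a" and stA :: "'a \<Rightarrow> 'a"
    and \<iota> :: "'v \<Rightarrow> 'a"
  assumes "operator_system sm st C e"
    and "abstract_projection sm st C e p"
    and "cstar_envelope sm C e scA stA \<iota>"
  shows "stA (\<iota> p) = \<iota> p \<and> \<iota> p * \<iota> p = \<iota> p"
proof -
  have env: "cstar_alg scA stA" "ucoe sm C e scA stA \<iota>" "cstar_gen scA stA (range \<iota>) = UNIV"
    "\<forall>I. boundary_ideal sm C scA stA \<iota> I \<longrightarrow> I = {0}"
    using assms(3) unfolding cstar_envelope_def by simp_all
  interpret projection_system sm st C e scA stA \<iota> p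
    by unfold_locales (fact assms(1) env(1) env(2) assms(2))+
  show ?thesis
    using st_p projection_if_no_boundary_ideal[OF env(3) env(4)[rule_format]] by blast
qed

end
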